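(* Let $k$ be a positive integer and let $G$ be a graph that is $(3k-3)$-edge-connected or $(2k-2)$-tree-connected. (a) $G$ can be edge-decomposed into $k$ factors $G_1,\ldots, G_k$ such that $d_{G_i}(v)\ge \lfloor d_G(v)/k\rfloor$ for every vertex $v$ and every $1\le i\le k$, if and only if at least one of the following holds: $\sum_{v\in V(G)}\lfloor d_G(v)/k\rfloor$ is even; or $\sum_{v\in V(G)}[d_G(v)]_k\ge k-1$. (b) $G$ can be edge-decomposed into $k$ factors $G_1,\ldots, G_k$ such that $d_{G_i}(v)\le \lceil d_G(v)/k\rceil$ for every vertex $v$ and every $1\le i\le k$, if and only if at least one of the following holds: $\sum_{v\in V(G)}\lceil d_G(v)/k\rceil$ is even; or $\sum_{v\in V(G)}[k-d_G(v)]_k\ge k-1$.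
   Context: Graphs may have loops and multiple edges; $d_G(v)$ is the degree of $v$ in $G$ (a loop counts twice). For an integer $x$, $[x]_k$ is the unique integer in $\{0,\ldots,k-1\}$ congruent to $x$ modulo $k$. A factor of $G$ is a spanning subgraph of $G$; $G$ is edge-decomposed into factors if their edge sets partition $E(G)$. For a vertex set $A$, $d_G(A)$ is the number of edges of $G$ with exactly one end in $A$; $G$ is $\lambda$-edge-connected if $d_G(A)\ge\lambda$ for every nonempty proper subset $A$ of $V(G)$. A graph is $m$-tree-connected if it contains $m$ edge-disjoint spanning trees. *)

theory Defs
  imports Complex_Main "HOL-Library.Uprod" "HOL-Library.Disjoint_Sets"
begin

text \<open>
  Edges are named objects whose ends form an unordered pair, so parallel edges are distinct
  elements of \<open>edges G\<close> and an edge with ends \<open>Upair v v\<close> is a loop at \<open>v\<close>.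
\<close>

record ('v, 'e) mgraph =
  verts :: "'v set"
  edges :: "'e set"
  ends :: "'e \<Rightarrow> 'v uprod"

locale multigraph =
  fixes G :: "('v, 'e) mgraph"
  assumes finite_verts: "finite (verts G)"
    and finite_edges: "finite (edges G)"
    and ends_in_verts: "e \<in> edges G \<Longrightarrow> set_uprod (ends G e) \<subseteq> verts G"

text \<open>The second summand makes a loop at \<open>v\<close> contribute two.\<close>

definition degree :: "('v, 'e) mgraph \<Rightarrow> 'v \<Rightarrow> nat" where
  "degree G v = card {e \<in> edges G. v \<in> set_uprod (ends G e)}
              + card {e \<in> edges G. ends G e = Upair v v}"

definition cut_degree :: "('v, 'e) mgraph \<Rightarrow> 'v set \<Rightarrow> nat" where
  "cut_degree G A = card {e \<in> edges G. \<exists>u v. ends G e = Upair u v \<and> u \<in> A \<and> v \<notin> A}"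

definition edge_connected :: "nat \<Rightarrow> ('v, 'e) mgraph \<Rightarrow> bool" where
  "edge_connected l G \<longleftrightarrow> (\<forall>A. A \<noteq> {} \<and> A \<subset> verts G \<longrightarrow> l \<le> cut_degree G A)"

definition is_factor :: "('v, 'e) mgraph \<Rightarrow> ('v, 'e) mgraph \<Rightarrow> bool" where
  "is_factor H G \<longleftrightarrow> verts H = verts G \<and> edges H \<subseteq> edges G \<and>
     (\<forall>e \<in> edges H. ends H e = ends G e)"

text \<open>As usual for decompositions, a factor may have no edges.\<close>

definition edge_decomposition ::
    "('v, 'e) mgraph \<Rightarrow> nat \<Rightarrow> (nat \<Rightarrow> ('v, 'e) mgraph) \<Rightarrow> bool" where
  "edge_decomposition G k H \<longleftrightarrow>
     (\<forall>i \<in> {1..k}. is_factor (H i) G) \<and>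
     (\<Union>i \<in> {1..k}. edges (H i)) = edges G \<and>
     disjoint_family_on (\<lambda>i. edges (H i)) {1..k}"

definition adjacency :: "('v, 'e) mgraph \<Rightarrow> 'v rel" where
  "adjacency G = {(u, v). \<exists>e \<in> edges G. ends G e = Upair u v}"

definition connected_graph :: "('v, 'e) mgraph \<Rightarrow> bool" where
  "connected_graph G \<longleftrightarrow> (\<forall>u \<in> verts G. \<forall>v \<in> verts G. (u, v) \<in> (adjacency G)\<^sup>*)"

text \<open>
  The cycle visits \<open>vs ! 0, vs ! 1, \<dots>\<close> and \<open>es ! i\<close> leads from \<open>vs ! i\<close> to the cyclically next
  vertex; a loop is a cycle of length one and two parallel edges form a cycle of length two.
\<close>

definition is_cycle :: "('v, 'e) mgraph \<Rightarrow> 'v list \<Rightarrow> 'e list \<Rightarrow> bool" where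
  "is_cycle G vs es \<longleftrightarrow> vs \<noteq> [] \<and> length es = length vs \<and> distinct vs \<and> distinct es \<and>
     set es \<subseteq> edges G \<and>
     (\<forall>i < length vs. ends G (es ! i) = Upair (vs ! i) (vs ! (Suc i mod length vs)))"

definition is_tree :: "('v, 'e) mgraph \<Rightarrow> bool" where
  "is_tree G \<longleftrightarrow> connected_graph G \<and> \<not> (\<exists>vs es. is_cycle G vs es)"

definition tree_connected :: "nat \<Rightarrow> ('v, 'e) mgraph \<Rightarrow> bool" where
  "tree_connected m G \<longleftrightarrow>
     (\<exists>T. (\<forall>i \<in> {1..m}. is_factor (T i) G \<and> is_tree (T i)) \<and>
          disjoint_family_on (\<lambda>i. edges (T i)) {1..m})"

end

theory Submission
  imports Defs
begin

text \<open>
  Orient the edges of \<open>G\<close> and let a vertex \<open>v\<close> of degree \<open>d\<close> have outdegree \<open>x\<close> and indegree \<open>y\<close>.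
  The arcs can be coloured with \<open>k\<close> colours in such a way that at every vertex the outgoing arcs,
  and likewise the incoming arcs, are shared out among the colours as evenly as possible
  (\<open>equitable_decomposition\<close>).  Every colour class then has at \<open>v\<close> a degree between
  \<open>\<lfloor>x / k\<rfloor> + \<lfloor>y / k\<rfloor>\<close> and \<open>\<lceil>x / k\<rceil> + \<lceil>y / k\<rceil>\<close>.  The first number is \<open>\<lfloor>d / k\<rfloor>\<close> as soon as
  \<open>x mod k \<le> d mod k\<close>, the second is \<open>\<lceil>d / k\<rceil>\<close> as soon as \<open>(- x) mod k \<le> (- d) mod k\<close>.  So it is
  enough to prescribe the outdegrees modulo \<open>k\<close>, by residues in these ranges that add up to the number
  of edges modulo \<open>k\<close>; each of the two alternatives on the right-hand sides provides such residues
  (\<open>sufficient_residues\<close>).  Conversely, the degree sum of a factor is even, so if the bounds have an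
  odd sum, then every factor misses it by at least one, and adding up the \<open>k\<close> factors shows that the
  remainders have sum at least \<open>k\<close> (\<open>odd_bound_defect\<close>).

  What remains is that the outdegrees can be prescribed modulo \<open>k\<close> (\<open>modular_orientation\<close>).  For
  \<open>(3k - 3)\<close>-edge-connected graphs this is the theorem of Lovasz, Thomassen, Wu and Zhang.  It is proved
  for graphs with a root at which all arcs are oriented already, where \<open>b v\<close> is the required outdegree
  minus indegree of \<open>v\<close> modulo \<open>2k\<close>.  The hypothesis is that every proper nonempty set \<open>A\<close> of
  vertices other than the root is left by at least \<open>2k - 2 + |b(A)|\<close> edges, while the set of all
  of them is left by at most that many; here \<open>|c|\<close> denotes the distance of \<open>c\<close> from the multiples of
  \<open>2k\<close> (\<open>admissible_orientable\<close>).  If a set of two or more vertices attains the bound, contract it, orient the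
  rest, then contract the rest into the root and orient the set.  Otherwise parity leaves all these sets
  a slack of two, so that only single vertices restrict further reductions.  A vertex with target \<open>0\<close>
  can be split off, pair by pair.  An arc can be deleted when this brings both its ends closer to
  their targets.  If neither is possible, all vertices want arcs to leave, say, while the root
  sends out all its arcs.  Then one edge is traded for some arcs to the root that push the target
  of one end beyond \<open>k\<close>, where its distance from the multiples of \<open>2k\<close> decreases again.

  For a graph with \<open>2k - 2\<close> edge-disjoint spanning trees (\<open>packed_orientable\<close>), take a smallest set that
  violates the cut condition.  If it has several vertices, contract it, orient the rest by induction,
  and apply the rooted theorem inside the set: the violated inequality is the one needed at the
  root.  If it is a single vertex, its degree is at most \<open>3k - 3\<close>; lifting pairs of its edges turns the
  spanning trees into spanning trees of the other vertices and leaves enough edges at the vertex to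
  realise its target (\<open>eliminate_vertex\<close>).
\<close>

section \<open>Distance to the multiples of 2k\<close>

text \<open>
The absolute value of the representative of \<open>b\<close> modulo \<open>2k\<close> that is closest to \<open>0\<close>.
\<close>

definition cdist :: "int \<Rightarrow> int \<Rightarrow> int" where
  "cdist k b = min (b mod (2 * k)) ((- b) mod (2 * k))"

text \<open>
  The least number of edges that a set of vertices with total target \<open>c\<close> has to send out.
\<close>

abbreviation demand :: "int \<Rightarrow> int \<Rightarrow> int" where
  "demand k c \<equiv> 2 * k - 2 + cdist k c"

locale modulus =
  fixes k :: int
  assumes k_pos: "1 \<le> k"
begin

text \<open>
  The triangle inequality and the parity of \<open>cdist\<close> come from this representative \<open>b - 2kj\<close> and its
  minimality, which is the next lemma.
\<close>

lemma cdist_attained: "\<exists>j. cdist k b = \<bar>b - 2 * k * j\<bar>"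
proof (cases "b mod (2 * k) \<le> (- b) mod (2 * k)")
  case True
  then have "cdist k b = b mod (2 * k)" by (simp add: cdist_def)
  moreover have "b mod (2 * k) = b - 2 * k * (b div (2 * k))" by (simp add: minus_mult_div_eq_mod)
  moreover have "b mod (2 * k) \<ge> 0" using k_pos by simp
  ultimately show ?thesis by (metis abs_of_nonneg)
next
  case False
  then have "cdist k b = (- b) mod (2 * k)" by (simp add: cdist_def)
  moreover have "(- b) mod (2 * k) = - (b - 2 * k * (- ((- b) div (2 * k))))"
    using minus_mult_div_eq_mod[of "- b" "2 * k"] by simp
  moreover have "(- b) mod (2 * k) \<ge> 0" using k_pos by simp
  ultimately show ?thesis by (metis abs_minus_cancel abs_of_nonneg)
qed

lemma cdist_le: "cdist k b \<le> \<bar>b - 2 * k * j\<bar>"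
proof (cases "b - 2 * k * j \<ge> 0")
  case True
  have "b mod (2 * k) = (b - 2 * k * j) mod (2 * k)"
    by (simp add: mod_eq_dvd_iff)
  also have "\<dots> \<le> b - 2 * k * j" using True zmod_le_nonneg_dividend by blast
  finally show ?thesis using True by (simp add: cdist_def)
next
  case False
  have "(- b) mod (2 * k) = (- (b - 2 * k * j)) mod (2 * k)"
    by (simp add: mod_eq_dvd_iff)
  also have "\<dots> \<le> - (b - 2 * k * j)" using False zmod_le_nonneg_dividend[of "- (b - 2 * k * j)"] by simp
  finally show ?thesis using False by (simp add: cdist_def)
qed

lemma cdist_nonneg: "0 \<le> cdist k b"
  using cdist_attained[of b] by auto

lemma cdist_minus [simp]: "cdist k (- b) = cdist k b"
  by (simp add: cdist_def min.commute)

lemma cdist_cong: "2 * k dvd b - c \<Longrightarrow> cdist k b = cdist k c"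
proof -
  assume d: "2 * k dvd b - c"
  then have "2 * k dvd (- b) - (- c)" by (metis dvd_minus_iff minus_diff_eq minus_diff_minus)
  then have "(- b) mod (2 * k) = (- c) mod (2 * k)" by (simp only: mod_eq_dvd_iff)
  moreover have "b mod (2 * k) = c mod (2 * k)" using d by (simp only: mod_eq_dvd_iff)
  ultimately show ?thesis by (simp only: cdist_def)
qed

lemma cdist_add_le: "cdist k (b + c) \<le> cdist k b + cdist k c"
proof -
  obtain i j where "cdist k b = \<bar>b - 2 * k * i\<bar>" "cdist k c = \<bar>c - 2 * k * j\<bar>"
    using cdist_attained by blast
  moreover have "b + c - 2 * k * (i + j) = (b - 2 * k * i) + (c - 2 * k * j)"
    by (simp add: algebra_simps)
  ultimately show ?thesis using cdist_le[of "b + c" "i + j"] by linarith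
qed

lemma cdist_le_abs: "cdist k b \<le> \<bar>b\<bar>"
  using cdist_le[of b 0] by simp

lemma cdist_shift_le: "cdist k (b + c) \<le> cdist k b + \<bar>c\<bar>"
  using cdist_add_le[of b c] cdist_le_abs[of c] by linarith

lemma cdist_le_k: "cdist k b \<le> k"
proof -
  have "b mod (2 * k) \<le> k \<or> b mod (2 * k) - 2 * k \<ge> - k" by linarith
  moreover have "0 \<le> b mod (2 * k)" "b mod (2 * k) < 2 * k" using k_pos by auto
  moreover have "b mod (2 * k) = b - 2 * k * (b div (2 * k))" by (simp add: minus_mult_div_eq_mod)
  moreover have "b - 2 * k * (b div (2 * k) + 1) = b - 2 * k * (b div (2 * k)) - 2 * k"
    by (simp add: algebra_simps)
  ultimately show ?thesis
    using cdist_le[of b "b div (2 * k)"] cdist_le[of b "b div (2 * k) + 1"] by linarith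
qed

lemma cdist_even: "even (cdist k b + b)"
proof -
  obtain j where "cdist k b = \<bar>b - 2 * k * j\<bar>" using cdist_attained by blast
  then show ?thesis by (auto simp: abs_if)
qed

lemma cdist_zero_dvd: "cdist k b = 0 \<longleftrightarrow> 2 * k dvd b"
proof
  assume "cdist k b = 0"
  with cdist_attained[of b] show "2 * k dvd b" by (metis abs_eq_0 dvd_triv_left eq_iff_diff_eq_0)
next
  assume "2 * k dvd b"
  then show "cdist k b = 0" using cdist_cong[of b 0] by (simp add: cdist_def)
qed

lemma cdist_decrease:
  assumes "cdist k b \<noteq> 0"
  shows "cdist k (b - 1) = cdist k b - 1 \<or> cdist k (b + 1) = cdist k b - 1"
proof -
  obtain j where j: "cdist k b = \<bar>b - 2 * k * j\<bar>" using cdist_attained by blast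
  have "cdist k (b - 1) \<le> cdist k b - 1 \<or> cdist k (b + 1) \<le> cdist k b - 1"
    using cdist_le[of "b - 1" j] cdist_le[of "b + 1" j] assms j by linarith
  moreover have "cdist k b \<le> cdist k (b - 1) + 1" "cdist k b \<le> cdist k (b + 1) + 1"
    using cdist_shift_le[of "b - 1" 1] cdist_shift_le[of "b + 1" "-1"] by simp_all
  ultimately show ?thesis by linarith
qed

text \<open>
  Here \<open>d\<close> is the degree of a vertex with target \<open>b\<close>, and the last hypothesis says that the cut condition
  of the vertex would not survive the deletion of an incoming arc.  By parity, the condition is then tight
  and \<open>cdist\<close> grows from \<open>b\<close> to \<open>b + 1\<close>, so \<open>b\<close> lies above its nearest multiple of \<open>2k\<close>; at distance \<open>k\<close>
  both neighbours of \<open>b\<close> would be closer.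
\<close>

lemma cdist_at_tight_vertex:
  assumes "even (d + b)" "cdist k b \<noteq> 0" "demand k b \<le> d"
    and "d - 1 < demand k (b + 1)"
  shows "d = demand k b" "2 * k dvd b - cdist k b" "cdist k b < k"
proof -
  obtain j where j: "cdist k b = \<bar>b - 2 * k * j\<bar>" using cdist_attained by blast
  have "even (d + cdist k b)" using assms(1) cdist_even[of b] by presburger
  moreover have "cdist k (b + 1) \<le> cdist k b + 1" using cdist_shift_le[of b 1] by simp
  ultimately show d: "d = demand k b" using assms(3,4) by presburger
  have pos: "b - 2 * k * j \<ge> 0"
    using cdist_le[of "b + 1" j] assms j d by linarith
  then show "2 * k dvd b - cdist k b" using j by simp
  have "cdist k b \<noteq> k"
  proof
    assume "cdist k b = k"
    moreover have "b + 1 - 2 * k * (j + 1) = b - 2 * k * j + 1 - 2 * k" by (simp add: algebra_simps)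
    ultimately have "cdist k (b + 1) \<le> k - 1"
      using cdist_le[of "b + 1" "j + 1"] pos j k_pos by linarith
    then show False using assms(4) d \<open>cdist k b = k\<close> by linarith
  qed
  then show "cdist k b < k" using cdist_le_k[of b] by linarith
qed

text \<open>
  For a root all of whose arcs leave it, \<open>D\<close> is both its degree and its balance.  From \<open>2k\<close> to \<open>3k\<close> the
  distance of \<open>D\<close> is only \<open>D - 2k\<close>, and beyond \<open>3k - 2\<close> the bound \<open>cdist k (- D) \<le> k\<close> takes over.
\<close>

lemma root_degree_bound:
  assumes "0 \<le> D" "D \<le> demand k (- D)"
  shows "D \<le> 2 * k - 1"
  using assms cdist_le[of "- D" "-1"] cdist_le_k[of "- D"] k_pos by auto

text \<open>
  Adding \<open>c\<close> arcs into such a root raises its degree and lowers its balance by \<open>c\<close>.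
\<close>

lemma root_degree_shift:
  assumes "0 \<le> D" "D \<le> 2 * k - 1" "1 \<le> c" "c \<le> k - 1"
  shows "D + c \<le> demand k (c - D)"
proof -
  obtain j where j: "cdist k (c - D) = \<bar>c - D - 2 * k * j\<bar>" using cdist_attained by blast
  consider "j = 0" | "j \<le> -1" | "j \<ge> 1" by linarith
  then show ?thesis
  proof cases
    case 1 then show ?thesis using assms j by (auto simp: abs_if)
  next
    case 2
    have "2 * k * j \<le> 2 * k * (-1)" using 2 k_pos by (intro mult_left_mono) auto
    then show ?thesis using j assms by linarith
  next
    case 3
    have "2 * k * 1 \<le> 2 * k * j" using 3 k_pos by (intro mult_left_mono) auto
    then show ?thesis using j assms by linarith
  qed
qed

end

section \<open>Multigraphs as multiplicity functions\<close>

definition between :: "('v \<Rightarrow> 'v \<Rightarrow> int) \<Rightarrow> 'v set \<Rightarrow> 'v set \<Rightarrow> int" where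
  "between m A B = (\<Sum>x\<in>A. \<Sum>y\<in>B. m x y)"

definition arc :: "'v \<Rightarrow> 'v \<Rightarrow> 'v \<Rightarrow> 'v \<Rightarrow> int" where
  "arc u v x y = of_bool (x = u \<and> y = v)"

lemma sum_point: "finite A \<Longrightarrow> (\<Sum>x\<in>A. of_bool (x = u) :: int) = of_bool (u \<in> A)"
  by (simp add: of_bool_def if_distrib cong: if_cong)

lemma sum_arc_out: "finite B \<Longrightarrow> (\<Sum>y\<in>B. arc u v x y) = of_bool (x = u \<and> v \<in> B)"
  by (cases "x = u") (simp_all add: arc_def sum_point)

lemma sum_arc_in: "finite B \<Longrightarrow> (\<Sum>y\<in>B. arc u v y x) = of_bool (x = v \<and> u \<in> B)"
  by (cases "x = v") (simp_all add: arc_def sum_point)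

lemma between_plus: "between (\<lambda>x y. f x y + g x y) A B = between f A B + between g A B"
  by (simp add: between_def sum.distrib)

lemma between_nonneg: "(\<And>x y. 0 \<le> m x y) \<Longrightarrow> 0 \<le> between m A B"
  unfolding between_def by (intro sum_nonneg) auto

lemma between_sym:
  assumes "\<And>x y. m x y = m y x"
  shows "between m A B = between m B A"
  unfolding between_def by (subst sum.swap) (simp add: assms)

lemma between_Un_left:
  "finite A \<Longrightarrow> finite B \<Longrightarrow> A \<inter> B = {} \<Longrightarrow> between m (A \<union> B) C = between m A C + between m B C"
  by (simp add: between_def sum.union_disjoint)

lemma between_Un_right:
  "finite B \<Longrightarrow> finite C \<Longrightarrow> B \<inter> C = {} \<Longrightarrow> between m A (B \<union> C) = between m A B + between m A C"
  by (simp add: between_def sum.union_disjoint sum.distrib)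

lemma between_empty [simp]: "between m {} B = 0" "between m A {} = 0"
  by (simp_all add: between_def)

lemma between_singleton: "between m {x} B = (\<Sum>y\<in>B. m x y)"
  by (simp add: between_def)

definition multiplicity_fun :: "('v \<Rightarrow> 'v \<Rightarrow> int) \<Rightarrow> bool" where
  "multiplicity_fun m \<longleftrightarrow> (\<forall>x y. m x y = m y x \<and> 0 \<le> m x y) \<and> (\<forall>x. m x x = 0)"

lemma multiplicity_funD:
  assumes "multiplicity_fun m"
  shows "m x y = m y x" "0 \<le> m x y" "m x x = 0"
  using assms by (auto simp: multiplicity_fun_def)

lemma between_inner_even:
  assumes "finite A" "multiplicity_fun m"
  shows "even (between m A A)"
  using assms(1)
proof induction
  case (insert x A)
  have "between m (insert x A) (insert x A)
      = between m {x} {x} + between m {x} A + (between m A {x} + between m A A)"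
    using insert between_Un_left[of "{x}" A m "insert x A"] between_Un_right[of "{x}" A m]
    by simp
  moreover have "between m {x} {x} = 0" using assms(2) by (simp add: between_def multiplicity_funD)
  moreover have "between m A {x} = between m {x} A"
    using between_sym multiplicity_funD(1)[OF assms(2)] by metis
  ultimately show ?case using insert by simp
qed simp

text \<open>
  Besides the edges inside \<open>W\<close> given by \<open>m\<close> there is a root outside \<open>W\<close>, which sends \<open>a x\<close> arcs to \<open>x\<close> and
  receives \<open>l x\<close> arcs from it.  Only these numbers occur; the root has no name of its own.  The
  boundary of \<open>W\<close> is the degree of the root.
\<close>

definition bd :: "'v set \<Rightarrow> ('v \<Rightarrow> 'v \<Rightarrow> int) \<Rightarrow> ('v \<Rightarrow> int) \<Rightarrow> ('v \<Rightarrow> int) \<Rightarrow> 'v set \<Rightarrow> int" where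
  "bd W m a l A = between m A (W - A) + (\<Sum>x\<in>A. a x + l x)"

lemma bd_singleton:
  assumes "finite W" "x \<in> W" "multiplicity_fun m"
  shows "bd W m a l {x} = (\<Sum>y\<in>W. m x y) + a x + l x"
proof -
  have "(\<Sum>y\<in>W. m x y) = m x x + (\<Sum>y\<in>W - {x}. m x y)" using assms by (simp add: sum.remove)
  then show ?thesis using assms by (simp add: bd_def between_singleton multiplicity_funD)
qed

lemma bd_whole: "bd W m a l W = (\<Sum>x\<in>W. a x + l x)"
  by (simp add: bd_def)

lemma bd_sum_singletons:
  assumes "finite W" "A \<subseteq> W" "multiplicity_fun m"
  shows "(\<Sum>x\<in>A. bd W m a l {x}) = bd W m a l A + between m A A"
proof -
  have fin: "finite A" using assms finite_subset by blast
  have "(\<Sum>x\<in>A. bd W m a l {x}) = (\<Sum>x\<in>A. (\<Sum>y\<in>W. m x y) + (a x + l x))"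
    using assms by (intro sum.cong) (auto simp: bd_singleton)
  also have "\<dots> = between m A W + (\<Sum>x\<in>A. a x + l x)" by (simp add: between_def sum.distrib)
  also have "between m A W = between m A (W - A) + between m A A"
    using between_Un_right[of "W - A" A m A] fin assms by (simp add: Un_absorb2 Int_commute)
  finally show ?thesis by (simp add: bd_def)
qed

lemma bd_even:
  assumes "finite W" "A \<subseteq> W" "multiplicity_fun m" "\<forall>x\<in>W. even (bd W m a l {x} + b x)"
  shows "even (bd W m a l A + sum b A)"
proof -
  have fin: "finite A" using assms finite_subset by blast
  have "even (\<Sum>x\<in>A. bd W m a l {x} + b x)" using assms by (intro dvd_sum) auto
  then have "even ((bd W m a l A + between m A A) + sum b A)"
    using assms by (simp add: sum.distrib bd_sum_singletons)
  moreover have "even (between m A A)" using between_inner_even fin assms by blast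
  ultimately show ?thesis by presburger
qed

lemma bd_Un:
  assumes "finite W" "A \<subseteq> W" "B \<subseteq> W" "A \<inter> B = {}" "multiplicity_fun m"
  shows "bd W m a l (A \<union> B) = bd W m a l A + bd W m a l B - 2 * between m A B"
proof -
  have fin: "finite A" "finite B" using assms finite_subset by blast+
  have e: "W - A = (W - (A \<union> B)) \<union> B" "W - B = (W - (A \<union> B)) \<union> A" using assms by auto
  have "between m A (W - A) = between m A (W - (A \<union> B)) + between m A B"
    unfolding e(1) using fin assms by (intro between_Un_right) auto
  moreover have "between m B (W - B) = between m B (W - (A \<union> B)) + between m B A"
    unfolding e(2) using fin assms by (intro between_Un_right) auto
  moreover have "between m B A = between m A B"
    using between_sym multiplicity_funD(1)[OF assms(5)] by metis
  ultimately show ?thesis using fin assms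
    by (simp add: bd_def between_Un_left sum.union_disjoint)
qed

section \<open>Orientations with prescribed balance\<close>

abbreviation balance :: "('v \<Rightarrow> 'v \<Rightarrow> int) \<Rightarrow> 'v set \<Rightarrow> 'v \<Rightarrow> int" where
  "balance w W x \<equiv> (\<Sum>y\<in>W. w x y) - (\<Sum>y\<in>W. w y x)"

text \<open>
  Parallel edges are interchangeable, so an orientation is given by the number \<open>w x y\<close> of edges directed
  from \<open>x\<close> to \<open>y\<close>.  The target \<open>b x\<close> concerns the outdegree minus the indegree of \<open>x\<close>, arcs at the root
  included.
\<close>

definition orientable ::
    "int \<Rightarrow> 'v set \<Rightarrow> ('v \<Rightarrow> 'v \<Rightarrow> int) \<Rightarrow> ('v \<Rightarrow> int) \<Rightarrow> ('v \<Rightarrow> int) \<Rightarrow> ('v \<Rightarrow> int) \<Rightarrow> bool" where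
  "orientable k W m a l b \<longleftrightarrow> (\<exists>w. (\<forall>x y. 0 \<le> w x y) \<and>
      (\<forall>x\<in>W. \<forall>y\<in>W. w x y + w y x = m x y) \<and>
      (\<forall>x\<in>W. 2 * k dvd balance w W x + l x - a x - b x))"

lemma distribute:
  fixes c :: "'v \<Rightarrow> int"
  assumes "finite A" "\<And>z. 0 \<le> c z" "0 \<le> s" "s \<le> sum c A"
  shows "\<exists>f. (\<forall>z. 0 \<le> f z \<and> f z \<le> c z) \<and> sum f A = s"
  using assms(1,3,4)
proof (induction A arbitrary: s)
  case empty
  then show ?case using assms(2) by (intro exI[of _ "\<lambda>_. 0"]) auto
next
  case (insert x A)
  define t where "t = max 0 (s - c x)"
  have "0 \<le> t" "t \<le> sum c A" using insert assms(2)[of x] by (auto simp: t_def sum_nonneg assms(2))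
  then obtain f where f: "\<forall>z. 0 \<le> f z \<and> f z \<le> c z" "sum f A = t" using insert.IH by blast
  let ?f = "f(x := s - t)"
  have "sum ?f A = t" using f insert by (subst sum.cong[of A A ?f f]) auto
  then have "sum ?f (insert x A) = s" using insert by simp
  moreover have "\<forall>z. 0 \<le> ?f z \<and> ?f z \<le> c z" using f insert assms(2)[of x] by (auto simp: t_def)
  ultimately show ?case by blast
qed

section \<open>Contracting a set of vertices\<close>

text \<open>
  The contracted set \<open>A\<close> is represented by one of its own vertices \<open>r\<close>, so that a contraction does not
  change the type of vertices.  A vertex of the contracted graph stands for its fibre.
\<close>

definition fibre :: "'v \<Rightarrow> 'v set \<Rightarrow> 'v \<Rightarrow> 'v set" where
  "fibre r A x = (if x = r then A else {x})"

definition contract_mult :: "'v \<Rightarrow> 'v set \<Rightarrow> ('v \<Rightarrow> 'v \<Rightarrow> int) \<Rightarrow> 'v \<Rightarrow> 'v \<Rightarrow> int" where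
  "contract_mult r A m x y = (if x = y then 0 else between m (fibre r A x) (fibre r A y))"

definition contract_fun :: "'v \<Rightarrow> 'v set \<Rightarrow> ('v \<Rightarrow> int) \<Rightarrow> 'v \<Rightarrow> int" where
  "contract_fun r A g x = sum g (fibre r A x)"

text \<open>
  The set of original vertices that a set of vertices of the contracted graph stands for.
\<close>

definition unfold_set :: "'v \<Rightarrow> 'v set \<Rightarrow> 'v set \<Rightarrow> 'v set" where
  "unfold_set r A B = (\<Union>x\<in>B. fibre r A x)"

locale contraction =
  fixes W A :: "'v set" and r :: 'v
  assumes finite_W: "finite W" and A_sub: "A \<subseteq> W" and r_in: "r \<in> A"
begin

abbreviation "W1 \<equiv> insert r (W - A)"

lemma finite_A: "finite A" using finite_W A_sub finite_subset by blast

lemma fibre_disjoint: "x \<in> W1 \<Longrightarrow> y \<in> W1 \<Longrightarrow> x \<noteq> y \<Longrightarrow> fibre r A x \<inter> fibre r A y = {}"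
  using r_in by (auto simp: fibre_def)

lemma finite_fibre: "finite (fibre r A x)" by (simp add: fibre_def finite_A)

lemma sum_contract: 
  assumes "B \<subseteq> W1"
  shows "(\<Sum>x\<in>B. sum g (fibre r A x)) = sum g (unfold_set r A B)"
proof -
  have "finite B" using assms finite_W finite_subset by (metis finite_Diff finite_insert)
  then show ?thesis unfolding unfold_set_def
    by (rule sum.UNION_disjoint[symmetric]) (use assms fibre_disjoint finite_fibre in \<open>simp_all add: subset_iff\<close>)
qed

lemma unfold_set_whole: "unfold_set r A W1 = W"
  using A_sub r_in by (auto simp: unfold_set_def fibre_def)

lemma unfold_set_Diff: "B \<subseteq> W1 \<Longrightarrow> unfold_set r A (W1 - B) = W - unfold_set r A B"
  using A_sub r_in by (auto simp: unfold_set_def fibre_def split: if_splits)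

lemma unfold_set_empty_iff: "unfold_set r A B = {} \<longleftrightarrow> B = {}"
  using r_in by (auto simp: unfold_set_def fibre_def)

lemma unfold_set_psubset:
  assumes "B \<subset> W1" shows "unfold_set r A B \<subset> W"
proof -
  have "W1 - B \<noteq> {}" using assms by blast
  then have "W - unfold_set r A B \<noteq> {}" using assms unfold_set_Diff[of B] unfold_set_empty_iff by (metis psubset_imp_subset)
  moreover have "unfold_set r A B \<subseteq> W" using assms unfold_set_whole unfolding unfold_set_def by blast
  ultimately show ?thesis by blast
qed

lemma between_contract:
  assumes "B \<subseteq> W1" "C \<subseteq> W1" "B \<inter> C = {}"
  shows "between (contract_mult r A m) B C = between m (unfold_set r A B) (unfold_set r A C)"
proof -
  have "between (contract_mult r A m) B C
      = (\<Sum>x\<in>B. \<Sum>y\<in>C. between m (fibre r A x) (fibre r A y))"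
    unfolding between_def[of "contract_mult r A m"]
    using assms by (intro sum.cong refl) (auto simp: contract_mult_def)
  also have "\<dots> = (\<Sum>x\<in>B. between m (fibre r A x) (unfold_set r A C))"
  proof (rule sum.cong[OF refl])
    fix x
    have "(\<Sum>y\<in>C. between m (fibre r A x) (fibre r A y))
        = (\<Sum>x'\<in>fibre r A x. \<Sum>y\<in>C. sum (m x') (fibre r A y))"
      unfolding between_def by (rule sum.swap)
    then show "(\<Sum>y\<in>C. between m (fibre r A x) (fibre r A y)) = between m (fibre r A x) (unfold_set r A C)"
      using assms by (simp add: sum_contract between_def)
  qed
  also have "\<dots> = between m (unfold_set r A B) (unfold_set r A C)"
    unfolding between_def using assms by (intro sum_contract) 
  finally show ?thesis .
qed

lemma bd_contract:
  assumes "B \<subseteq> W1"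
  shows "bd W1 (contract_mult r A m) (contract_fun r A a) (contract_fun r A l) B
       = bd W m a l (unfold_set r A B)"
proof -
  have "between (contract_mult r A m) B (W1 - B) = between m (unfold_set r A B) (W - unfold_set r A B)"
    using assms between_contract[of B "W1 - B"] unfold_set_Diff by auto
  moreover have "(\<Sum>x\<in>B. contract_fun r A a x + contract_fun r A l x) = (\<Sum>x\<in>unfold_set r A B. a x + l x)"
    using assms by (simp add: contract_fun_def sum.distrib sum_contract)
  ultimately show ?thesis by (simp add: bd_def)
qed

lemma sum_contract_fun:
  "B \<subseteq> W1 \<Longrightarrow> sum (contract_fun r A g) B = sum g (unfold_set r A B)"
  using sum_contract by (simp add: contract_fun_def)

lemma contract_mult_valid:
  assumes "multiplicity_fun m"
  shows "multiplicity_fun (contract_mult r A m)"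
proof -
  have "contract_mult r A m x y = contract_mult r A m y x" for x y
  proof -
    have "between m (fibre r A x) (fibre r A y) = between m (fibre r A y) (fibre r A x)"
      by (rule between_sym) (rule multiplicity_funD(1)[OF assms])
    then show ?thesis by (simp add: contract_mult_def)
  qed
  moreover have "0 \<le> contract_mult r A m x y" for x y
    using multiplicity_funD(2)[OF assms] by (simp add: contract_mult_def between_nonneg)
  ultimately show ?thesis by (simp add: multiplicity_fun_def contract_mult_def)
qed

lemma contract_fun_nonneg: "(\<And>x. 0 \<le> g x) \<Longrightarrow> 0 \<le> contract_fun r A g x"
  by (simp add: contract_fun_def sum_nonneg)

text \<open>
  Orient the contracted graph first.  The arcs between \<open>y\<close> and \<open>r\<close> are distributed among the edges that
  join \<open>y\<close> to the vertices of \<open>A\<close>; seen from inside \<open>A\<close>, they are arcs at the root.  The divisibility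
  assumption of the inner problem is the balance at \<open>r\<close> in the outer solution.
\<close>

lemma orientable_contract:
  assumes m: "multiplicity_fun m" and a: "\<And>x. 0 \<le> a x" and l: "\<And>x. 0 \<le> l x"
    and outer: "orientable k W1 (contract_mult r A m) (contract_fun r A a) (contract_fun r A l) (contract_fun r A b)"
    and inner: "\<And>a' l'. (\<forall>x. 0 \<le> a' x \<and> 0 \<le> l' x) \<Longrightarrow>
        (\<forall>x. a' x + l' x = a x + l x + (\<Sum>y\<in>W - A. m x y)) \<Longrightarrow>
        2 * k dvd sum b A - (\<Sum>x\<in>A. l' x - a' x) \<Longrightarrow> orientable k A m a' l' b"
  shows "orientable k W m a l b"
proof -
  let ?m = "contract_mult r A m"
  obtain w where w0: "\<forall>x y. 0 \<le> w x y" and wm: "\<forall>x\<in>W1. \<forall>y\<in>W1. w x y + w y x = ?m x y"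
    and wb: "\<forall>x\<in>W1. 2 * k dvd balance w W1 x
        + contract_fun r A l x - contract_fun r A a x - contract_fun r A b x"
    using outer unfolding orientable_def by blast
  have cross: "?m y r = (\<Sum>z\<in>A. m y z)" if "y \<in> W - A" for y
  proof -
    have "y \<noteq> r" using that r_in by blast
    then show ?thesis by (simp add: contract_mult_def fibre_def between_def)
  qed
  have "\<exists>f. (\<forall>z. 0 \<le> f z \<and> f z \<le> m y z) \<and> sum f A = w y r" if y: "y \<in> W - A" for y
  proof (rule distribute[OF finite_A])
    have "w y r + w r y = ?m y r" using y wm by blast
    moreover have "0 \<le> w r y" using w0 by blast
    ultimately show "w y r \<le> sum (m y) A" using cross[OF y] by simp
  qed (use w0 m in \<open>auto simp: multiplicity_funD\<close>)
  then obtain f where f: "\<And>y z. y \<in> W - A \<Longrightarrow> 0 \<le> f y z \<and> f y z \<le> m y z"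
    and fs: "\<And>y. y \<in> W - A \<Longrightarrow> (\<Sum>z\<in>A. f y z) = w y r" by metis
  have gs: "(\<Sum>z\<in>A. m y z - f y z) = w r y" if "y \<in> W - A" for y
  proof -
    have "w y r + w r y = ?m y r" using that wm by blast
    then show ?thesis using fs[OF that] cross[OF that] by (simp add: sum_subtractf)
  qed
  define a' where "a' = (\<lambda>x. a x + (\<Sum>y\<in>W - A. f y x))"
  define l' where "l' = (\<lambda>x. l x + (\<Sum>y\<in>W - A. m y x - f y x))"
  have sw: "(\<Sum>x\<in>A. \<Sum>y\<in>W - A. f y x) = (\<Sum>y\<in>W - A. w y r)"
    "(\<Sum>x\<in>A. \<Sum>y\<in>W - A. m y x - f y x) = (\<Sum>y\<in>W - A. w r y)"
    by (subst sum.swap, simp add: fs gs)+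
  have at_r: "balance w W1 r = balance w (W - A) r"
    using finite_W r_in by simp
  have "orientable k A m a' l' b"
  proof (rule inner)
    have "0 \<le> (\<Sum>y\<in>W - A. f y x)" "0 \<le> (\<Sum>y\<in>W - A. m y x - f y x)" for x
      using f by (auto intro!: sum_nonneg)
    then show "\<forall>x. 0 \<le> a' x \<and> 0 \<le> l' x"
      using a l by (auto simp: a'_def l'_def add_nonneg_nonneg)
    show "\<forall>x. a' x + l' x = a x + l x + (\<Sum>y\<in>W - A. m x y)"
      using multiplicity_funD(1)[OF m] by (simp add: a'_def l'_def sum_subtractf)
    have "(\<Sum>x\<in>A. l' x - a' x) = sum l A - sum a A + (balance w (W - A) r)"
    proof -
      have "sum l' A = sum l A + (\<Sum>y\<in>W - A. w r y)"
        unfolding l'_def sum.distrib sw ..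
      moreover have "sum a' A = sum a A + (\<Sum>y\<in>W - A. w y r)"
        unfolding a'_def sum.distrib sw ..
      ultimately show ?thesis by (simp add: sum_subtractf)
    qed
    moreover have "2 * k dvd balance w (W - A) r + sum l A - sum a A - sum b A"
      using wb at_r by (simp add: contract_fun_def fibre_def)
    ultimately show "2 * k dvd sum b A - (\<Sum>x\<in>A. l' x - a' x)"
      by (metis (no_types, lifting) add.commute add_diff_eq dvd_minus_iff minus_diff_eq)
  qed
  then obtain w2 where v0: "\<forall>x y. 0 \<le> w2 x y" and vm: "\<forall>x\<in>A. \<forall>y\<in>A. w2 x y + w2 y x = m x y"
    and vb: "\<forall>x\<in>A. 2 * k dvd balance w2 A x + l' x - a' x - b x"
    unfolding orientable_def by blast
  define v where "v = (\<lambda>x y. if x \<in> A then (if y \<in> A then w2 x y else if y \<in> W then m y x - f y x else 0)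
       else if x \<in> W then (if y \<in> A then f x y else w x y) else 0)"
  have split: "(\<Sum>y\<in>W. g y) = (\<Sum>y\<in>A. g y) + (\<Sum>y\<in>W - A. g y)" for g :: "'v \<Rightarrow> int"
    using sum.subset_diff[OF A_sub finite_W, of g] by simp
  have "\<forall>x y. 0 \<le> v x y" using v0 w0 f by (simp add: v_def)
  moreover have "\<forall>x\<in>W. \<forall>y\<in>W. v x y + v y x = m x y"
  proof (intro ballI)
    fix x y assume xy: "x \<in> W" "y \<in> W"
    have "?m x y = m x y" if "x \<notin> A" "y \<notin> A"
      using that r_in m by (auto simp: contract_mult_def fibre_def between_def multiplicity_funD)
    then show "v x y + v y x = m x y"
      using xy vm wm multiplicity_funD(1)[OF m] by (auto simp: v_def)
  qed
  moreover have "2 * k dvd balance v W x + l x - a x - b x" if x: "x \<in> W" for x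
  proof (cases "x \<in> A")
    case True
    have "(\<Sum>y\<in>W. v x y) = (\<Sum>y\<in>A. w2 x y) + (\<Sum>y\<in>W - A. m y x - f y x)"
      unfolding split by (intro arg_cong2[where f="(+)"] sum.cong) (auto simp: v_def True)
    moreover have "(\<Sum>y\<in>W. v y x) = (\<Sum>y\<in>A. w2 y x) + (\<Sum>y\<in>W - A. f y x)"
      unfolding split by (intro arg_cong2[where f="(+)"] sum.cong) (auto simp: v_def True)
    moreover have "2 * k dvd balance w2 A x + l' x - a' x - b x"
      using vb True by blast
    ultimately show ?thesis by (simp add: a'_def l'_def algebra_simps)
  next
    case False
    have x1: "x \<in> W - A" "x \<in> W1" "x \<noteq> r" using False x r_in by auto
    have "(\<Sum>y\<in>W. v x y) = w x r + (\<Sum>y\<in>W - A. w x y)"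
      unfolding split fs[OF x1(1), symmetric]
      by (intro arg_cong2[where f="(+)"] sum.cong) (use x1 in \<open>auto simp: v_def\<close>)
    moreover have "(\<Sum>y\<in>W. v y x) = w r x + (\<Sum>y\<in>W - A. w y x)"
      unfolding split gs[OF x1(1), symmetric]
      by (intro arg_cong2[where f="(+)"] sum.cong) (use x1 in \<open>auto simp: v_def\<close>)
    moreover have "2 * k dvd balance w W1 x + l x - a x - b x"
      using bspec[OF wb x1(2)] x1(3) by (simp add: contract_fun_def fibre_def)
    ultimately show ?thesis using finite_W r_in by simp
  qed
  ultimately show ?thesis unfolding orientable_def by blast
qed

text \<open>
  Contracting the complement of \<open>A\<close> into the root does not affect the boundaries of subsets of \<open>A\<close>.
\<close>

lemma bd_inner:
  assumes "B \<subseteq> A" "\<forall>x. a' x + l' x = a x + l x + (\<Sum>y\<in>W - A. m x y)"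
  shows "bd A m a' l' B = bd W m a l B"
proof -
  have "W - B = (A - B) \<union> (W - A)" using assms A_sub by auto
  then have "between m B (W - B) = between m B (A - B) + between m B (W - A)"
    using between_Un_right[of "A - B" "W - A" m B] finite_A finite_W by auto
  then show ?thesis using assms(2) by (simp add: bd_def sum.distrib between_def)
qed

end

section \<open>Deleting, lifting and shifting arcs\<close>

text \<open>
  Negative \<open>c\<close> removes arcs.
\<close>

definition add_arc :: "'v \<Rightarrow> 'v \<Rightarrow> int \<Rightarrow> ('v \<Rightarrow> 'v \<Rightarrow> int) \<Rightarrow> 'v \<Rightarrow> 'v \<Rightarrow> int" where
  "add_arc u v c w x y = w x y + c * arc u v x y"

definition add_edge :: "'v \<Rightarrow> 'v \<Rightarrow> int \<Rightarrow> ('v \<Rightarrow> 'v \<Rightarrow> int) \<Rightarrow> 'v \<Rightarrow> 'v \<Rightarrow> int" where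
  "add_edge u v c m = add_arc u v c (add_arc v u c m)"

definition bump :: "'v \<Rightarrow> int \<Rightarrow> ('v \<Rightarrow> int) \<Rightarrow> 'v \<Rightarrow> int" where
  "bump u c g x = g x + c * of_bool (x = u)"

lemma sum_bump: "finite A \<Longrightarrow> sum (bump u c g) A = sum g A + c * of_bool (u \<in> A)"
  by (simp add: bump_def sum.distrib sum_point flip: sum_distrib_left)

lemma sum_add_arc_out:
  "finite B \<Longrightarrow> v \<in> B \<Longrightarrow> (\<Sum>y\<in>B. add_arc u v c w x y) = (\<Sum>y\<in>B. w x y) + c * of_bool (x = u)"
  by (simp add: add_arc_def sum.distrib sum_arc_out flip: sum_distrib_left)

lemma sum_add_arc_in:
  "finite B \<Longrightarrow> u \<in> B \<Longrightarrow> (\<Sum>y\<in>B. add_arc u v c w y x) = (\<Sum>y\<in>B. w y x) + c * of_bool (x = v)"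
  by (simp add: add_arc_def sum.distrib sum_arc_in flip: sum_distrib_left)

lemma between_add_arc:
  "finite A \<Longrightarrow> finite B \<Longrightarrow>
    between (add_arc u v c m) A B = between m A B + c * of_bool (u \<in> A \<and> v \<in> B)"
  unfolding add_arc_def[abs_def] between_plus
  by (simp add: between_def sum_arc_out sum_point of_bool_conj flip: sum_distrib_left sum_distrib_right)

lemma between_add_edge:
  "finite A \<Longrightarrow> finite B \<Longrightarrow> between (add_edge u v c m) A B
    = between m A B + c * of_bool (u \<in> A \<and> v \<in> B) + c * of_bool (v \<in> A \<and> u \<in> B)"
  by (simp add: add_edge_def between_add_arc)

lemma bd_add_edge:
  assumes "finite W" "A \<subseteq> W" "u \<in> W" "v \<in> W"
  shows "bd W (add_edge u v c m) a l A = bd W m a l A + c * of_bool ((u \<in> A) \<noteq> (v \<in> A))"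
proof -
  have "finite A" using assms finite_subset by blast
  then show ?thesis using assms by (auto simp: bd_def between_add_edge)
qed

lemma bd_bump_in:
  "finite A \<Longrightarrow> bd W m (bump u c a) l A = bd W m a l A + c * of_bool (u \<in> A)"
  by (simp add: bd_def sum.distrib sum_bump)

lemma bd_bump_out:
  "finite A \<Longrightarrow> bd W m a (bump u c l) A = bd W m a l A + c * of_bool (u \<in> A)"
  by (simp add: bd_def sum.distrib sum_bump)

lemma add_edge_apply:
  "add_edge u v c m x y = m x y + c * of_bool (x = u \<and> y = v) + c * of_bool (x = v \<and> y = u)"
  by (simp add: add_edge_def add_arc_def arc_def)

lemma multiplicity_add_edge:
  assumes "multiplicity_fun m" "u \<noteq> v" "0 \<le> m u v + c"
  shows "multiplicity_fun (add_edge u v c m)"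
proof -
  note m = multiplicity_funD[OF assms(1)]
  have "m v u = m u v" by (rule m(1))
  then have "0 \<le> add_edge u v c m x y" for x y
    using assms(3) m(2)[of x y] by (cases "x = u \<and> y = v \<or> x = v \<and> y = u") (auto simp: add_edge_apply assms(2))
  moreover have "add_edge u v c m x y = add_edge u v c m y x" for x y
    using m(1)[of x y] by (simp add: add_edge_apply conj_commute)
  moreover have "add_edge u v c m x x = 0" for x
    using m(3)[of x] assms(2) by (auto simp: add_edge_apply)
  ultimately show ?thesis by (simp add: multiplicity_fun_def)
qed

text \<open>
  Only \<open>l - a - b\<close> enters the balance conditions: arcs at the root can be traded for a change of targets.
\<close>

lemma orientable_shift:
  assumes "orientable k W m a' l' b'"
    and "\<And>x. x \<in> W \<Longrightarrow> 2 * k dvd (l x - a x - b x) - (l' x - a' x - b' x)"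
  shows "orientable k W m a l b"
proof -
  obtain w where "\<forall>x y. 0 \<le> w x y" "\<forall>x\<in>W. \<forall>y\<in>W. w x y + w y x = m x y"
    and w: "\<forall>x\<in>W. 2 * k dvd balance w W x + l' x - a' x - b' x"
    using assms(1) unfolding orientable_def by blast
  moreover have "2 * k dvd balance w W x + l x - a x - b x" if "x \<in> W" for x
    using dvd_add[OF bspec[OF w that] assms(2)[OF that]] by (simp add: algebra_simps)
  ultimately show ?thesis unfolding orientable_def by blast
qed

lemma orientable_reverse:
  assumes "orientable k W m l a (\<lambda>x. - b x)"
  shows "orientable k W m a l b"
proof -
  obtain w where w: "\<forall>x y. 0 \<le> w x y" "\<forall>x\<in>W. \<forall>y\<in>W. w x y + w y x = m x y"
    "\<forall>x\<in>W. 2 * k dvd balance w W x + a x - l x - (- b x)"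
    using assms unfolding orientable_def by blast
  have "2 * k dvd (\<Sum>y\<in>W. w y x) - (\<Sum>y\<in>W. w x y) + l x - a x - b x" if "x \<in> W" for x
  proof -
    have "(\<Sum>y\<in>W. w y x) - (\<Sum>y\<in>W. w x y) + l x - a x - b x
        = - (balance w W x + a x - l x - (- b x))" by simp
    then show ?thesis using bspec[OF w(3) that] by (simp only: dvd_minus_iff)
  qed
  then show ?thesis unfolding orientable_def using w(1,2)
    by (intro exI[of _ "\<lambda>x y. w y x"]) (auto simp: add.commute)
qed

lemma orientable_delete_arc:
  assumes "finite W" "u \<in> W" "v \<in> W"
    and "orientable k W (add_edge u v (-1) m) a l (bump u (-1) (bump v 1 b))"
  shows "orientable k W m a l b"
proof -
  obtain w where w: "\<forall>x y. 0 \<le> w x y" "\<forall>x\<in>W. \<forall>y\<in>W. w x y + w y x = add_edge u v (-1) m x y"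
    "\<forall>x\<in>W. 2 * k dvd balance w W x + l x - a x - bump u (-1) (bump v 1 b) x"
    using assms(4) unfolding orientable_def by blast
  let ?w = "add_arc u v 1 w"
  have "\<forall>x y. 0 \<le> ?w x y" using w(1) by (simp add: add_arc_def arc_def)
  moreover have "\<forall>x\<in>W. \<forall>y\<in>W. ?w x y + ?w y x = m x y"
  proof (intro ballI)
    fix x y assume "x \<in> W" "y \<in> W"
    then have "w x y + w y x = add_edge u v (-1) m x y" using w(2) by blast
    moreover have "(y = u \<and> x = v) = (x = v \<and> y = u)" by blast
    ultimately show "?w x y + ?w y x = m x y"
      unfolding add_arc_def arc_def add_edge_apply by simp
  qed
  moreover have "2 * k dvd balance ?w W x + l x - a x - b x" if "x \<in> W" for x
    using bspec[OF w(3) that] assms(1-3)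
    by (simp add: sum_add_arc_out sum_add_arc_in bump_def algebra_simps)
  ultimately show ?thesis unfolding orientable_def by blast
qed

text \<open>
  An arc from the root to \<open>u\<close> and an edge \<open>uv\<close> become one arc from the root to \<open>v\<close>.
\<close>

lemma orientable_lift_root_in:
  assumes "finite W" "u \<in> W" "v \<in> W"
    and "orientable k W (add_edge u v (-1) m) (bump u (-1) (bump v 1 a)) l b"
  shows "orientable k W m a l b"
proof (rule orientable_delete_arc[OF assms(1-3)])
  show "orientable k W (add_edge u v (-1) m) a l (bump u (-1) (bump v 1 b))"
    by (rule orientable_shift[OF assms(4)]) (simp add: bump_def)
qed

text \<open>
  In whichever direction the new edge \<open>yz\<close> is oriented, it can be rerouted through \<open>u\<close>, entering and
  leaving \<open>u\<close> once.
\<close>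

lemma orientable_lift:
  assumes "finite W" "u \<in> W" "y \<in> W" "z \<in> W" "y \<noteq> z" "0 \<le> m y z"
    and "orientable k W (add_edge u y (-1) (add_edge u z (-1) (add_edge y z 1 m))) a l b"
    and "u \<noteq> y" "u \<noteq> z"
  shows "orientable k W m a l b"
proof -
  let ?m = "add_edge u y (-1) (add_edge u z (-1) (add_edge y z 1 m))"
  obtain w where w: "\<forall>x y. 0 \<le> w x y" "\<forall>x\<in>W. \<forall>y\<in>W. w x y + w y x = ?m x y"
    "\<forall>x\<in>W. 2 * k dvd balance w W x + l x - a x - b x"
    using assms(7) unfolding orientable_def by blast
  have main: "orientable k W m a l b"
    if s: "s \<in> W" "t \<in> W" "{s, t} = {y, z}" "1 \<le> w s t" for s t
  proof -
    let ?w = "add_arc s u 1 (add_arc u t 1 (add_arc s t (-1) w))"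
    have "\<forall>x y. 0 \<le> ?w x y" using w(1) s(4) by (auto simp: add_arc_def arc_def of_bool_def)
    moreover have "?w p q + ?w q p = m p q" if "p \<in> W" "q \<in> W" for p q
    proof -
      have "w p q + w q p = ?m p q" using w(2) that by blast
      moreover have "?m p q = m p q - arc u s p q - arc s u p q - arc u t p q - arc t u p q
          + arc s t p q + arc t s p q"
        using s(3) by (auto simp: doubleton_eq_iff add_edge_def add_arc_def)
      moreover have "arc s u q p = arc u s p q" "arc u t q p = arc t u p q" "arc s t q p = arc t s p q"
        by (simp_all add: arc_def conj_commute)
      ultimately show ?thesis unfolding add_arc_def by linarith
    qed
    moreover have "2 * k dvd balance ?w W x + l x - a x - b x" if "x \<in> W" for x
      using bspec[OF w(3) that] assms(1-2) s(1,2)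
      by (simp add: sum_add_arc_out sum_add_arc_in algebra_simps)
    ultimately show ?thesis unfolding orientable_def by blast
  qed
  have "w y z + w z y = ?m y z" using w(2) assms(3,4) by blast
  moreover have "?m y z = m y z + 1" using assms(5,8,9) by (auto simp: add_edge_apply)
  ultimately have "1 \<le> w y z \<or> 1 \<le> w z y" using assms(6) by linarith
  then show ?thesis using main[of y z] main[of z y] assms(3,4) by blast
qed

text \<open>
  Of the edges joining \<open>u\<close> to \<open>y\<close>, \<open>h y\<close> are directed away from \<open>u\<close>.  Once oriented, the edges at \<open>u\<close>
  are arcs at the root for the other vertices.
\<close>

lemma orientable_delete_vertex:
  assumes fin: "finite W" and u: "u \<in> W" and m: "multiplicity_fun m"
    and h: "\<forall>y. 0 \<le> h y \<and> h y \<le> m u y"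
    and at_u: "2 * k dvd (\<Sum>y\<in>W - {u}. 2 * h y - m u y) + l u - a u - b u"
    and rest: "orientable k (W - {u}) m (\<lambda>y. a y + h y) (\<lambda>y. l y + (m u y - h y)) b"
  shows "orientable k W m a l b"
proof -
  obtain w where w: "\<forall>x y. 0 \<le> w x y" "\<forall>x\<in>W - {u}. \<forall>y\<in>W - {u}. w x y + w y x = m x y"
    "\<forall>x\<in>W - {u}. 2 * k dvd balance w (W - {u}) x
       + (l x + (m u x - h x)) - (a x + h x) - b x"
    using rest unfolding orientable_def by blast
  define v where "v = (\<lambda>x y. if x = u then (if y = u then 0 else h y)
     else if y = u then m u x - h x else w x y)"
  have split: "(\<Sum>y\<in>W. g y) = g u + (\<Sum>y\<in>W - {u}. g y)" for g :: "'a \<Rightarrow> int"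
    using fin u by (simp add: sum.remove)
  have "\<forall>x y. 0 \<le> v x y" using w(1) h by (simp add: v_def)
  moreover have "\<forall>x\<in>W. \<forall>y\<in>W. v x y + v y x = m x y"
  proof (intro ballI)
    fix x y assume "x \<in> W" "y \<in> W"
    moreover have "m x u = m u x" by (rule multiplicity_funD(1)[OF m])
    ultimately show "v x y + v y x = m x y"
      using w(2) multiplicity_funD(3)[OF m, of u] by (cases "x = u"; cases "y = u") (simp_all add: v_def)
  qed
  moreover have "2 * k dvd balance v W x + l x - a x - b x" if x: "x \<in> W" for x
  proof (cases "x = u")
    case True
    have "(\<Sum>y\<in>W. v u y) = (\<Sum>y\<in>W - {u}. h y)" unfolding split by (simp add: v_def)
    moreover have "(\<Sum>y\<in>W. v y u) = (\<Sum>y\<in>W - {u}. m u y - h y)" unfolding split by (simp add: v_def)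
    moreover have "(\<Sum>y\<in>W - {u}. 2 * h y - m u y) = (\<Sum>y\<in>W - {u}. h y) - (\<Sum>y\<in>W - {u}. m u y - h y)"
      by (simp flip: sum_subtractf)
    ultimately show ?thesis using at_u True by simp
  next
    case False
    have "(\<Sum>y\<in>W. v x y) = (m u x - h x) + (\<Sum>y\<in>W - {u}. w x y)"
      unfolding split using False by (auto simp: v_def intro!: sum.cong)
    moreover have "(\<Sum>y\<in>W. v y x) = h x + (\<Sum>y\<in>W - {u}. w y x)"
      unfolding split using False by (auto simp: v_def intro!: sum.cong)
    ultimately have "balance v W x + l x - a x - b x
      = balance w (W - {u}) x + (l x + (m u x - h x)) - (a x + h x) - b x"
      by linarith
    moreover have "2 * k dvd balance w (W - {u}) x
      + (l x + (m u x - h x)) - (a x + h x) - b x" using w(3) x False by blast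
    ultimately show ?thesis by (simp only:)
  qed
  ultimately show ?thesis unfolding orientable_def by blast
qed

section \<open>The rooted cut condition and tight sets\<close>

text \<open>
  Proper nonempty sets satisfy a lower bound, while \<open>W\<close> itself, that is, the root, satisfies the
  corresponding upper bound; when the complement of a tight set is contracted, equality provides the
  upper bound.

  \<open>U\<close> is empty or consists of one flagged vertex \<open>u\<close>.  Its target is \<open>0\<close>, and in place of the cut condition
  it has only what is necessary to balance its arcs at the root: neither kind makes up more than half of
  its degree.  This makes it possible to split off the edges at \<open>u\<close> one pair at a time, although its degree
  drops below \<open>2k - 2\<close> on the way.
\<close>

definition admissible ::
    "int \<Rightarrow> 'v set \<Rightarrow> 'v set \<Rightarrow> ('v \<Rightarrow> 'v \<Rightarrow> int) \<Rightarrow> ('v \<Rightarrow> int) \<Rightarrow> ('v \<Rightarrow> int) \<Rightarrow> ('v \<Rightarrow> int) \<Rightarrow> bool" where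
  "admissible k W U m a l b \<longleftrightarrow>
     finite W \<and> multiplicity_fun m \<and> (\<forall>x. 0 \<le> a x \<and> 0 \<le> l x) \<and>
     (\<forall>x\<in>W. even (bd W m a l {x} + b x)) \<and>
     2 * k dvd sum b W - (\<Sum>x\<in>W. l x - a x) \<and>
     bd W m a l W \<le> demand k (sum b W) \<and>
     (\<forall>A. A \<noteq> {} \<and> A \<subset> W \<and> A \<noteq> U \<longrightarrow> demand k (sum b A) \<le> bd W m a l A) \<and>
     (\<forall>u\<in>U. U = {u} \<and> u \<in> W \<and> 2 * k dvd b u \<and>
        2 * a u \<le> bd W m a l {u} \<and> 2 * l u \<le> bd W m a l {u})"

lemma bd_swap: "bd W m l a A = bd W m a l A"
  by (simp add: bd_def add.commute)

text \<open>
  The induction step.  Instances are compared by the number of vertices, then the number of edges inside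
  \<open>W\<close>, then the degree of the root; a flagged vertex makes an instance smaller.  Edges are counted
  before arcs at the root because one reduction removes an edge at the cost of new arcs at the root.
\<close>

locale reduction = modulus +
  fixes W U :: "'v set" and m :: "'v \<Rightarrow> 'v \<Rightarrow> int" and a l b :: "'v \<Rightarrow> int"
  assumes adm: "admissible k W U m a l b" and big: "2 \<le> card W"
    and IH_card: "\<And>(W' :: 'v set) U' m' a' l' b'. card W' < card W \<Longrightarrow>
        admissible k W' U' m' a' l' b' \<Longrightarrow> orientable k W' m' a' l' b'"
    and IH_edges: "\<And>U' m' a' l' b'. between m' W W < between m W W \<Longrightarrow>
        admissible k W U' m' a' l' b' \<Longrightarrow> orientable k W m' a' l' b'"
    and IH_root: "\<And>U' a' l' b'. bd W m a' l' W < bd W m a l W \<Longrightarrow>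
        admissible k W U' m a' l' b' \<Longrightarrow> orientable k W m a' l' b'"
    and IH_flag: "\<And>u. U = {} \<Longrightarrow> admissible k W {u} m a l b \<Longrightarrow> orientable k W m a l b"
begin

lemma fin: "finite W" and mult: "multiplicity_fun m" and a0: "0 \<le> a x" and l0: "0 \<le> l x"
  and total: "2 * k dvd sum b W - (\<Sum>x\<in>W. l x - a x)"
  and root: "bd W m a l W \<le> demand k (sum b W)"
  using adm by (simp_all add: admissible_def)

lemma par: "x \<in> W \<Longrightarrow> even (bd W m a l {x} + b x)"
  using adm by (simp add: admissible_def)

lemma cut: "A \<noteq> {} \<Longrightarrow> A \<subset> W \<Longrightarrow> A \<noteq> U \<Longrightarrow> demand k (sum b A) \<le> bd W m a l A"
  using adm by (simp add: admissible_def)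

lemma flag:
  assumes "u \<in> U"
  shows "U = {u} \<and> u \<in> W \<and> 2 * k dvd b u \<and> 2 * a u \<le> bd W m a l {u} \<and> 2 * l u \<le> bd W m a l {u}"
  using adm unfolding admissible_def by (elim conjE) (erule bspec[OF _ assms])

lemmas mD = multiplicity_funD[OF mult]

lemma finA: "A \<subseteq> W \<Longrightarrow> finite A" using fin finite_subset by blast

lemma par_set: "A \<subseteq> W \<Longrightarrow> even (bd W m a l A + sum b A)"
  using bd_even fin mult par by blast

lemma U_card: "card U \<le> 1"
proof (cases "U = {}")
  case False
  then obtain u where "u \<in> U" by blast
  then have "U = {u}" using flag[of u] by simp
  then show ?thesis by simp
qed simp

text \<open>
  Contract \<open>A\<close>, orient the rest, then orient \<open>A\<close> with the rest contracted into the root; tightness is the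
  upper bound at this root.  A flagged vertex \<open>u\<close> in \<open>A\<close> stays flagged: \<open>A\<close> and \<open>A - {u}\<close> have the same
  target, so the cut condition for \<open>A - {u}\<close> says that at least half of the edges at \<open>u\<close> stay
  inside \<open>A\<close>, and the others can be oriented in any way.
\<close>

lemma orientable_of_tight_set:
  assumes A: "A \<subset> W" "2 \<le> card A" and tight: "bd W m a l A = demand k (sum b A)"
  shows "orientable k W m a l b"
proof -
  obtain r where r: "r \<in> A" using A by fastforce
  interpret contraction W A r using fin A r by unfold_locales auto
  have small: "card W1 < card W" "card A < card W"
  proof -
    show "card A < card W" using A fin psubset_card_mono by blast
    have "card W1 = card W - card A + 1" using r A fin finA by (simp add: card_Diff_subset)
    then show "card W1 < card W" using A \<open>card A < card W\<close> by linarith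
  qed
  have lift1: "unfold_set r A {x} = fibre r A x" for x by (simp add: unfold_set_def)
  let ?m1 = "contract_mult r A m" and ?a1 = "contract_fun r A a" and ?l1 = "contract_fun r A l"
    and ?b1 = "contract_fun r A b"
  show ?thesis
  proof (rule orientable_contract[OF mult a0 l0])
    have "admissible k W1 (U - A) ?m1 ?a1 ?l1 ?b1"
      unfolding admissible_def
    proof (intro conjI)
      show "finite W1" using fin by simp
      show "multiplicity_fun ?m1" using contract_mult_valid mult by blast
      show "\<forall>x. 0 \<le> ?a1 x \<and> 0 \<le> ?l1 x"
        using contract_fun_nonneg a0 l0 by blast
      show "\<forall>x\<in>W1. even (bd W1 ?m1 ?a1 ?l1 {x} + ?b1 x)" (is "\<forall>x\<in>W1. ?even x")
      proof
        fix x assume x: "x \<in> W1"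
        then have "fibre r A x \<subseteq> W" using A by (auto simp: fibre_def)
        then show "?even x"
          using x bd_contract[of "{x}" m a l] par_set[of "fibre r A x"] by (simp add: lift1 contract_fun_def)
      qed
      have "(\<Sum>x\<in>W1. ?l1 x - ?a1 x) = (\<Sum>x\<in>W. l x - a x)"
        using sum_contract_fun[of W1 l] sum_contract_fun[of W1 a] by (simp add: sum_subtractf unfold_set_whole)
      then show "2 * k dvd sum ?b1 W1 - (\<Sum>x\<in>W1. ?l1 x - ?a1 x)"
        using total sum_contract_fun[of W1 b] by (simp add: unfold_set_whole)
      show "bd W1 ?m1 ?a1 ?l1 W1
          \<le> demand k (sum ?b1 W1)"
        using root sum_contract_fun[of W1 b] bd_contract[of W1 m a l] by (simp add: unfold_set_whole)
      show "\<forall>B. B \<noteq> {} \<and> B \<subset> W1 \<and> B \<noteq> U - A \<longrightarrow> demand k (sum ?b1 B)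
          \<le> bd W1 ?m1 ?a1 ?l1 B" (is "\<forall>B. _ \<longrightarrow> ?bound B")
      proof (intro allI impI, elim conjE)
        fix B assume B: "B \<noteq> {}" "B \<subset> W1" "B \<noteq> U - A"
        have "unfold_set r A B \<noteq> U"
        proof
          assume eq: "unfold_set r A B = U"
          then obtain u where u: "U = {u}" using B(1) flag unfold_set_empty_iff by (metis ex_in_conv)
          have "r \<notin> B"
          proof
            assume "r \<in> B"
            then have "A \<subseteq> {u}" using eq u by (auto simp: unfold_set_def fibre_def)
            then have "card A \<le> 1" using card_mono[of "{u}" A] by simp
            then show False using A by simp
          qed
          then have "unfold_set r A B = B" by (auto simp: unfold_set_def fibre_def)
          moreover have "B \<inter> A = {}" using B(2) \<open>r \<notin> B\<close> by auto
          ultimately show False using eq B(3) by blast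
        qed
        then have "demand k (sum b (unfold_set r A B)) \<le> bd W m a l (unfold_set r A B)"
          using unfold_set_psubset[OF B(2)] unfold_set_empty_iff[of B] B(1) by (intro cut) auto
        then show "?bound B"
          using B sum_contract_fun[of B b] bd_contract[of B m a l] by auto
      qed
      show "\<forall>u\<in>U - A. U - A = {u} \<and> u \<in> W1 \<and> 2 * k dvd ?b1 u \<and>
          2 * ?a1 u \<le> bd W1 ?m1 ?a1 ?l1 {u} \<and>
          2 * ?l1 u \<le> bd W1 ?m1 ?a1 ?l1 {u}" (is "\<forall>u\<in>U - A. ?flag u")
      proof
        fix u assume u: "u \<in> U - A"
        then have "u \<in> W1" "u \<noteq> r" "U - A = {u}" using flag[of u] r by auto
        moreover have "fibre r A u = {u}" using \<open>u \<noteq> r\<close> by (simp add: fibre_def)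
        ultimately show "?flag u"
          using flag[of u] u bd_contract[of "{u}" m a l] by (auto simp: lift1 contract_fun_def)
      qed
    qed
    then show "orientable k W1 ?m1 ?a1 ?l1 ?b1"
      using small by (intro IH_card)
  next
    fix a' l' :: "'v \<Rightarrow> int"
    assume nn: "\<forall>x. 0 \<le> a' x \<and> 0 \<le> l' x"
      and deg: "\<forall>x. a' x + l' x = a x + l x + (\<Sum>y\<in>W - A. m x y)"
      and tot: "2 * k dvd sum b A - (\<Sum>x\<in>A. l' x - a' x)"
    have bd': "bd A m a' l' B = bd W m a l B" if "B \<subseteq> A" for B using bd_inner that deg by blast
    have "admissible k A (U \<inter> A) m a' l' b"
      unfolding admissible_def
    proof (intro conjI)
      show "\<forall>x\<in>A. even (bd A m a' l' {x} + b x)" using bd' par A by auto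
      show "bd A m a' l' A \<le> demand k (sum b A)" using bd' tight by simp
      show "\<forall>B. B \<noteq> {} \<and> B \<subset> A \<and> B \<noteq> U \<inter> A \<longrightarrow> demand k (sum b B) \<le> bd A m a' l' B" (is "\<forall>B. _ \<longrightarrow> ?bound B")
      proof (intro allI impI, elim conjE)
        fix B assume B: "B \<noteq> {}" "B \<subset> A" "B \<noteq> U \<inter> A"
        then have "B \<subset> W" "B \<noteq> U" using A by auto
        then show "?bound B"
          using cut[of B] bd'[of B] B by auto
      qed
      show "\<forall>u\<in>U \<inter> A. U \<inter> A = {u} \<and> u \<in> A \<and> 2 * k dvd b u \<and>
          2 * a' u \<le> bd A m a' l' {u} \<and> 2 * l' u \<le> bd A m a' l' {u}" (is "\<forall>u\<in>U \<inter> A. ?flag u")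
      proof
        fix u assume u: "u \<in> U \<inter> A"
        then have U: "U = {u}" "2 * k dvd b u" using flag by auto
        have "A - {u} \<noteq> {}"
          using A(2) card_mono[of "{u}" A] by auto
        then have "demand k (sum b (A - {u})) \<le> bd W m a l (A - {u})"
          using cut[of "A - {u}"] A U by auto
        moreover have "cdist k (sum b (A - {u})) = cdist k (sum b A)"
          using U u finite_A by (intro cdist_cong) (simp add: sum.remove)
        moreover have "bd W m a l A = bd W m a l {u} + bd W m a l (A - {u}) - 2 * between m {u} (A - {u})"
          using bd_Un[of W "{u}" "A - {u}" m a l] fin mult u A by (auto simp: insert_absorb)
        moreover have "bd W m a l {u} = between m {u} (A - {u}) + a' u + l' u"
          using bd'[of "{u}"] u by (simp add: bd_def)
        ultimately have "a' u + l' u \<le> between m {u} (A - {u})" using tight by linarith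
        then show "?flag u"
          using U u nn bd'[of "{u}"] \<open>bd W m a l {u} = between m {u} (A - {u}) + a' u + l' u\<close>
          by (auto simp: algebra_simps) (smt (verit))+
      qed
    qed (use nn tot mult finite_A in auto)
    then show "orientable k A m a' l' b" using small by (intro IH_card)
  qed
qed

text \<open>
  Reversing all arcs exchanges \<open>a\<close> with \<open>l\<close> and negates the targets.  Every reduction below thus
  has a mirror image.
\<close>

lemma reverse_adm: "admissible k W U m l a (\<lambda>x. - b x)"
  unfolding admissible_def
proof (intro conjI)
  show "\<forall>x\<in>W. even (bd W m l a {x} + - b x)" using par by (simp add: bd_swap)
  have "(\<Sum>x\<in>W. - b x) - (\<Sum>x\<in>W. a x - l x) = - (sum b W - (\<Sum>x\<in>W. l x - a x))"
    by (simp add: sum_negf sum_subtractf)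
  then show "2 * k dvd (\<Sum>x\<in>W. - b x) - (\<Sum>x\<in>W. a x - l x)" using total by (simp only: dvd_minus_iff)
  show "bd W m l a W \<le> demand k (\<Sum>x\<in>W. - b x)" using root by (simp add: bd_swap sum_negf)
  show "\<forall>A. A \<noteq> {} \<and> A \<subset> W \<and> A \<noteq> U \<longrightarrow> demand k (\<Sum>x\<in>A. - b x) \<le> bd W m l a A"
    using cut by (simp add: bd_swap sum_negf)
  show "\<forall>u\<in>U. U = {u} \<and> u \<in> W \<and> 2 * k dvd - b u \<and> 2 * l u \<le> bd W m l a {u} \<and> 2 * a u \<le> bd W m l a {u}"
    using flag by (simp add: bd_swap[of W m l a]) blast
qed (use fin mult a0 l0 in auto)

lemma reverse_IH_flag: "U = {} \<Longrightarrow> admissible k W {u} m l a (\<lambda>x. - b x) \<Longrightarrow> orientable k W m l a (\<lambda>x. - b x)"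
proof -
  assume U: "U = {}" and "admissible k W {u} m l a (\<lambda>x. - b x)"
  then interpret R: reduction k W "{u}" m l a "\<lambda>x. - b x"
    using big IH_card IH_edges IH_root by unfold_locales (auto simp: bd_swap[of W m l a])
  have "admissible k W {u} m a l b" using R.reverse_adm by simp
  then have "orientable k W m a l b" by (rule IH_flag[OF U])
  then have "orientable k W m a l (\<lambda>x. - (- b x))" by simp
  then show ?thesis by (rule orientable_reverse)
qed

lemma reverse_reduction: "reduction k W U m l a (\<lambda>x. - b x)"
  using reverse_adm big IH_card IH_edges IH_root reverse_IH_flag
  by unfold_locales (auto simp: bd_swap[of W m l a])

end

section \<open>Slack at larger sets and splitting off a flagged vertex\<close>

lemma multiplicity_lift:
  assumes m: "multiplicity_fun m" and "y \<noteq> z" "u \<noteq> y" "u \<noteq> z" "1 \<le> m u y" "1 \<le> m u z"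
  shows "multiplicity_fun (add_edge u y (-1) (add_edge u z (-1) (add_edge y z 1 m)))"
proof -
  have "0 \<le> m y z + 1" using multiplicity_funD(2)[OF m, of y z] by simp
  then have "multiplicity_fun (add_edge y z 1 m)" by (intro multiplicity_add_edge m assms)
  then have "multiplicity_fun (add_edge u z (-1) (add_edge y z 1 m))"
    by (rule multiplicity_add_edge) (use assms in \<open>auto simp: add_edge_apply\<close>)
  then show ?thesis
    by (rule multiplicity_add_edge) (use assms in \<open>auto simp: add_edge_apply\<close>)
qed

text \<open>
  Boundary and distance have the same parity, so sets of two or more vertices that are not tight have a
  slack of two.
\<close>

locale slack_reduction = reduction +
  assumes slack: "A \<subset> W \<Longrightarrow> 2 \<le> card A \<Longrightarrow> 2 * k + cdist k (sum b A) \<le> bd W m a l A"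
begin

lemma reverse_slack: "slack_reduction k W U m l a (\<lambda>x. - b x)"
proof -
  interpret R: reduction k W U m l a "\<lambda>x. - b x" by (rule reverse_reduction)
  show ?thesis using slack by unfold_locales (simp add: bd_swap[of W m l a] sum_negf)
qed

lemma single_psubset: "x \<in> W \<Longrightarrow> {x} \<subset> W"
  using big by (cases "W = {x}") auto

text \<open>
  For sets of two or more vertices, \<open>cdist\<close> changes by no more than the target does, so the slack
  absorbs a loss of two in total.  The conditions at single vertices have to be checked one by one.
\<close>

lemma admissible_perturb:
  assumes "multiplicity_fun m'" "\<And>x. 0 \<le> a' x" "\<And>x. 0 \<le> l' x"
    and par': "\<And>x. x \<in> W \<Longrightarrow> even ((bd W m' a' l' {x} - bd W m a l {x}) + (b' x - b x))"
    and total': "2 * k dvd (sum b' W - sum b W) - ((sum l' W - sum l W) - (sum a' W - sum a W))"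
    and root': "bd W m' a' l' W \<le> demand k (sum b' W)"
    and single': "\<And>x. x \<in> W \<Longrightarrow> {x} \<noteq> U' \<Longrightarrow> demand k (b' x) \<le> bd W m' a' l' {x}"
    and set': "\<And>A. A \<subset> W \<Longrightarrow> 2 \<le> card A \<Longrightarrow>
        \<bar>sum b' A - sum b A\<bar> \<le> 2 + (bd W m' a' l' A - bd W m a l A)"
    and flag': "\<And>u. u \<in> U' \<Longrightarrow> U' = {u} \<and> u \<in> W \<and> 2 * k dvd b' u \<and>
        2 * a' u \<le> bd W m' a' l' {u} \<and> 2 * l' u \<le> bd W m' a' l' {u}"
  shows "admissible k W U' m' a' l' b'"
  unfolding admissible_def
proof (intro conjI)
  show "\<forall>x\<in>W. even (bd W m' a' l' {x} + b' x)"
  proof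
    fix x assume x: "x \<in> W"
    have "bd W m' a' l' {x} + b' x
        = ((bd W m' a' l' {x} - bd W m a l {x}) + (b' x - b x)) + (bd W m a l {x} + b x)" by simp
    then show "even (bd W m' a' l' {x} + b' x)" using dvd_add[OF par'[OF x] par[OF x]] by (simp only:)
  qed
  have "sum b' W - (\<Sum>x\<in>W. l' x - a' x) = ((sum b' W - sum b W) - ((sum l' W - sum l W) - (sum a' W - sum a W)))
      + (sum b W - (\<Sum>x\<in>W. l x - a x))" by (simp add: sum_subtractf)
  then show "2 * k dvd sum b' W - (\<Sum>x\<in>W. l' x - a' x)" using dvd_add[OF total' total] by (simp only:)
  show "\<forall>A. A \<noteq> {} \<and> A \<subset> W \<and> A \<noteq> U' \<longrightarrow> demand k (sum b' A) \<le> bd W m' a' l' A"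
  proof (intro allI impI, elim conjE)
    fix A assume A: "A \<noteq> {}" "A \<subset> W" "A \<noteq> U'"
    have "finite A" using A finA by blast
    consider x where "A = {x}" | "2 \<le> card A"
    proof (cases "card A = 1")
      case True then show ?thesis using that(1) card_1_singletonE by blast
    next
      case False
      moreover have "card A \<noteq> 0" using A(1) \<open>finite A\<close> by simp
      ultimately show ?thesis using that(2) by linarith
    qed
    then show "demand k (sum b' A) \<le> bd W m' a' l' A"
    proof cases
      case 1 then show ?thesis using single' A by auto
    next
      case 2
      have "cdist k (sum b' A) \<le> cdist k (sum b A) + \<bar>sum b' A - sum b A\<bar>"
        using cdist_shift_le[of "sum b A" "sum b' A - sum b A"] by simp
      then show ?thesis using slack[OF A(2) 2] set'[OF A(2) 2] by linarith
    qed
  qed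
  show "\<forall>u\<in>U'. U' = {u} \<and> u \<in> W \<and> 2 * k dvd b' u \<and>
      2 * a' u \<le> bd W m' a' l' {u} \<and> 2 * l' u \<le> bd W m' a' l' {u}"
    by (intro ballI flag')
qed (simp_all add: assms(1-3) fin root')

lemma flag_even:
  assumes "u \<in> U" shows "even (bd W m a l {u})"
proof -
  have "u \<in> W" "2 * k dvd b u" using flag[OF assms] by simp_all
  then have "even (b u)" using dvd_trans[of 2 "2 * k" "b u"] by simp
  then show ?thesis using par[OF \<open>u \<in> W\<close>] by simp
qed

lemma single_cut: "x \<in> W \<Longrightarrow> {x} \<noteq> U \<Longrightarrow> demand k (b x) \<le> bd W m a l {x}"
  using cut[of "{x}"] single_psubset by simp

lemma flagged_lift_root:
  assumes u: "u \<in> U" and y: "y \<in> W" "1 \<le> m u y" and au: "l u \<le> a u" "1 \<le> a u"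
  shows "orientable k W m a l b"
proof -
  note U = flag[OF u]
  have uy: "u \<noteq> y" using y mD(3) by fastforce
  have deg: "bd W m a l {u} = (\<Sum>y\<in>W. m u y) + a u + l u" using U by (intro bd_singleton fin mult) simp
  moreover have "m u y \<le> (\<Sum>y\<in>W. m u y)" using y fin mD(2) by (intro member_le_sum) auto
  moreover obtain q where "bd W m a l {u} = 2 * q" using flag_even[OF u] by blast
  \<comment> \<open>The edge \<open>uy\<close> leaves less than half of the degree to \<open>l u\<close>, and the degree is even.\<close>
  ultimately have "2 * l u < 2 * q" and q: "bd W m a l {u} = 2 * q" using y au by linarith+
  then have lu: "2 * l u \<le> bd W m a l {u} - 2" by simp
  let ?m = "add_edge u y (-1) m" and ?a = "bump u (-1) (bump y 1 a)"
  have bd': "bd W ?m ?a l A = bd W m a l A - of_bool ((u \<in> A) \<noteq> (y \<in> A)) - of_bool (u \<in> A) + of_bool (y \<in> A)"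
    if "A \<subseteq> W" for A
    using that finA[OF that] U y fin by (simp add: bd_add_edge bd_bump_in)
  have "admissible k W U ?m ?a l b"
  proof (rule admissible_perturb)
    show "multiplicity_fun ?m" by (rule multiplicity_add_edge) (use mult uy y in auto)
    show "0 \<le> ?a x" for x using a0[of x] au uy by (auto simp: bump_def)
    show "bd W ?m ?a l W \<le> demand k (sum b W)" using bd'[of W] root U y by simp
    show "demand k (b x) \<le> bd W ?m ?a l {x}" if "x \<in> W" "{x} \<noteq> U" for x
      using single_cut[OF that] bd'[of "{x}"] that U uy by auto
    show "v \<in> U \<Longrightarrow> U = {v} \<and> v \<in> W \<and> 2 * k dvd b v \<and>
        2 * ?a v \<le> bd W ?m ?a l {v} \<and> 2 * l v \<le> bd W ?m ?a l {v}" for v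
      using U bd'[of "{u}"] uy lu by (auto simp: bump_def)
  qed (use l0 fin U y bd' uy in \<open>auto simp: sum_bump\<close>)
  moreover have "between ?m W W < between m W W" using fin U y by (simp add: between_add_edge)
  ultimately have o: "orientable k W ?m ?a l b" by (intro IH_edges)
  have "u \<in> W" using U by simp
  then show ?thesis by (rule orientable_lift_root_in[OF fin _ y(1) o])
qed

lemma flagged_lift:
  assumes u: "u \<in> U" and yz: "y \<in> W" "z \<in> W" "y \<noteq> z" "1 \<le> m u y" "1 \<le> m u z" and au: "a u = 0" "l u = 0"
  shows "orientable k W m a l b"
proof -
  note U = flag[OF u]
  have ne: "u \<noteq> y" "u \<noteq> z" using yz mD(3) by fastforce+
  let ?m = "add_edge u y (-1) (add_edge u z (-1) (add_edge y z 1 m))"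
  have bd': "bd W ?m a l A = bd W m a l A + of_bool ((y \<in> A) \<noteq> (z \<in> A))
      - of_bool ((u \<in> A) \<noteq> (z \<in> A)) - of_bool ((u \<in> A) \<noteq> (y \<in> A))" if "A \<subseteq> W" for A
    using that U yz fin by (simp add: bd_add_edge)
  have mm: "multiplicity_fun ?m" by (intro multiplicity_lift mult yz ne)
  have "admissible k W U ?m a l b"
  proof (rule admissible_perturb)
    show "demand k (b x) \<le> bd W ?m a l {x}" if "x \<in> W" "{x} \<noteq> U" for x
      using single_cut[OF that] bd'[of "{x}"] that U ne yz by auto
    show "v \<in> U \<Longrightarrow> U = {v} \<and> v \<in> W \<and> 2 * k dvd b v \<and>
        2 * a v \<le> bd W ?m a l {v} \<and> 2 * l v \<le> bd W ?m a l {v}" for v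
      using U au bd_singleton[OF fin _ mm, of u a l] mm by (auto simp: multiplicity_funD(2) sum_nonneg)
  qed (use l0 a0 fin U yz bd' ne root mm in \<open>auto\<close>)
  moreover have "between ?m W W < between m W W" using fin U yz by (simp add: between_add_edge)
  ultimately have o: "orientable k W ?m a l b" by (intro IH_edges)
  have "u \<in> W" using U by simp
  then show ?thesis by (rule orientable_lift[OF fin _ yz(1-3) mD(2) o ne])
qed

text \<open>
  Half of the edges between \<open>u\<close> and each other vertex are directed away from \<open>u\<close>, which keeps all balances.
  A set \<open>A\<close> that contains the other ends of all edges at \<open>u\<close> has, after the deletion of \<open>u\<close>, the
  boundary that \<open>insert u A\<close> had before.
\<close>

lemma flagged_delete:
  assumes u: "u \<in> U" and au: "a u = l u" and ev: "\<And>x. x \<in> W \<Longrightarrow> even (m u x)"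
    and cases: "\<And>A. A \<subseteq> W - {u} \<Longrightarrow> between m A {u} = 0 \<or> between m A {u} = bd W m a l {u}"
  shows "orientable k W m a l b"
proof -
  note U = flag[OF u]
  let ?W = "W - {u}"
  have bd': "bd ?W m a l A = bd W m a l A - between m A {u}" if "A \<subseteq> ?W" for A
  proof -
    have "W - A = (?W - A) \<union> {u}" using that U by auto
    then have "between m A (W - A) = between m A (?W - A) + between m A {u}"
      using between_Un_right[of "?W - A" "{u}" m A] fin by simp
    then show ?thesis by (simp add: bd_def)
  qed
  have ins: "bd W m a l (insert u A) = bd W m a l A + bd W m a l {u} - 2 * between m A {u}"
    if "A \<subseteq> ?W" for A
    using that bd_Un[of W A "{u}" m a l] fin U mult by auto
  have b_ins: "cdist k (sum b (insert u A)) = cdist k (sum b A)" if "A \<subseteq> ?W" for A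
  proof (rule cdist_cong)
    have "u \<notin> A" "finite A" using that finA[of A] by auto
    then show "2 * k dvd sum b (insert u A) - sum b A" using U by simp
  qed
  have splitW: "sum g W = g u + sum g ?W" for g :: "'a \<Rightarrow> int"
    using fin U by (simp add: sum.remove)
  have "admissible k ?W {} m a l b"
    unfolding admissible_def
  proof (intro conjI)
    show "\<forall>x\<in>?W. even (bd ?W m a l {x} + b x)"
    proof
      fix x assume x: "x \<in> ?W"
      have "even (m x u)" using ev[of x] mD(1)[of x u] x by simp
      then show "even (bd ?W m a l {x} + b x)" using bd'[of "{x}"] x par[of x] by (simp add: between_def)
    qed
    show "2 * k dvd sum b ?W - (\<Sum>x\<in>?W. l x - a x)"
    proof -
      have "sum b ?W - (\<Sum>x\<in>?W. l x - a x) = (sum b W - (\<Sum>x\<in>W. l x - a x)) - b u"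
        using splitW[of b] splitW[of "\<lambda>x. l x - a x"] au by simp
      then show ?thesis using dvd_diff[OF total, of "b u"] U by (simp only:)
    qed
    have "cdist k (sum b ?W) = cdist k (sum b W)"
      using b_ins[of ?W] U by (simp add: insert_absorb)
    moreover have "bd ?W m a l ?W \<le> bd W m a l W"
      unfolding bd_whole using splitW[of "\<lambda>x. a x + l x"] a0[of u] l0[of u] by simp
    ultimately show "bd ?W m a l ?W \<le> demand k (sum b ?W)" using root by simp
    show "\<forall>A. A \<noteq> {} \<and> A \<subset> ?W \<and> A \<noteq> {} \<longrightarrow> demand k (sum b A) \<le> bd ?W m a l A"
    proof (intro allI impI, elim conjE)
      fix A assume A: "A \<noteq> {}" "A \<subset> ?W"
      then have As: "A \<subseteq> ?W" by blast
      have c1: "demand k (sum b A) \<le> bd W m a l A"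
        using A U by (intro cut) auto
      have c2: "demand k (sum b (insert u A)) \<le> bd W m a l (insert u A)"
        using A U by (intro cut) auto
      show "demand k (sum b A) \<le> bd ?W m a l A"
        using c1 c2 cases[OF As] bd'[OF As] ins[OF As] b_ins[OF As] by linarith
    qed
  qed (use fin mult a0 l0 in auto)
  moreover have "card ?W < card W" using U fin by (intro psubset_card_mono) auto
  ultimately have "orientable k ?W m a l b" by (intro IH_card)
  moreover have h2: "2 * (m u x div 2) = m u x" if "x \<in> W" for x using ev[OF that] by simp
  ultimately have "orientable k ?W m (\<lambda>y. a y + m u y div 2) (\<lambda>y. l y + (m u y - m u y div 2)) b"
    using h2 by (elim orientable_shift) auto
  moreover have "\<forall>y. 0 \<le> m u y div 2 \<and> m u y div 2 \<le> m u y"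
  proof
    fix y have "0 \<le> m u y" by (rule mD(2))
    then show "0 \<le> m u y div 2 \<and> m u y div 2 \<le> m u y" by linarith
  qed
  moreover have "(\<Sum>y\<in>?W. 2 * (m u y div 2) - m u y) = 0" using h2 by (intro sum.neutral) auto
  ultimately show ?thesis
    using orientable_delete_vertex[of W u m "\<lambda>y. m u y div 2" k l a b] fin U mult au by simp
qed

text \<open>
  Lift arcs at the root with edges at \<open>u\<close>, starting with the more frequent direction, then pairs of edges
  with distinct ends, until all edges at \<open>u\<close> lead to the root or all lead to the same vertex.
\<close>

lemma flagged_orientable:
  assumes u: "u \<in> U"
  shows "orientable k W m a l b"
proof -
  note U = flag[OF u]
  interpret R: slack_reduction k W U m l a "\<lambda>x. - b x" by (rule reverse_slack)
  have deg: "bd W m a l {u} = (\<Sum>y\<in>W. m u y) + a u + l u" using U by (intro bd_singleton fin mult) simp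
  have between_u: "between m A {u} = (\<Sum>x\<in>A. m u x)" for A
    unfolding between_def using mD(1) by (auto intro: sum.cong)
  show ?thesis
  proof (cases "\<exists>y\<in>W. 1 \<le> m u y")
    case False
    have z: "m u x = 0" if "x \<in> W" for x using False that mD(2)[of u x] by force
    then have s0: "(\<Sum>x\<in>A. m u x) = 0" if "A \<subseteq> W" for A using that by (intro sum.neutral) auto
    then have "a u = l u" using deg U by auto
    moreover have "between m A {u} = 0" if "A \<subseteq> W - {u}" for A using s0[of A] that between_u by auto
    ultimately show ?thesis using z u by (intro flagged_delete) auto
  next
    case True
    then obtain y where y: "y \<in> W" "1 \<le> m u y" by blast
    consider "l u \<le> a u" "1 \<le> a u" | "a u \<le> l u" "1 \<le> l u" | "a u = 0" "l u = 0"
      using a0[of u] l0[of u] by linarith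
    then show ?thesis
    proof cases
      case 1 then show ?thesis using u y by (intro flagged_lift_root[of u y])
    next
      case 2
      then have "orientable k W m l a (\<lambda>x. - b x)" using u y by (intro R.flagged_lift_root[of u y])
      then show ?thesis by (rule orientable_reverse)
    next
      case 3
      show ?thesis
      proof (cases "\<exists>z\<in>W. z \<noteq> y \<and> 1 \<le> m u z")
        case True then show ?thesis using flagged_lift[of u y] u y 3 by auto
      next
        case False
        have z: "m u x = 0" if "x \<in> W" "x \<noteq> y" for x using False that mD(2)[of u x] by force
        have sA: "(\<Sum>x\<in>A. m u x) = (if y \<in> A then m u y else 0)" if "A \<subseteq> W" for A
        proof -
          have "(\<Sum>x\<in>A. m u x) = (\<Sum>x\<in>A. if x = y then m u y else 0)"
            using that z by (intro sum.cong) auto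
          then show ?thesis using finA[OF that] by simp
        qed
        have "even (m u y)" using flag_even[OF u] deg 3 sA[of W] y by simp
        then have "even (m u x)" if "x \<in> W" for x using z[of x] that by (cases "x = y") auto
        moreover have "between m A {u} = 0 \<or> between m A {u} = bd W m a l {u}" if "A \<subseteq> W - {u}" for A
        proof -
          have "A \<subseteq> W" using that by blast
          then show ?thesis using sA[of A] sA[of W] between_u[of A] deg 3 y(1) by simp
        qed
        ultimately show ?thesis using u 3 by (intro flagged_delete) auto
      qed
    qed
  qed
qed

end

section \<open>Deleting arcs when no vertex is flagged\<close>

locale unflagged_reduction = slack_reduction +
  assumes U_empty: "U = {}"
begin

lemma reverse_unflagged: "unflagged_reduction k W U m l a (\<lambda>x. - b x)"
proof -
  interpret R: slack_reduction k W U m l a "\<lambda>x. - b x" by (rule reverse_slack)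
  show ?thesis using U_empty by unfold_locales
qed

lemma single_bound: "x \<in> W \<Longrightarrow> demand k (b x) \<le> bd W m a l {x}"
  using single_cut[of x] U_empty by simp

text \<open>
  The lower bound for \<open>W - {x}\<close> and the upper bound for \<open>W\<close> involve the same distance.  Their
  difference says that at most half of the edges at \<open>x\<close> are arcs at the root, so \<open>x\<close> can be flagged.
\<close>

lemma zero_vertex:
  assumes x: "x \<in> W" and z: "cdist k (b x) = 0"
  shows "orientable k W m a l b"
proof (rule IH_flag[OF U_empty])
  have bx: "2 * k dvd b x" using z cdist_zero_dvd by simp
  let ?A = "W - {x}"
  have "?A \<noteq> {}" using single_psubset[OF x] by blast
  then have "demand k (sum b ?A) \<le> bd W m a l ?A" using x U_empty by (intro cut) auto
  moreover have "cdist k (sum b W) = cdist k (sum b ?A)"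
    using bx x fin by (intro cdist_cong) (simp add: sum.remove)
  moreover have "bd W m a l W = bd W m a l {x} + bd W m a l ?A - 2 * between m {x} ?A"
    using bd_Un[of W "{x}" ?A m a l] fin mult x by (simp add: insert_absorb)
  moreover have "bd W m a l {x} = between m {x} ?A + a x + l x" by (simp add: bd_def)
  ultimately have "2 * a x + 2 * l x \<le> bd W m a l {x}" using root by linarith
  then have "2 * a x \<le> bd W m a l {x}" "2 * l x \<le> bd W m a l {x}"
    using a0[of x] l0[of x] by linarith+
  then show "admissible k W {x} m a l b"
    unfolding admissible_def
    using fin mult a0 l0 par total root cut U_empty bx x by auto
qed

text \<open>
  Deleting an arc that leaves \<open>x\<close> lowers both the degree and the target of \<open>x\<close> by one; \<open>x\<close> is out-good if
  its cut condition survives this.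
\<close>

definition out_good :: "'a \<Rightarrow> bool" where
  "out_good x \<longleftrightarrow> demand k (b x - 1) \<le> bd W m a l {x} - 1"

definition in_good :: "'a \<Rightarrow> bool" where
  "in_good x \<longleftrightarrow> demand k (b x + 1) \<le> bd W m a l {x} - 1"

lemma out_or_in_good:
  assumes "x \<in> W" "cdist k (b x) \<noteq> 0"
  shows "out_good x \<or> in_good x"
  using cdist_decrease[OF assms(2)] single_bound[OF assms(1)] unfolding out_good_def in_good_def by linarith

text \<open>
  Larger sets lose at most one edge and change their target by at most one, so only the conditions at
  \<open>x\<close> and \<open>y\<close> matter.
\<close>

lemma delete_edge:
  assumes xy: "x \<in> W" "y \<in> W" "1 \<le> m x y" and g: "out_good x" "in_good y"
  shows "orientable k W m a l b"
proof -
  have ne: "x \<noteq> y" using xy mD(3)[of x] by auto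
  let ?m = "add_edge x y (-1) m" and ?b = "bump x (-1) (bump y 1 b)"
  have bd': "bd W ?m a l A = bd W m a l A - of_bool ((x \<in> A) \<noteq> (y \<in> A))" if "A \<subseteq> W" for A
    using that xy fin by (simp add: bd_add_edge)
  have b': "sum ?b A = sum b A - of_bool (x \<in> A) + of_bool (y \<in> A)" if "A \<subseteq> W" for A
    using finA[OF that] by (simp add: sum_bump)
  have "admissible k W {} ?m a l ?b"
  proof (rule admissible_perturb)
    show "multiplicity_fun ?m" by (rule multiplicity_add_edge) (use mult ne xy in auto)
    show "even (bd W ?m a l {z} - bd W m a l {z} + (?b z - b z))" if "z \<in> W" for z
      using bd'[of "{z}"] that ne by (auto simp: bump_def)
    show "demand k (?b z) \<le> bd W ?m a l {z}" if "z \<in> W" "{z} \<noteq> {}" for z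
      using bd'[of "{z}"] that ne g single_bound[of z] by (auto simp: bump_def out_good_def in_good_def)
    show "\<bar>sum ?b A - sum b A\<bar> \<le> 2 + (bd W ?m a l A - bd W m a l A)" if "A \<subset> W" for A
      using bd'[of A] b'[of A] that by auto
  qed (use a0 l0 root bd'[of W] b'[of W] xy in auto)
  moreover have "between ?m W W < between m W W" using fin xy by (simp add: between_add_edge)
  ultimately have "orientable k W ?m a l ?b" by (intro IH_edges)
  then show ?thesis by (rule orientable_delete_arc[OF fin xy(1,2)])
qed

text \<open>
  The degree of the root drops by one, its upper bound by at most one.
\<close>

lemma delete_root_arc:
  assumes x: "x \<in> W" "1 \<le> a x" and g: "in_good x"
  shows "orientable k W m a l b"
proof -
  let ?a = "bump x (-1) a" and ?b = "bump x 1 b"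
  have bd': "bd W m ?a l A = bd W m a l A - of_bool (x \<in> A)" if "A \<subseteq> W" for A
    using finA[OF that] by (simp add: bd_bump_in)
  have b': "sum ?b A = sum b A + of_bool (x \<in> A)" if "A \<subseteq> W" for A
    using finA[OF that] by (simp add: sum_bump)
  have "admissible k W {} m ?a l ?b"
  proof (rule admissible_perturb)
    show "0 \<le> ?a z" for z using a0[of z] x by (auto simp: bump_def)
    show "even (bd W m ?a l {z} - bd W m a l {z} + (?b z - b z))" if "z \<in> W" for z
      using bd'[of "{z}"] that by (auto simp: bump_def)
    show "demand k (?b z) \<le> bd W m ?a l {z}" if "z \<in> W" "{z} \<noteq> {}" for z
      using bd'[of "{z}"] that g single_bound[of z] by (auto simp: bump_def in_good_def)
    show "\<bar>sum ?b A - sum b A\<bar> \<le> 2 + (bd W m ?a l A - bd W m a l A)" if "A \<subset> W" for A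
      using bd'[of A] b'[of A] that by auto
    have "cdist k (sum b W) \<le> cdist k (sum b W + 1) + 1" using cdist_shift_le[of "sum b W + 1" "-1"] by simp
    then show "bd W m ?a l W \<le> demand k (sum ?b W)"
      using bd'[of W] b'[of W] x root by simp
    show "2 * k dvd sum ?b W - sum b W - (sum l W - sum l W - (sum ?a W - sum a W))"
      using x fin by (simp add: sum_bump)
  qed (use l0 mult in auto)
  moreover have "bd W m ?a l W < bd W m a l W" using bd'[of W] x by simp
  ultimately have "orientable k W m ?a l ?b" by (intro IH_root)
  then show ?thesis by (rule orientable_shift) (simp add: bump_def)
qed

text \<open>
  Every target has its nearest representative between \<open>1\<close> and \<open>k - 1\<close>, and the root has only outgoing
  arcs.  Choose an edge between \<open>x\<close> and \<open>y\<close>, delete it as an arc from \<open>y\<close> to \<open>x\<close>, which suits \<open>y\<close>, and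
  add \<open>c = k - t\<close> arcs from \<open>x\<close> to the root, where \<open>t\<close> represents the target of \<open>x\<close>.  This target becomes
  \<open>t + 1 + c = k + 1\<close>, at distance \<open>k - 1\<close> only, for which the new degree \<open>2k - 2 + t - 1 + c\<close> of \<open>x\<close> is
  exactly sufficient.
\<close>

lemma all_out_good:
  assumes nz: "\<And>x. x \<in> W \<Longrightarrow> cdist k (b x) \<noteq> 0"
    and og: "\<And>x. x \<in> W \<Longrightarrow> out_good x" and nig: "\<And>x. x \<in> W \<Longrightarrow> \<not> in_good x"
    and no_out: "\<And>x. x \<in> W \<Longrightarrow> l x = 0"
  shows "orientable k W m a l b"
proof -
  define D where "D = sum a W"
  have W_root: "bd W m a l W = D" using no_out by (simp add: bd_whole D_def)
  have total_D: "2 * k dvd sum b W + D"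
    using total no_out by (simp add: D_def sum_negf)
  have D0: "0 \<le> D" using a0 by (simp add: D_def sum_nonneg)
  have cdist_W: "cdist k (sum b W + c) = cdist k (c - D)" for c
    using total_D by (intro cdist_cong) simp
  have D_le: "D \<le> 2 * k - 1"
    using root_degree_bound[OF D0] root cdist_W[of 0] W_root by simp
  have tight: "bd W m a l {x} = demand k (b x)" "2 * k dvd b x - cdist k (b x)"
    "1 \<le> cdist k (b x)" "cdist k (b x) \<le> k - 1" if "x \<in> W" for x
  proof -
    have "bd W m a l {x} - 1 < demand k (b x + 1)" using nig[OF that] by (simp add: in_good_def)
    note * = cdist_at_tight_vertex[OF par[OF that] nz[OF that] single_bound[OF that] this]
    show "bd W m a l {x} = demand k (b x)" "2 * k dvd b x - cdist k (b x)"
      "1 \<le> cdist k (b x)" "cdist k (b x) \<le> k - 1"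
      using * nz[OF that] cdist_nonneg[of "b x"] by linarith+
  qed
  \<comment> \<open>Without edges inside \<open>W\<close>, two vertices alone would need more arcs than the root has.\<close>
  obtain x y where xy: "x \<in> W" "y \<in> W" "1 \<le> m x y"
  proof (rule ccontr)
    assume none: "\<not> thesis"
    note ex = that
    have z: "m x y = 0" if xy: "x \<in> W" "y \<in> W" for x y
    proof -
      have "\<not> 1 \<le> m x y" using ex xy none by blast
      then show ?thesis using mD(2)[of x y] by linarith
    qed
    obtain p q where pq: "p \<in> W" "q \<in> W" "p \<noteq> q"
      using big by (metis card_le_Suc0_iff_eq fin not_less_eq_eq numeral_2_eq_2)
    have "bd W m a l {v} = a v" if "v \<in> W" for v
      using bd_singleton[OF fin that mult] z[OF that] no_out[OF that] by simp
    then have "4 * k - 2 \<le> a p + a q" using pq tight[of p] tight[of q] by simp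
    also have "a p + a q \<le> D"
      unfolding D_def using pq fin a0 sum_mono2[of W "{p, q}" a] by simp
    finally show False using D_le k_pos by linarith
  qed
  have ne: "x \<noteq> y" using xy mD(3)[of x] by auto
  define c where "c = k - cdist k (b x)"
  have c: "1 \<le> c" "c \<le> k - 1" using tight[OF xy(1)] by (auto simp: c_def)
  let ?m = "add_edge y x (-1) m" and ?l = "bump x c l" and ?b = "bump y (-1) (bump x (c + 1) b)"
  have bd': "bd W ?m a ?l A = bd W m a l A - of_bool ((y \<in> A) \<noteq> (x \<in> A)) + c * of_bool (x \<in> A)"
    if "A \<subseteq> W" for A
    using that xy fin finA[OF that] by (simp add: bd_add_edge bd_bump_out)
  have b': "sum ?b A = sum b A - of_bool (y \<in> A) + (c + 1) * of_bool (x \<in> A)" if "A \<subseteq> W" for A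
    using finA[OF that] by (simp add: sum_bump)
  have "m y x = m x y" by (rule mD(1))
  have "admissible k W {} ?m a ?l ?b"
  proof (rule admissible_perturb)
    show "multiplicity_fun ?m"
      by (rule multiplicity_add_edge) (use mult ne xy \<open>m y x = m x y\<close> in auto)
    show "0 \<le> ?l z" for z using l0[of z] c by (simp add: bump_def)
    show "even (bd W ?m a ?l {z} - bd W m a l {z} + (?b z - b z))" if "z \<in> W" for z
      using bd'[of "{z}"] that ne by (auto simp: bump_def)
    show "demand k (?b z) \<le> bd W ?m a ?l {z}" if "z \<in> W" "{z} \<noteq> {}" for z
    proof -
      consider "z = x" | "z = y" | "z \<noteq> x" "z \<noteq> y" by blast
      then show ?thesis
      proof cases
        case 1
        have "cdist k (b x + c + 1) = cdist k (k + 1)"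
          using tight(2)[OF xy(1)] by (intro cdist_cong) (simp add: c_def algebra_simps)
        also have "\<dots> \<le> k - 1" using cdist_le[of "k + 1" 1] k_pos c by simp
        finally show ?thesis
          using 1 bd'[of "{x}"] xy ne tight(1)[OF xy(1)] by (simp add: bump_def c_def algebra_simps)
      next
        case 2 then show ?thesis using og[OF xy(2)] bd'[of "{y}"] xy ne by (simp add: bump_def out_good_def)
      next
        case 3 then show ?thesis using single_bound[of z] bd'[of "{z}"] that by (simp add: bump_def)
      qed
    qed
    show "\<bar>sum ?b A - sum b A\<bar> \<le> 2 + (bd W ?m a ?l A - bd W m a l A)" if "A \<subset> W" for A
      using bd'[of A] b'[of A] that c by (auto simp: of_bool_def)
    have "D + c \<le> demand k (c - D)" using root_degree_shift D0 D_le c by blast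
    then show "bd W ?m a ?l W \<le> demand k (sum ?b W)"
      using bd'[of W] b'[of W] xy W_root cdist_W[of c] by simp
    show "2 * k dvd sum ?b W - sum b W - (sum ?l W - sum l W - (sum a W - sum a W))"
      using xy fin by (simp add: sum_bump)
  qed (use a0 in auto)
  moreover have "between ?m W W < between m W W" using fin xy by (simp add: between_add_edge)
  ultimately have "orientable k W ?m a ?l ?b" by (intro IH_edges)
  then have "orientable k W ?m a l (bump y (-1) (bump x 1 b))"
    by (rule orientable_shift) (simp add: bump_def algebra_simps)
  then show ?thesis by (rule orientable_delete_arc[OF fin xy(2,1)])
qed

text \<open>
  If no reduction applies, every vertex is either only out-good or only in-good, and there are no edges
  between the two classes.  If both occur, then each edge that leaves one of them is an arc at the root,
  and the two cut conditions together exceed the upper bound at the root.  Otherwise the previous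
  lemma or its mirror image applies.
\<close>

lemma unflagged_orientable: "orientable k W m a l b"
proof (rule ccontr)
  assume not: "\<not> orientable k W m a l b"
  interpret R: unflagged_reduction k W U m l a "\<lambda>x. - b x" by (rule reverse_unflagged)
  have no_rev: "\<not> orientable k W m l a (\<lambda>x. - b x)" using not orientable_reverse by blast
  have sw: "R.in_good x = out_good x" "R.out_good x = in_good x" for x
    using cdist_minus[of "b x - 1"] cdist_minus[of "b x + 1"]
    by (simp_all add: R.in_good_def R.out_good_def in_good_def out_good_def bd_swap[of W m l a])
  have nz: "cdist k (b x) \<noteq> 0" if "x \<in> W" for x using zero_vertex that not by blast
  have no_edge: "m x y = 0" if "x \<in> W" "y \<in> W" "out_good x" "in_good y" for x y
  proof -
    have "\<not> 1 \<le> m x y" using delete_edge that not by blast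
    then show ?thesis using mD(2)[of x y] by linarith
  qed
  have no_in: "a x = 0" if "x \<in> W" "in_good x" for x
  proof -
    have "\<not> 1 \<le> a x" using delete_root_arc that not by blast
    then show ?thesis using a0[of x] by linarith
  qed
  have no_out: "l x = 0" if "x \<in> W" "out_good x" for x
  proof -
    have "\<not> 1 \<le> l x" using R.delete_root_arc[of x] that no_rev sw by blast
    then show ?thesis using l0[of x] by linarith
  qed
  have not_both: "\<not> (out_good x \<and> in_good x)" if x: "x \<in> W" for x
  proof
    assume both: "out_good x \<and> in_good x"
    have "m x y = 0" if "y \<in> W" for y
    proof (cases "in_good y")
      case True then show ?thesis using no_edge x that both by blast
    next
      case False
      then have "out_good y" using out_or_in_good nz that by blast
      then have "m y x = 0" using no_edge x that both by blast
      then show ?thesis using mD(1)[of x y] by simp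
    qed
    then have "bd W m a l {x} = 0" using bd_singleton[OF fin x mult] no_in no_out x both by simp
    then show False using single_bound[OF x] nz[OF x] cdist_nonneg[of "b x"] k_pos by linarith
  qed
  define P where "P = {x \<in> W. out_good x}"
  define N where "N = {x \<in> W. in_good x}"
  have PN: "P \<union> N = W" "P \<inter> N = {}" using out_or_in_good nz not_both unfolding P_def N_def by blast+
  show False
  proof (cases "N = {} \<or> P = {}")
    case True
    then show False
    proof
      assume "N = {}"
      then have "P = W" using PN by simp
      then have "orientable k W m a l b"
        using nz not_both no_out unfolding P_def by (intro all_out_good) blast+
      then show False using not by simp
    next
      assume "P = {}"
      then have "N = W" using PN by simp
      then have "orientable k W m l a (\<lambda>x. - b x)"
        using nz not_both no_in unfolding N_def by (intro R.all_out_good) (auto simp: sw)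
      then show False using no_rev by simp
    qed
  next
    case False
    have "between m P N = 0"
      unfolding between_def using no_edge by (intro sum.neutral ballI) (auto simp: P_def N_def)
    then have "bd W m a l W = bd W m a l P + bd W m a l N"
      using bd_Un[of W P N m a l] fin PN mult by auto
    moreover have "demand k (sum b P) \<le> bd W m a l P" "demand k (sum b N) \<le> bd W m a l N"
      using False PN U_empty by (intro cut; blast)+
    moreover have "sum b W = sum b P + sum b N"
      using sum.union_disjoint[of P N b] PN fin by (metis finite_Un)
    ultimately have k1: "k = 1"
      using root k_pos cdist_add_le[of "sum b P" "sum b N"] by simp
    \<comment> \<open>For \<open>k = 1\<close>, a target at distance \<open>1\<close> is at distance \<open>k\<close>, which suits both directions.\<close>
    obtain x where x: "x \<in> P" using False by blast
    then have xW: "x \<in> W" and ni: "\<not> in_good x" using not_both by (auto simp: P_def)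
    have "bd W m a l {x} - 1 < demand k (b x + 1)" using ni by (simp add: in_good_def)
    note * = cdist_at_tight_vertex[OF par[OF xW] nz[OF xW] single_bound[OF xW] this]
    show False using *(3) k1 nz[OF xW] cdist_nonneg[of "b x"] by linarith
  qed
qed

end

section \<open>The rooted orientation theorem\<close>

context modulus
begin

lemma orientable_small:
  assumes "admissible k W U m a l b" "card W \<le> 1"
  shows "orientable k W m a l b"
proof -
  note adm = assms(1)[unfolded admissible_def]
  have fin: "finite W" and mult: "multiplicity_fun m" using adm by simp_all
  have "W = {} \<or> (\<exists>x. W = {x})"
    using assms(2) fin by (metis card_0_eq card_1_singletonE le_Suc_eq le_zero_eq One_nat_def)
  then show ?thesis
  proof (elim disjE exE)
    assume "W = {}" then show ?thesis by (auto simp: orientable_def intro: exI[of _ "\<lambda>_ _. 0"])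
  next
    fix x assume W: "W = {x}"
    have "2 * k dvd b x - (l x - a x)" using adm W by simp
    then have "2 * k dvd l x - a x - b x" by (metis dvd_minus_iff minus_diff_eq)
    then show ?thesis using W mult
      by (auto simp: orientable_def multiplicity_funD intro!: exI[of _ "\<lambda>_ _. 0"])
  qed
qed

text \<open>
  The rooted form of the theorem of Lovasz, Thomassen, Wu and Zhang.
\<close>

theorem admissible_orientable:
  fixes W U :: "'v set"
  assumes "admissible k W U m a l b"
  shows "orientable k W m a l b"
proof -
  let ?fs = "[\<lambda>(W :: 'v set, U :: 'v set, m, a, l, b :: 'v \<Rightarrow> int). card W,
      \<lambda>(W, U, m, a, l, b). nat (between m W W), \<lambda>(W, U, m, a, l, b). nat (bd W m a l W),
      \<lambda>(W, U, m, a, l, b). 1 - card U]"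
  have "\<forall>(W :: 'v set) U m a l b. p = (W, U, m, a, l, b) \<longrightarrow> admissible k W U m a l b \<longrightarrow> orientable k W m a l b" for p
  proof (induction p rule: wf_induct_rule[OF wf_measures[of ?fs]])
    case (1 p)
    show ?case
    proof (intro allI impI)
      fix W U :: "'v set" and m a l b
      assume p: "p = (W, U, m, a, l, b)" and adm: "admissible k W U m a l b"
      have nn: "0 \<le> between m W W" "0 \<le> bd W m a l W" if "admissible k W U m a l b"
        for U :: "'v set" and m a l b
        using that by (auto simp: admissible_def multiplicity_funD bd_def intro!: between_nonneg sum_nonneg)
      show "orientable k W m a l b"
      proof (cases "card W \<le> 1")
        case True then show ?thesis using orientable_small adm by blast
      next
        case False
        interpret reduction k W U m a l b
        proof
          show "2 \<le> card W" using False by simp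
          show "orientable k W' m' a' l' b'" if "card W' < card W" "admissible k W' U' m' a' l' b'"
            for W' U' :: "'v set" and m' a' l' b'
            using 1[of "(W', U', m', a', l', b')"] that p by simp
          show "orientable k W m' a' l' b'" if "between m' W W < between m W W" "admissible k W U' m' a' l' b'"
            for U' :: "'v set" and m' a' l' b'
            using 1[of "(W, U', m', a', l', b')"] that p nn[OF that(2)] by simp
          show "orientable k W m a' l' b'" if "bd W m a' l' W < bd W m a l W" "admissible k W U' m a' l' b'"
            for U' :: "'v set" and a' l' b'
            using 1[of "(W, U', m, a', l', b')"] that p nn[OF that(2)] by simp
          show "orientable k W m a l b" if "U = {}" "admissible k W {u} m a l b" for u
            using 1[of "(W, {u}, m, a, l, b)"] that p by simp
        qed (rule adm)
        show ?thesis
        proof (cases "\<exists>A. A \<subset> W \<and> 2 \<le> card A \<and> bd W m a l A = demand k (sum b A)")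
          case True then show ?thesis using orientable_of_tight_set by blast
        next
          case no_tight: False
          interpret slack_reduction k W U m a l b
          proof
            fix A assume A: "A \<subset> W" "2 \<le> card A"
            then have "A \<noteq> {}" "A \<noteq> U" using U_card by auto
            then have "demand k (sum b A) < bd W m a l A" using cut[of A] A no_tight by force
            moreover obtain p where "bd W m a l A + sum b A = 2 * p" using par_set[of A] A by blast
            moreover obtain q where "cdist k (sum b A) + sum b A = 2 * q" using cdist_even[of "sum b A"] by blast
            ultimately have "2 * k - 2 < 2 * p - 2 * q" "bd W m a l A = cdist k (sum b A) + 2 * p - 2 * q"
              by linarith+
            moreover from this(1) have "k \<le> p - q" by simp
            ultimately show "2 * k + cdist k (sum b A) \<le> bd W m a l A" by linarith
          qed
          show ?thesis
          proof (cases "U = {}")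
            case True
            interpret unflagged_reduction k W U m a l b using True by unfold_locales
            show ?thesis by (rule unflagged_orientable)
          next
            case False then show ?thesis using flagged_orientable by blast
          qed
        qed
      qed
    qed
  qed
  then show ?thesis using assms by blast
qed

end

section \<open>Packings of connected spanning subgraphs\<close>

definition cut_connected :: "'v set \<Rightarrow> ('v \<Rightarrow> 'v \<Rightarrow> int) \<Rightarrow> bool" where
  "cut_connected W c \<longleftrightarrow> (\<forall>A. A \<noteq> {} \<and> A \<subset> W \<longrightarrow> 1 \<le> between c A (W - A))"

lemma between_submodular:
  assumes "finite W" "A \<subseteq> W" "B \<subseteq> W" "multiplicity_fun c"
  shows "between c (A \<inter> B) (W - A \<inter> B) + between c (A \<union> B) (W - (A \<union> B))
    \<le> between c A (W - A) + between c B (W - B)"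
proof -
  define P Q R S where "P = A \<inter> B" and "Q = A - B" and "R = B - A" and "S = W - (A \<union> B)"
  note defs = P_def Q_def R_def S_def
  have fin: "finite P" "finite Q" "finite R" "finite S"
    using assms finite_subset[OF assms(2,1)] finite_subset[OF assms(3,1)] by (auto simp: defs)
  have sets: "A = P \<union> Q" "W - A = R \<union> S" "B = P \<union> R" "W - B = Q \<union> S"
    "W - A \<inter> B = Q \<union> (R \<union> S)" "A \<union> B = P \<union> (Q \<union> R)"
    using assms(2,3) by (auto simp: defs)
  have disj: "P \<inter> Q = {}" "P \<inter> R = {}" "Q \<inter> R = {}" "R \<inter> S = {}" "Q \<inter> S = {}"
    by (auto simp: defs)
  have "between c A (W - A) = between c (P \<union> Q) (R \<union> S)"
    by (subst sets(2), subst sets(1), rule refl)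
  moreover have "between c B (W - B) = between c (P \<union> R) (Q \<union> S)"
    by (subst sets(4), subst sets(3), rule refl)
  moreover have "between c (A \<inter> B) (W - A \<inter> B) = between c P (Q \<union> (R \<union> S))"
    by (subst sets(5), subst P_def[symmetric], rule refl)
  moreover have "between c (A \<union> B) (W - (A \<union> B)) = between c (P \<union> (Q \<union> R)) S"
    by (subst S_def[symmetric], subst sets(6), rule refl)
  moreover have "between c (P \<union> Q) (R \<union> S) = between c P R + between c P S + between c Q R + between c Q S"
    using fin disj by (simp add: between_Un_left between_Un_right)
  moreover have "between c (P \<union> R) (Q \<union> S) = between c P Q + between c P S + between c R Q + between c R S"
    using fin disj by (simp add: between_Un_left between_Un_right)
  moreover have "between c P (Q \<union> (R \<union> S)) = between c P Q + between c P R + between c P S"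
    using fin disj by (simp add: Int_Un_distrib between_Un_right)
  moreover have "between c (P \<union> (Q \<union> R)) S = between c P S + between c Q S + between c R S"
    using fin disj by (simp add: Int_Un_distrib between_Un_left)
  moreover have "0 \<le> between c Q R" "0 \<le> between c R Q"
    using between_nonneg multiplicity_funD(2)[OF assms(4)] by blast+
  ultimately show ?thesis by linarith
qed

lemma degree_into_le_cut:
  assumes "finite W" "A \<subseteq> W" "v \<in> W - A" "S \<subseteq> A" "multiplicity_fun c"
  shows "(\<Sum>x\<in>S. c v x) \<le> between c A (W - A)"
proof -
  have fin: "finite A" using assms finite_subset by blast
  have "(\<Sum>x\<in>S. c v x) \<le> (\<Sum>x\<in>A. c v x)"
    using fin assms multiplicity_funD(2) by (intro sum_mono2) auto
  also have "\<dots> \<le> (\<Sum>x\<in>A. \<Sum>y\<in>W - A. c x y)"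
  proof (rule sum_mono)
    fix x assume "x \<in> A"
    have "c v x = c x v" by (rule multiplicity_funD(1)[OF assms(5)])
    also have "\<dots> \<le> (\<Sum>y\<in>W - A. c x y)"
      using assms multiplicity_funD(2)[OF assms(5)] by (intro member_le_sum) auto
    finally show "c v x \<le> (\<Sum>y\<in>W - A. c x y)" .
  qed
  finally show ?thesis by (simp add: between_def)
qed

lemma between_commute: "multiplicity_fun c \<Longrightarrow> between c A B = between c B A"
  by (rule between_sym) (rule multiplicity_funD(1))

text \<open>
  If replacing the edge \<open>vx\<close> by \<open>xy\<close> disconnects the graph, then there is a set that contains \<open>x\<close> and \<open>y\<close>
  but not \<open>v\<close> and is left only by the edge \<open>vx\<close>; in particular \<open>y\<close> is no neighbour of \<open>v\<close>.  Suppose this happens for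
  two neighbours \<open>x1\<close> and \<open>x2\<close> of \<open>v\<close>.  The two sets meet in \<open>y\<close>, and their union is left by \<open>vx1\<close> and \<open>vx2\<close>, contrary
  to submodularity.
\<close>

lemma exchange_edge:
  assumes fin: "finite W" and mult: "multiplicity_fun c" and conn: "cut_connected W c" and v: "v \<in> W"
    and x12: "x1 \<in> W" "x2 \<in> W" "x1 \<noteq> x2" "1 \<le> c v x1" "1 \<le> c v x2" and y: "y \<in> W" "y \<noteq> v"
  shows "\<exists>x\<in>W. x \<noteq> y \<and> 1 \<le> c v x \<and> cut_connected W (add_edge v x (-1) (add_edge x y 1 c))"
proof (rule ccontr)
  assume none: "\<not> ?thesis"
  have bad: "\<exists>A. A \<subseteq> W - {v} \<and> x \<in> A \<and> y \<in> A \<and> between c A (W - A) = 1"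
    if x: "x \<in> W" "x \<noteq> y" "1 \<le> c v x" for x
  proof -
    have xv: "x \<noteq> v" using x(3) multiplicity_funD(3)[OF mult, of v] by auto
    have "\<not> cut_connected W (add_edge v x (-1) (add_edge x y 1 c))" using none x by blast
    then obtain A where A: "A \<noteq> {}" "A \<subset> W"
      and small: "\<not> 1 \<le> between (add_edge v x (-1) (add_edge x y 1 c)) A (W - A)"
      unfolding cut_connected_def not_all not_imp by (elim exE conjE)
    have finA: "finite A" using finite_subset[of A W] A fin by simp
    have "between (add_edge v x (-1) (add_edge x y 1 c)) A (W - A)
      = between c A (W - A) + of_bool ((x \<in> A) \<noteq> (y \<in> A)) - of_bool ((v \<in> A) \<noteq> (x \<in> A))"
      using finA fin v x y by (cases "x \<in> A"; cases "y \<in> A"; cases "v \<in> A") (simp_all add: between_add_edge)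
    moreover have "1 \<le> between c A (W - A)" using conn A unfolding cut_connected_def by blast
    ultimately have 1: "between c A (W - A) = 1" "(v \<in> A) \<noteq> (x \<in> A)" "(x \<in> A) = (y \<in> A)"
      using small by (cases "x \<in> A"; cases "y \<in> A"; cases "v \<in> A"; simp)+
    show ?thesis
    proof (cases "v \<in> A")
      case False
      then show ?thesis using 1 A by (intro exI[of _ A]) auto
    next
      case True
      have "W - (W - A) = A" using A by blast
      then have "between c (W - A) (W - (W - A)) = 1" using 1(1) between_commute[OF mult] by metis
      then show ?thesis using 1 A True x y by (intro exI[of _ "W - A"]) auto
    qed
  qed
  show False
  proof (cases "1 \<le> c v y")
    case True
    obtain x where x: "x \<in> W" "x \<noteq> y" "1 \<le> c v x" using x12 by metis
    then obtain A where A: "A \<subseteq> W - {v}" "x \<in> A" "y \<in> A" "between c A (W - A) = 1" using bad by blast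
    then have "(\<Sum>z\<in>{x, y}. c v z) \<le> between c A (W - A)"
      using fin v mult by (intro degree_into_le_cut) auto
    then show False using A True x by simp
  next
    case False
    then have "x1 \<noteq> y" "x2 \<noteq> y" using x12 by auto
    then obtain A B where A: "A \<subseteq> W - {v}" "x1 \<in> A" "y \<in> A" "between c A (W - A) = 1"
      and B: "B \<subseteq> W - {v}" "x2 \<in> B" "y \<in> B" "between c B (W - B) = 1" using bad x12 by metis
    have "(\<Sum>z\<in>{x1, x2}. c v z) \<le> between c (A \<union> B) (W - (A \<union> B))"
      using fin v mult A B by (intro degree_into_le_cut) auto
    moreover have "1 \<le> between c (A \<inter> B) (W - A \<inter> B)"
      using conn A B v unfolding cut_connected_def by (metis Diff_iff IntI empty_iff inf.absorb_iff2 inf.coboundedI1 psubsetI singletonI subset_iff)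
    moreover have "A \<subseteq> W" "B \<subseteq> W" using A B by auto
    ultimately show False using between_submodular[OF fin, of A B c] mult A B x12 by simp
  qed
qed

lemma cut_connected_delete_leaf:
  assumes fin: "finite W" and mult: "multiplicity_fun c" and conn: "cut_connected W c" and v: "v \<in> W"
    and leaf: "\<And>x y. x \<in> W \<Longrightarrow> y \<in> W \<Longrightarrow> 1 \<le> c v x \<Longrightarrow> 1 \<le> c v y \<Longrightarrow> x = y"
  shows "cut_connected (W - {v}) c"
proof -
  have away: "1 \<le> between c A (W - {v} - A)"
    if A: "A \<noteq> {}" "A \<subset> W - {v}" and z: "\<And>x. x \<in> A \<Longrightarrow> c v x = 0" for A
  proof -
    have "W - A = (W - {v} - A) \<union> {v}" using A v by auto
    then have "between c A (W - A) = between c A (W - {v} - A) + between c A {v}"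
      using between_Un_right[of "W - {v} - A" "{v}" c A] fin by simp
    moreover have "between c A {v} = 0"
      using z multiplicity_funD(1)[OF mult] by (simp add: between_def)
    moreover have "1 \<le> between c A (W - A)" using conn A unfolding cut_connected_def by blast
    ultimately show ?thesis by simp
  qed
  show ?thesis unfolding cut_connected_def
  proof (intro allI impI, elim conjE)
    fix A assume A: "A \<noteq> {}" "A \<subset> W - {v}"
    show "1 \<le> between c A (W - {v} - A)"
    proof (cases "\<exists>x\<in>A. 1 \<le> c v x")
      case False
      have "c v x = 0" if "x \<in> A" for x using False that multiplicity_funD(2)[OF mult, of v x] by force
      then show ?thesis using away A by blast
    next
      case True
      let ?B = "W - {v} - A"
      have "c v x = 0" if "x \<in> ?B" for x
      proof -
        have "\<not> 1 \<le> c v x" using leaf True that A by blast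
        then show ?thesis using multiplicity_funD(2)[OF mult, of v x] by linarith
      qed
      moreover have "?B \<noteq> {}" "?B \<subset> W - {v}" "W - {v} - ?B = A" using A by auto
      ultimately have "1 \<le> between c ?B A" using away[of ?B] by simp
      then show ?thesis using between_commute[OF mult, of A ?B] by simp
    qed
  qed
qed

definition packing :: "nat set \<Rightarrow> (nat \<Rightarrow> 'v \<Rightarrow> 'v \<Rightarrow> int) \<Rightarrow> ('v \<Rightarrow> 'v \<Rightarrow> int) \<Rightarrow> bool" where
  "packing J c m \<longleftrightarrow> finite J \<and> (\<forall>j\<in>J. multiplicity_fun (c j)) \<and> (\<forall>x y. (\<Sum>j\<in>J. c j x y) \<le> m x y)"

lemma packing_between:
  assumes "packing J c m" shows "(\<Sum>j\<in>J. between (c j) A B) \<le> between m A B"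
proof -
  have "(\<Sum>j\<in>J. between (c j) A B) = (\<Sum>x\<in>A. \<Sum>j\<in>J. \<Sum>y\<in>B. c j x y)"
    unfolding between_def by (rule sum.swap)
  also have "\<dots> = (\<Sum>x\<in>A. \<Sum>y\<in>B. \<Sum>j\<in>J. c j x y)" by (intro sum.cong refl sum.swap)
  also have "\<dots> \<le> between m A B"
    unfolding between_def using assms by (intro sum_mono) (auto simp: packing_def)
  finally show ?thesis .
qed

context modulus
begin

text \<open>
  With \<open>k - 1\<close> edges at \<open>v\<close>, the outdegree of \<open>v\<close> can be chosen in every residue class modulo \<open>k\<close>.
\<close>

lemma orient_vertex_and_delete:
  assumes fin: "finite W" and v: "v \<in> W" and mult: "multiplicity_fun m"
    and par: "\<And>x. x \<in> W \<Longrightarrow> even (between m {x} W + b x)" and total: "2 * k dvd sum b W"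
    and deg: "k - 1 \<le> between m {v} W"
    and rest: "\<And>b'. (\<And>x. x \<in> W - {v} \<Longrightarrow> even (between m {x} (W - {v}) + b' x)) \<Longrightarrow>
        2 * k dvd sum b' (W - {v}) \<Longrightarrow> orientable k (W - {v}) m (\<lambda>_. 0) (\<lambda>_. 0) b'"
  shows "orientable k W m (\<lambda>_. 0) (\<lambda>_. 0) b"
proof -
  define d where "d = between m {v} W"
  have "even (d + b v)" using par[OF v] by (simp only: d_def)
  then obtain t where t: "d + b v = 2 * t" by (rule evenE)
  \<comment> \<open>Outdegree \<open>s\<close> means balance \<open>2s - d\<close> at \<open>v\<close>, and the target is \<open>b v = 2t - d\<close>.\<close>
  define s where "s = t mod k"
  have s: "0 \<le> s" "s \<le> k - 1" using k_pos by (auto simp: s_def)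
  have split: "sum g W = g v + sum g (W - {v})" for g :: "'a \<Rightarrow> int" using fin v by (simp add: sum.remove)
  have d: "d = (\<Sum>y\<in>W - {v}. m v y)"
    using split[of "m v"] multiplicity_funD(3)[OF mult, of v] by (simp add: d_def between_singleton)
  have "\<exists>h. (\<forall>y. 0 \<le> h y \<and> h y \<le> m v y) \<and> sum h (W - {v}) = s"
    using fin s deg d multiplicity_funD(2)[OF mult] by (intro distribute) (auto simp: d_def)
  then obtain h where h: "\<forall>y. 0 \<le> h y \<and> h y \<le> m v y" "sum h (W - {v}) = s" by blast
  define b' where "b' = (\<lambda>x. b x - m v x + 2 * h x)"
  have dvd: "2 * k dvd 2 * t - 2 * s"
  proof -
    have "k dvd t - s" unfolding s_def by (simp add: minus_mod_eq_mult_div)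
    then show ?thesis by (metis mult_dvd_mono dvd_refl right_diff_distrib)
  qed
  show ?thesis
  proof (rule orientable_delete_vertex[OF fin v mult h(1)])
    have "(\<Sum>y\<in>W - {v}. 2 * h y - m v y) = 2 * s - d"
      using h(2) d by (simp add: sum_subtractf flip: sum_distrib_left)
    then have "(\<Sum>y\<in>W - {v}. 2 * h y - m v y) + 0 - 0 - b v = - (2 * t - 2 * s)" using t by simp
    then show "2 * k dvd (\<Sum>y\<in>W - {v}. 2 * h y - m v y) + 0 - 0 - b v"
      using dvd by (simp only: dvd_minus_iff)
    have "orientable k (W - {v}) m (\<lambda>_. 0) (\<lambda>_. 0) b'"
    proof (rule rest)
      fix x assume x: "x \<in> W - {v}"
      have "between m {x} W = m x v + between m {x} (W - {v})" by (simp add: between_singleton split)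
      moreover have "m x v = m v x" by (rule multiplicity_funD(1)[OF mult])
      ultimately have "between m {x} (W - {v}) + b' x = (between m {x} W + b x) + 2 * (h x - m v x)"
        by (simp add: b'_def)
      then show "even (between m {x} (W - {v}) + b' x)" using par[of x] x by simp
    next
      have "sum b' (W - {v}) = sum b (W - {v}) - d + 2 * s"
        using h(2) d by (simp add: b'_def sum_subtractf sum.distrib flip: sum_distrib_left)
      also have "\<dots> = sum b W - (2 * t - 2 * s)" using split[of b] t by simp
      finally show "2 * k dvd sum b' (W - {v})" using total dvd by simp
    qed
    then show "orientable k (W - {v}) m (\<lambda>y. 0 + h y) (\<lambda>y. 0 + (m v y - h y)) b"
      by (rule orientable_shift) (simp add: b'_def)
  qed
qed

end

lemma cut_connected_degree:
  assumes "finite W" "cut_connected W c" "v \<in> W" "W \<noteq> {v}" "multiplicity_fun c"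
  shows "1 \<le> between c {v} W"
proof -
  have "1 \<le> between c {v} (W - {v})"
    using assms(2-4) unfolding cut_connected_def by blast
  also have "\<dots> = between c {v} W"
    using assms multiplicity_funD(3)[OF assms(5), of v] by (simp add: between_singleton sum.remove)
  finally show ?thesis .
qed

context modulus
begin

text \<open>
  \<open>I\<close> indexes the subgraphs that still need \<open>v\<close>.  If one of them has two neighbours at \<open>v\<close>, then by counting
  some other one has a single edge \<open>vy\<close> at \<open>v\<close> and is connected without \<open>v\<close>.  Lifting \<open>vy\<close> with a
  suitable edge \<open>vx\<close> of the former, by \<open>exchange_edge\<close>, keeps the former connected and removes the latter
  from \<open>I\<close>.  The degree of \<open>v\<close> drops by two and \<open>card I\<close> by one, so the bound on \<open>2 * card I\<close> minus the
  degree is preserved.  In the end no subgraph needs \<open>v\<close>, and the degree of \<open>v\<close> is at least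
  \<open>card I\<close>, hence at least \<open>k - 1\<close>.
\<close>

lemma eliminate_vertex:
  assumes fin: "finite W" and v: "v \<in> W" and two: "W \<noteq> {v}" and card_J: "int (card J) = 2 * k - 2"
    and rest: "\<And>m c b. multiplicity_fun m \<Longrightarrow> packing J c m \<Longrightarrow> (\<And>j. j \<in> J \<Longrightarrow> cut_connected (W - {v}) (c j)) \<Longrightarrow>
        (\<And>x. x \<in> W - {v} \<Longrightarrow> even (between m {x} (W - {v}) + b x)) \<Longrightarrow>
        2 * k dvd sum b (W - {v}) \<Longrightarrow> orientable k (W - {v}) m (\<lambda>_. 0) (\<lambda>_. 0) b"
    and "multiplicity_fun m" "packing J c m" "I \<subseteq> J"
    and "\<And>j. j \<in> I \<Longrightarrow> cut_connected W (c j)" "\<And>j. j \<in> J - I \<Longrightarrow> cut_connected (W - {v}) (c j)"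
    and "k - 1 \<le> 2 * int (card I) - between m {v} W"
    and "\<And>x. x \<in> W \<Longrightarrow> even (between m {x} W + b x)" "2 * k dvd sum b W"
  shows "orientable k W m (\<lambda>_. 0) (\<lambda>_. 0) b"
  using assms(6-)
proof (induction "card I" arbitrary: I m c rule: less_induct)
  case less
  note mult = less.prems(1) and pack = less.prems(2) and IJ = less.prems(3) and conn = less.prems(4)
    and conn' = less.prems(5) and count = less.prems(6) and par = less.prems(7) and total = less.prems(8)
  have finJ: "finite J" and multc: "\<And>j. j \<in> J \<Longrightarrow> multiplicity_fun (c j)"
    and le: "\<And>x y. (\<Sum>j\<in>J. c j x y) \<le> m x y" using pack by (auto simp: packing_def)
  have finI: "finite I" using IJ finJ finite_subset by auto
  have deg1: "1 \<le> between (c j) {v} W" if "j \<in> I" for j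
    using cut_connected_degree[OF fin conn[OF that] v two] multc that IJ by blast
  have deg_le: "(\<Sum>j\<in>I. between (c j) {v} W) \<le> between m {v} W"
  proof -
    have "(\<Sum>j\<in>I. between (c j) {v} W) \<le> (\<Sum>j\<in>J. between (c j) {v} W)"
    proof (rule sum_mono2[OF finJ IJ])
      fix n assume "n \<in> J - I"
      then show "0 \<le> between (c n) {v} W" by (intro between_nonneg multiplicity_funD(2)[OF multc]) simp
    qed
    also have "\<dots> \<le> between m {v} W" by (rule packing_between[OF pack])
    finally show ?thesis .
  qed
  show ?case
  proof (cases "\<exists>i\<in>I. \<exists>p\<in>W. \<exists>q\<in>W. p \<noteq> q \<and> 1 \<le> c i v p \<and> 1 \<le> c i v q")
    case False
    have "int (card I) \<le> (\<Sum>j\<in>I. between (c j) {v} W)"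
      using sum_mono[of I "\<lambda>_. 1" "\<lambda>j. between (c j) {v} W"] deg1 by simp
    then have deg: "k - 1 \<le> between m {v} W" using deg_le count by linarith
    have all: "cut_connected (W - {v}) (c j)" if j: "j \<in> J" for j
    proof (cases "j \<in> I")
      case True
      show ?thesis
        by (rule cut_connected_delete_leaf[OF fin multc[OF j] conn[OF True] v]) (use False True in blast)
    next
      case False then show ?thesis using conn' j by blast
    qed
    show ?thesis
      by (rule orient_vertex_and_delete[OF fin v mult _ total deg]) (use par rest[OF mult pack all] in auto)
  next
    case True
    then obtain i p q where i: "i \<in> I" and pq: "p \<in> W" "q \<in> W" "p \<noteq> q" "1 \<le> c i v p" "1 \<le> c i v q"
      by blast
    \<comment> \<open>For \<open>k = 1\<close> there are no subgraphs at all.\<close>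
    have "k \<noteq> 1" using i IJ finJ card_J by auto
    \<comment> \<open>Otherwise the degree of \<open>v\<close> would be at least \<open>2 * card I\<close>.\<close>
    have "\<exists>j\<in>I. between (c j) {v} W < 2"
    proof (rule ccontr)
      assume "\<not> ?thesis"
      then have "(\<Sum>j\<in>I. 2) \<le> (\<Sum>j\<in>I. between (c j) {v} W)" by (intro sum_mono) force
      then show False using deg_le count k_pos \<open>k \<noteq> 1\<close> by simp
    qed
    then obtain j where j: "j \<in> I" and degj: "between (c j) {v} W = 1" using deg1 by force
    note mj = multc[OF subsetD[OF IJ j]] and mi = multc[OF subsetD[OF IJ i]]
    have two_le: "2 \<le> between c' {v} W"
      if "multiplicity_fun c'" "s \<in> W" "t \<in> W" "s \<noteq> t" "1 \<le> c' v s" "1 \<le> c' v t" for c' s t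
    proof -
      have "(\<Sum>x\<in>{s, t}. c' v x) \<le> (\<Sum>x\<in>W. c' v x)"
        using that fin multiplicity_funD(2)[OF that(1)] by (intro sum_mono2) auto
      then show ?thesis using that by (simp add: between_singleton)
    qed
    have ij: "i \<noteq> j" using two_le[OF mi pq] degj by auto
    obtain y where y: "y \<in> W" "1 \<le> c j v y"
    proof (rule ccontr)
      assume none: "\<not> thesis"
      note ex = that
      have "c j v y = 0" if "y \<in> W" for y
      proof -
        have "\<not> 1 \<le> c j v y" using ex none that by blast
        then show ?thesis using multiplicity_funD(2)[OF mj, of v y] by linarith
      qed
      then show False using degj by (simp add: between_singleton)
    qed
    have yv: "y \<noteq> v" using y multiplicity_funD(3)[OF mj, of v] by auto
    have leaf: "cut_connected (W - {v}) (c j)"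
    proof (rule cut_connected_delete_leaf[OF fin mj conn[OF j] v])
      fix s t assume st: "s \<in> W" "t \<in> W" "1 \<le> c j v s" "1 \<le> c j v t"
      show "s = t"
      proof (rule ccontr)
        assume "s \<noteq> t"
        then show False using two_le[OF mj st(1,2) _ st(3,4)] degj by simp
      qed
    qed
    obtain x where x: "x \<in> W" "x \<noteq> y" "1 \<le> c i v x"
      and conn_i: "cut_connected W (add_edge v x (-1) (add_edge x y 1 (c i)))"
      using exchange_edge[OF fin mi conn[OF i] v pq y(1) yv] by blast
    have xv: "x \<noteq> v" using x multiplicity_funD(3)[OF mi, of v] by auto
    let ?m = "add_edge v y (-1) (add_edge v x (-1) (add_edge y x 1 m))"
    let ?ci = "add_edge v x (-1) (add_edge x y 1 (c i))" and ?cj = "add_edge v y (-1) (c j)"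
    define c' where "c' = c(i := ?ci, j := ?cj)"
    have c'_simps: "c' i = ?ci" "c' j = ?cj" "\<And>n. n \<noteq> i \<Longrightarrow> n \<noteq> j \<Longrightarrow> c' n = c n"
      using ij by (auto simp: c'_def)
    have cm: "c n s t \<le> m s t" if "n \<in> J" for n s t
    proof -
      have "c n s t \<le> (\<Sum>j\<in>J. c j s t)"
        by (rule member_le_sum) (use that finJ multiplicity_funD(2)[OF multc] in auto)
      then show ?thesis using le[of s t] by linarith
    qed
    have m_vy: "1 \<le> m v y" and m_vx: "1 \<le> m v x"
      using cm[of j v y] cm[of i v x] x y i j IJ by auto
    have mult': "multiplicity_fun ?m"
      by (rule multiplicity_lift) (use mult x y yv xv m_vy m_vx in auto)
    have mult_ci: "multiplicity_fun ?ci"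
    proof (rule multiplicity_add_edge)
      have "0 \<le> c i x y + 1" using multiplicity_funD(2)[OF mi, of x y] by simp
      then show "multiplicity_fun (add_edge x y 1 (c i))" using x by (intro multiplicity_add_edge mi) auto
    qed (use x xv yv in \<open>auto simp: add_edge_apply\<close>)
    have mult_cj: "multiplicity_fun ?cj"
      by (rule multiplicity_add_edge) (use mj yv y in auto)
    have "orientable k W ?m (\<lambda>_. 0) (\<lambda>_. 0) b"
    proof (rule less.hyps[of "I - {j}" ?m c'])
      show "card (I - {j}) < card I" by (rule card_Diff1_less[OF finI j])
      show "multiplicity_fun ?m" by (rule mult')
      show "packing J c' ?m"
        unfolding packing_def
      proof (intro conjI ballI allI)
        show "multiplicity_fun (c' n)" if "n \<in> J" for n
          using c'_simps mult_ci mult_cj multc[OF that] by (cases "n = i"; cases "n = j") auto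
        fix s t
        have s3: "(\<Sum>n\<in>J. g n) = g i + g j + (\<Sum>n\<in>J - {i, j}. g n)" for g :: "nat \<Rightarrow> int"
        proof -
          have "J = {i, j} \<union> (J - {i, j})" using i j IJ by auto
          then have "(\<Sum>n\<in>J. g n) = (\<Sum>n\<in>{i, j}. g n) + (\<Sum>n\<in>J - {i, j}. g n)"
            using finJ by (metis Diff_disjoint finite_Diff finite.emptyI finite.insertI sum.union_disjoint)
          then show ?thesis using ij by simp
        qed
        have "(\<Sum>n\<in>J - {i, j}. c' n s t) = (\<Sum>n\<in>J - {i, j}. c n s t)"
          by (intro sum.cong) (auto simp: c'_simps)
        then have "(\<Sum>n\<in>J. c' n s t) = ?ci s t + ?cj s t - c i s t - c j s t + (\<Sum>n\<in>J. c n s t)"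
          unfolding s3[of "\<lambda>n. c' n s t"] s3[of "\<lambda>n. c n s t"] by (simp add: c'_simps)
        also have "\<dots> = ?m s t - m s t + (\<Sum>n\<in>J. c n s t)"
          by (simp add: add_edge_apply)
        finally show "(\<Sum>n\<in>J. c' n s t) \<le> ?m s t" using le[of s t] by linarith
      qed (rule finJ)
      show "I - {j} \<subseteq> J" using IJ by blast
      show "cut_connected W (c' n)" if "n \<in> I - {j}" for n
        using that conn conn_i c'_simps by (cases "n = i") auto
      have "cut_connected (W - {v}) ?cj"
        unfolding cut_connected_def
      proof (intro allI impI, elim conjE)
        fix A assume A: "A \<noteq> {}" "A \<subset> W - {v}"
        then have "finite A" using finite_subset[of A W] fin by blast
        then have "between ?cj A (W - {v} - A) = between (c j) A (W - {v} - A)"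
          using A fin by (auto simp: between_add_edge)
        then show "1 \<le> between ?cj A (W - {v} - A)" using leaf A unfolding cut_connected_def by simp
      qed
      then show "cut_connected (W - {v}) (c' n)" if "n \<in> J - (I - {j})" for n
        using that conn' c'_simps i by (cases "n = j"; cases "n = i") auto
      have "between ?m {v} W = between m {v} W - 2"
        using x y v xv yv fin by (simp add: between_add_edge)
      moreover have "int (card (I - {j})) = int (card I) - 1"
        using j finI card_gt_0_iff[of I] by (auto simp: of_nat_diff)
      ultimately show "k - 1 \<le> 2 * int (card (I - {j})) - between ?m {v} W" using count by simp
      show "even (between ?m {z} W + b z)" if "z \<in> W" for z
        using par[OF that] x y v xv yv fin by (auto simp: between_add_edge)
      show "2 * k dvd sum b W" by (rule total)
    qed
    then show ?thesis
      using fin v y(1) x(1,2) yv xv multiplicity_funD(2)[OF mult]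
      by (intro orientable_lift[of W v y x m k "\<lambda>_. 0" "\<lambda>_. 0" b]) auto
  qed
qed

text \<open>
  Inside a smallest violating set, all proper subsets satisfy the cut condition, and the violation is the
  upper bound at the root into which the rest is contracted.  A single violating vertex is eliminated.
\<close>

theorem packed_orientable:
  assumes "finite W" "multiplicity_fun m" "int (card J) = 2 * k - 2" "packing J c m"
    and "\<And>j. j \<in> J \<Longrightarrow> cut_connected W (c j)"
    and "\<And>x. x \<in> W \<Longrightarrow> even (between m {x} W + b x)" "2 * k dvd sum b W"
  shows "orientable k W m (\<lambda>_. 0) (\<lambda>_. 0) b"
  using assms(1,2,4-)
proof (induction "card W" arbitrary: W m c b rule: less_induct)
  case less
  note fin = less.prems(1) and mult = less.prems(2) and pack = less.prems(3) and conn = less.prems(4)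
    and par = less.prems(5) and total = less.prems(6)
  let ?z = "\<lambda>_ :: 'a. 0 :: int"
  have finJ: "finite J" and multc: "\<And>j. j \<in> J \<Longrightarrow> multiplicity_fun (c j)"
    and le: "\<And>x y. (\<Sum>j\<in>J. c j x y) \<le> m x y" using pack by (auto simp: packing_def)
  have bd1: "bd W m ?z ?z {x} = between m {x} W" if "x \<in> W" for x
    using bd_singleton[OF fin that mult] by (simp add: between_singleton)
  have par': "\<forall>x\<in>W. even (bd W m ?z ?z {x} + b x)" using par bd1 by simp
  define violating where "violating A \<longleftrightarrow> A \<noteq> {} \<and> A \<subset> W \<and> bd W m ?z ?z A < demand k (sum b A)" for A
  show ?case
  proof (cases "\<exists>A. violating A")
    case False
    then have "admissible k W {} m ?z ?z b"
      unfolding admissible_def violating_def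
      using fin mult par' total k_pos cdist_nonneg[of "sum b W"] by (auto simp: bd_whole not_less)
    then show ?thesis by (rule admissible_orientable)
  next
    case True
    then obtain A where viol: "violating A" and least: "\<And>B. violating B \<Longrightarrow> card A \<le> card B"
      using ex_has_least_nat[of violating _ card] by blast
    have A: "A \<noteq> {}" "A \<subset> W" "bd W m ?z ?z A < demand k (sum b A)"
      using viol by (auto simp: violating_def)
    have finA: "finite A" using A fin finite_subset by blast
    show ?thesis
    proof (cases "card A = 1")
      case True
      then obtain v where Av: "A = {v}" by (rule card_1_singletonE)
      then have v: "v \<in> W" "W \<noteq> {v}" using A by auto
      \<comment> \<open>Since \<open>cdist\<close> is at most \<open>k\<close>, a violating vertex has degree at most \<open>3k - 3\<close>.\<close>
      have count: "k - 1 \<le> 2 * int (card J) - between m {v} W"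
        using A(3) bd1[OF v(1)] Av assms(3) cdist_le_k[of "b v"] by simp
      have small: "card (W - {v}) < card W" by (rule card_Diff1_less[OF fin v(1)])
      show ?thesis
      proof (rule eliminate_vertex[OF fin v assms(3) _ mult pack subset_refl _ _ count par total])
        show "orientable k (W - {v}) m' ?z ?z b'"
          if "multiplicity_fun m'" "packing J c' m'" "\<And>j. j \<in> J \<Longrightarrow> cut_connected (W - {v}) (c' j)"
            "\<And>x. x \<in> W - {v} \<Longrightarrow> even (between m' {x} (W - {v}) + b' x)" "2 * k dvd sum b' (W - {v})" for m' c' b'
          using less.hyps[OF small, of m' c' b'] fin that by simp
      qed (use conn in auto)
    next
      case False
      then have A2: "2 \<le> card A" using A finA by (metis One_nat_def Suc_leI card_gt_0_iff le_neq_implies_less numeral_2_eq_2)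
      obtain r where r: "r \<in> A" using A by blast
      interpret contraction W A r using fin A r by unfold_locales auto
      have zero: "contract_fun r A ?z = ?z" by (simp add: contract_fun_def fun_eq_iff)
      have lift1: "unfold_set r A {x} = fibre r A x" for x by (simp add: unfold_set_def)
      show ?thesis
      proof (rule orientable_contract[OF mult])
        show "orientable k W1 (contract_mult r A m) (contract_fun r A ?z) (contract_fun r A ?z) (contract_fun r A b)"
          unfolding zero
        proof (rule less.hyps[of W1 _ "\<lambda>j. contract_mult r A (c j)"])
          have "card W1 = card W - card A + 1" using r A fin finA by (simp add: card_Diff_subset)
          moreover have "card A < card W" using A fin psubset_card_mono by blast
          ultimately show "card W1 < card W" using A2 by linarith
          show "packing J (\<lambda>j. contract_mult r A (c j)) (contract_mult r A m)"
            unfolding packing_def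
          proof (intro conjI ballI allI)
            fix x y
            show "(\<Sum>j\<in>J. contract_mult r A (c j) x y) \<le> contract_mult r A m x y"
              using packing_between[OF pack] by (simp add: contract_mult_def)
          qed (use finJ multc contract_mult_valid in auto)
          show "cut_connected W1 (contract_mult r A (c j))" if "j \<in> J" for j
            unfolding cut_connected_def
          proof (intro allI impI, elim conjE)
            fix B assume B: "B \<noteq> {}" "B \<subset> W1"
            have "1 \<le> between (c j) (unfold_set r A B) (W - unfold_set r A B)"
              using conn[OF that] unfold_set_psubset[OF B(2)] unfold_set_empty_iff[of B] B(1)
              unfolding cut_connected_def by simp
            then show "1 \<le> between (contract_mult r A (c j)) B (W1 - B)"
              using between_contract[of B "W1 - B" "c j"] unfold_set_Diff[of B] B by auto
          qed
          show "even (between (contract_mult r A m) {x} W1 + contract_fun r A b x)" if x: "x \<in> W1" for x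
          proof -
            have "bd W1 (contract_mult r A m) ?z ?z {x} = bd W m ?z ?z (fibre r A x)"
              using bd_contract[of "{x}" m ?z ?z] x by (simp add: zero lift1)
            moreover have "bd W1 (contract_mult r A m) ?z ?z {x} = between (contract_mult r A m) {x} W1"
              using bd_singleton[of W1 x] fin x contract_mult_valid[OF mult] by (simp add: between_singleton)
            moreover have "fibre r A x \<subseteq> W" using x A by (auto simp: fibre_def)
            then have "even (bd W m ?z ?z (fibre r A x) + sum b (fibre r A x))"
              using bd_even[OF fin _ mult par'] by blast
            ultimately show ?thesis by (simp add: contract_fun_def)
          qed
          show "2 * k dvd sum (contract_fun r A b) W1"
            using total sum_contract_fun[of W1 b] by (simp add: unfold_set_whole)
        qed (use fin contract_mult_valid[OF mult] in auto)
      next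
        fix a' l' :: "'a \<Rightarrow> int"
        assume nn: "\<forall>x. 0 \<le> a' x \<and> 0 \<le> l' x"
          and deg: "\<forall>x. a' x + l' x = 0 + 0 + (\<Sum>y\<in>W - A. m x y)"
          and tot: "2 * k dvd sum b A - (\<Sum>x\<in>A. l' x - a' x)"
        have bd': "bd A m a' l' B = bd W m ?z ?z B" if "B \<subseteq> A" for B
          by (rule bd_inner[OF that deg])
        have "admissible k A {} m a' l' b"
          unfolding admissible_def
        proof (intro conjI)
          show "\<forall>x\<in>A. even (bd A m a' l' {x} + b x)" using bd' par' A by auto
          show "bd A m a' l' A \<le> demand k (sum b A)" using bd'[of A] A by simp
          show "\<forall>B. B \<noteq> {} \<and> B \<subset> A \<and> B \<noteq> {} \<longrightarrow> demand k (sum b B) \<le> bd A m a' l' B"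
          proof (intro allI impI, elim conjE)
            fix B assume B: "B \<noteq> {}" "B \<subset> A"
            then have "card B < card A" using finA psubset_card_mono by blast
            then have "\<not> violating B" using least[of B] by auto
            then show "demand k (sum b B) \<le> bd A m a' l' B"
              using B A bd'[of B] by (auto simp: violating_def)
          qed
        qed (use nn tot mult finA in auto)
        then show "orientable k A m a' l' b" by (rule admissible_orientable)
      qed auto
    qed
  qed
qed

end

section \<open>Orientations of multigraphs modulo k\<close>

text \<open>
  Loops are left out: they contribute equally to outdegree and indegree.
\<close>

definition mult_of :: "('v, 'e) mgraph \<Rightarrow> 'v \<Rightarrow> 'v \<Rightarrow> int" where
  "mult_of G x y = (if x = y then 0 else int (card {e \<in> edges G. ends G e = Upair x y}))"

lemma multiplicity_mult_of: "multiplicity_fun (mult_of G)"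
proof -
  have "Upair x y = Upair y x" for x y :: 'a by (simp add: Upair_inject)
  then have "mult_of G x y = mult_of G y x" for x y unfolding mult_of_def by metis
  then show ?thesis by (simp add: multiplicity_fun_def mult_of_def)
qed

definition orients :: "('v, 'e) mgraph \<Rightarrow> ('e \<Rightarrow> 'v) \<Rightarrow> ('e \<Rightarrow> 'v) \<Rightarrow> bool" where
  "orients G t h \<longleftrightarrow> (\<forall>e\<in>edges G. ends G e = Upair (t e) (h e))"

lemma orients_exists: "\<exists>t h. orients G t h"
proof -
  have "\<forall>e. \<exists>p. ends G e = Upair (fst p) (snd p)"
    by (metis fst_conv snd_conv uprod_exhaust)
  then obtain f where "\<forall>e. ends G e = Upair (fst (f e)) (snd (f e))" by metis
  then show ?thesis unfolding orients_def by (intro exI[of _ "\<lambda>e. fst (f e)"] exI[of _ "\<lambda>e. snd (f e)"]) simp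
qed

lemma degree_orients:
  assumes "finite (edges G)" "orients G t h"
  shows "degree G v = card {e \<in> edges G. t e = v} + card {e \<in> edges G. h e = v}"
proof -
  have "{e \<in> edges G. v \<in> set_uprod (ends G e)} = {e \<in> edges G. t e = v} \<union> {e \<in> edges G. h e = v}"
    using assms(2) by (auto simp: orients_def)
  moreover have "{e \<in> edges G. ends G e = Upair v v} = {e \<in> edges G. t e = v} \<inter> {e \<in> edges G. h e = v}"
    using assms(2) by (auto simp: orients_def Upair_inject)
  ultimately show ?thesis unfolding degree_def
    using card_Un_Int[of "{e \<in> edges G. t e = v}" "{e \<in> edges G. h e = v}"] assms(1) by simp
qed

lemma sum_card_fibres:
  assumes "finite V" "finite E" "\<And>e. e \<in> E \<Longrightarrow> f e \<in> V"
  shows "(\<Sum>v\<in>V. card {e \<in> E. f e = v}) = card E"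
proof -
  have "card E = card (\<Union>v\<in>V. {e \<in> E. f e = v})" using assms(3) by (intro arg_cong[where f=card]) auto
  also have "\<dots> = (\<Sum>v\<in>V. card {e \<in> E. f e = v})"
    using assms by (intro card_UN_disjoint) auto
  finally show ?thesis by simp
qed

context multigraph
begin

lemma orients_in_verts:
  assumes "orients G t h" "e \<in> edges G"
  shows "t e \<in> verts G" "h e \<in> verts G"
  using ends_in_verts[OF assms(2)] assms by (auto simp: orients_def)

lemma handshake: "(\<Sum>v\<in>verts G. degree G v) = 2 * card (edges G)"
proof -
  obtain t h where o: "orients G t h" using orients_exists by blast
  show ?thesis
    using sum_card_fibres[OF finite_verts finite_edges, of t] sum_card_fibres[OF finite_verts finite_edges, of h]
      orients_in_verts[OF o] by (simp add: degree_orients[OF finite_edges o] sum.distrib)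
qed

lemma mult_of_degree:
  assumes v: "v \<in> verts G"
  shows "int (degree G v) = between (mult_of G) {v} (verts G) + 2 * int (card {e \<in> edges G. ends G e = Upair v v})"
proof -
  let ?L = "\<lambda>y. {e \<in> edges G. ends G e = Upair v y}"
  have "{e \<in> edges G. v \<in> set_uprod (ends G e)} = (\<Union>y\<in>verts G. ?L y)"
  proof (intro set_eqI iffI)
    fix e assume e: "e \<in> {e \<in> edges G. v \<in> set_uprod (ends G e)}"
    obtain x y where xy: "ends G e = Upair x y" by (rule uprod_exhaust)
    then have "x \<in> verts G" "y \<in> verts G" using ends_in_verts[of e] e by auto
    then show "e \<in> (\<Union>y\<in>verts G. ?L y)" using e xy by (auto simp: Upair_inject)
  qed auto
  moreover have "card (\<Union>y\<in>verts G. ?L y) = (\<Sum>y\<in>verts G. card (?L y))"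
    using finite_verts finite_edges by (intro card_UN_disjoint) (auto simp: Upair_inject)
  moreover have "(\<Sum>y\<in>verts G. card (?L y)) = card (?L v) + (\<Sum>y\<in>verts G - {v}. card (?L y))"
    using finite_verts v by (simp add: sum.remove)
  moreover have "between (mult_of G) {v} (verts G) = (\<Sum>y\<in>verts G - {v}. int (card (?L y)))"
    using finite_verts v by (auto simp: between_singleton sum.remove mult_of_def intro!: sum.cong split: if_splits)
  ultimately show ?thesis by (simp add: degree_def)
qed

lemma cut_degree_mult_of:
  assumes A: "A \<subseteq> verts G"
  shows "between (mult_of G) A (verts G - A) = int (cut_degree G A)"
proof -
  let ?B = "verts G - A"
  let ?E = "\<lambda>p. {e \<in> edges G. ends G e = Upair (fst p) (snd p)}"
  have fin: "finite A" using A finite_verts finite_subset by blast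
  have "{e \<in> edges G. \<exists>u v. ends G e = Upair u v \<and> u \<in> A \<and> v \<notin> A} = (\<Union>p\<in>A \<times> ?B. ?E p)"
    using ends_in_verts by fastforce
  moreover have "card (\<Union>p\<in>A \<times> ?B. ?E p) = (\<Sum>p\<in>A \<times> ?B. card (?E p))"
    using fin finite_verts finite_edges by (intro card_UN_disjoint) (auto simp: Upair_inject)
  moreover have "(\<Sum>p\<in>A \<times> ?B. int (card (?E p))) = between (mult_of G) A ?B"
    unfolding between_def sum.cartesian_product by (intro sum.cong) (auto simp: mult_of_def)
  ultimately show ?thesis by (simp add: cut_degree_def)
qed

end

text \<open>
  One edge at a time receives a direction in which arcs are still required.
\<close>

lemma realize_arc_counts:
  fixes f :: "'e \<Rightarrow> 'v uprod"
  assumes "finite E" "\<And>x y. 0 \<le> w x y"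
    and "\<And>x y. x \<noteq> y \<Longrightarrow> x \<in> W \<Longrightarrow> y \<in> W \<Longrightarrow> w x y + w y x = int (card {e \<in> E. f e = Upair x y})"
    and "\<And>e. e \<in> E \<Longrightarrow> set_uprod (f e) \<subseteq> W"
  shows "\<exists>t h. (\<forall>e\<in>E. f e = Upair (t e) (h e)) \<and>
      (\<forall>x\<in>W. \<forall>y\<in>W. x \<noteq> y \<longrightarrow> int (card {e \<in> E. t e = x \<and> h e = y}) = w x y)"
  using assms
proof (induction E arbitrary: w)
  case empty
  have "w x y = 0" if "x \<noteq> y" "x \<in> W" "y \<in> W" for x y
    using empty(2)[OF that] empty(1)[of x y] empty(1)[of y x] by simp
  then show ?case by simp
next
  case (insert e E)
  obtain x0 y0 where xy0: "f e = Upair x0 y0" by (rule uprod_exhaust)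
  then have xy0W: "x0 \<in> W" "y0 \<in> W" using insert.prems(3)[of e] by auto
  have card_ins: "int (card {d \<in> insert e E. P d}) = int (card {d \<in> E. P d}) + of_bool (P e)" for P
  proof -
    have "{d \<in> insert e E. P d} = (if P e then insert e {d \<in> E. P d} else {d \<in> E. P d})" by auto
    then show ?thesis using insert.hyps by simp
  qed
  have "\<exists>x1 y1. f e = Upair x1 y1 \<and> (x1 = y1 \<or> 1 \<le> w x1 y1)"
  proof (cases "x0 = y0")
    case False
    have "w x0 y0 + w y0 x0 = int (card {d \<in> insert e E. f d = Upair x0 y0})"
      by (rule insert.prems(2)[OF False xy0W])
    then have "1 \<le> w x0 y0 + w y0 x0" unfolding card_ins by (simp add: xy0)
    then have "1 \<le> w x0 y0 \<or> 1 \<le> w y0 x0" by linarith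
    then show ?thesis using xy0 by (metis Upair_inject)
  qed (use xy0 in blast)
  then obtain x1 y1 where xy: "f e = Upair x1 y1" "x1 = y1 \<or> 1 \<le> w x1 y1" by blast
  define w' where "w' x y = w x y - of_bool (x \<noteq> y \<and> x = x1 \<and> y = y1)" for x y
  have "\<exists>t h. (\<forall>e\<in>E. f e = Upair (t e) (h e)) \<and>
    (\<forall>x\<in>W. \<forall>y\<in>W. x \<noteq> y \<longrightarrow> int (card {e \<in> E. t e = x \<and> h e = y}) = w' x y)"
  proof (rule insert.IH)
    show "0 \<le> w' x y" for x y using insert.prems(1)[of x y] xy(2) by (auto simp: w'_def of_bool_def)
    fix x y assume p: "x \<noteq> y" "x \<in> W" "y \<in> W"
    have "of_bool (f e = Upair x y) = of_bool (x \<noteq> y \<and> x = x1 \<and> y = y1) + (of_bool (y \<noteq> x \<and> y = x1 \<and> x = y1) :: int)"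
      using p xy(1) by (auto simp: Upair_inject of_bool_def)
    then show "w' x y + w' y x = int (card {d \<in> E. f d = Upair x y})"
      using insert.prems(2)[OF p] card_ins[of "\<lambda>d. f d = Upair x y"] unfolding w'_def by linarith
  qed (use insert.prems in auto)
  then obtain t h where th: "\<forall>d\<in>E. f d = Upair (t d) (h d)"
    and cnt: "\<And>x y. x \<in> W \<Longrightarrow> y \<in> W \<Longrightarrow> x \<noteq> y \<Longrightarrow> int (card {d \<in> E. t d = x \<and> h d = y}) = w' x y" by blast
  let ?t = "t(e := x1)" and ?h = "h(e := y1)"
  have "{d \<in> E. ?t d = x \<and> ?h d = y} = {d \<in> E. t d = x \<and> h d = y}" for x y
    using insert.hyps by auto
  then have "int (card {d \<in> insert e E. ?t d = x \<and> ?h d = y}) = w x y"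
    if "x \<in> W" "y \<in> W" "x \<noteq> y" for x y
    using cnt[OF that] that unfolding card_ins by (auto simp: w'_def of_bool_def)
  moreover have "\<forall>d\<in>insert e E. f d = Upair (?t d) (?h d)" using th xy insert.hyps by auto
  ultimately show ?case by blast
qed

lemma rtrancl_crosses:
  assumes "(u, v) \<in> r\<^sup>*" "u \<in> A" "v \<notin> A"
  shows "\<exists>x y. (x, y) \<in> r \<and> x \<in> A \<and> y \<notin> A"
  using assms by (induction rule: rtrancl_induct) auto

context multigraph
begin

lemma tree_packing_mult_of:
  assumes T: "\<And>i. i \<in> J \<Longrightarrow> is_factor (T i) G" and disj: "disjoint_family_on (\<lambda>i. edges (T i)) J" and "finite J"
  shows "packing J (\<lambda>i. mult_of (T i)) (mult_of G)"
  unfolding packing_def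
proof (intro conjI ballI allI)
  fix x y
  show "(\<Sum>i\<in>J. mult_of (T i) x y) \<le> mult_of G x y"
  proof (cases "x = y")
    case False
    let ?E = "\<lambda>i. {e \<in> edges (T i). ends (T i) e = Upair x y}"
    have sub: "?E i \<subseteq> {e \<in> edges G. ends G e = Upair x y}" if "i \<in> J" for i
      using T[OF that] by (auto simp: is_factor_def)
    have finE: "finite {e \<in> edges G. ends G e = Upair x y}" using finite_edges by simp
    have "(\<Sum>i\<in>J. card (?E i)) = card (\<Union>i\<in>J. ?E i)"
    proof (rule card_UN_disjoint[symmetric, OF \<open>finite J\<close>])
      show "\<forall>i\<in>J. finite (?E i)" using sub finite_subset[OF _ finE] by simp
      show "\<forall>i\<in>J. \<forall>j\<in>J. i \<noteq> j \<longrightarrow> ?E i \<inter> ?E j = {}"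
      proof (intro ballI impI)
        fix i j assume "i \<in> J" "j \<in> J" "i \<noteq> j"
        then have "edges (T i) \<inter> edges (T j) = {}" by (rule disjoint_family_onD[OF disj])
        then show "?E i \<inter> ?E j = {}" by auto
      qed
    qed
    also have "\<dots> \<le> card {e \<in> edges G. ends G e = Upair x y}"
      using sub finE by (intro card_mono) auto
    finally show ?thesis using False by (simp add: mult_of_def flip: of_nat_sum)
  qed (simp add: mult_of_def)
qed (simp_all add: multiplicity_mult_of \<open>finite J\<close>)

lemma connected_factor_cut_connected:
  assumes "is_factor T G" "connected_graph T"
  shows "cut_connected (verts G) (mult_of T)"
  unfolding cut_connected_def
proof (intro allI impI, elim conjE)
  fix A assume A: "A \<noteq> {}" "A \<subset> verts G"
  then obtain u v where "u \<in> A" "v \<in> verts G" "v \<notin> A" by blast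
  moreover have "verts T = verts G" using assms(1) by (simp add: is_factor_def)
  ultimately have "(u, v) \<in> (adjacency T)\<^sup>*" using assms(2) A by (auto simp: connected_graph_def)
  then obtain x y where xy: "(x, y) \<in> adjacency T" "x \<in> A" "y \<notin> A"
    using rtrancl_crosses \<open>u \<in> A\<close> \<open>v \<notin> A\<close> by metis
  then obtain e where e: "e \<in> edges T" "ends T e = Upair x y" by (auto simp: adjacency_def)
  then have eG: "e \<in> edges G" "ends G e = Upair x y" using assms(1) by (auto simp: is_factor_def)
  then have y: "y \<in> verts G - A" using ends_in_verts[of e] xy by auto
  have "finite (edges T)" using assms(1) finite_edges finite_subset by (auto simp: is_factor_def)
  then have "1 \<le> card {e \<in> edges T. ends T e = Upair x y}" using e by (auto simp: Suc_le_eq card_gt_0_iff)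
  then have "1 \<le> mult_of T x y" using xy by (auto simp: mult_of_def)
  also have "\<dots> \<le> (\<Sum>y\<in>verts G - A. mult_of T x y)"
    using y finite_verts multiplicity_funD(2)[OF multiplicity_mult_of] by (intro member_le_sum) auto
  also have "\<dots> \<le> (\<Sum>x\<in>A. \<Sum>y\<in>verts G - A. mult_of T x y)"
    by (rule member_le_sum)
      (use xy A finite_verts finite_subset multiplicity_funD(2)[OF multiplicity_mult_of[of T]] in \<open>auto intro!: sum_nonneg\<close>)
  finally show "1 \<le> between (mult_of T) A (verts G - A)" by (simp add: between_def)
qed

text \<open>
  Outdegree minus indegree is twice the outdegree minus the degree, so outdegree \<open>p v\<close> modulo \<open>k\<close> amounts to
  the target \<open>2 * p v - degree G v\<close> modulo \<open>2k\<close>.  The root has no arcs.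
\<close>

theorem modular_orientation:
  fixes k :: nat
  assumes k: "k > 0" and conn: "edge_connected (3 * k - 3) G \<or> tree_connected (2 * k - 2) G"
    and total: "int k dvd sum p (verts G) - int (card (edges G))"
  shows "\<exists>t h. orients G t h \<and> (\<forall>v\<in>verts G. int k dvd int (card {e \<in> edges G. t e = v}) - p v)"
proof -
  interpret modulus "int k" using k by unfold_locales simp
  let ?V = "verts G" and ?m = "mult_of G" and ?z = "\<lambda>_. 0 :: int"
  define b where "b v = 2 * p v - int (degree G v)" for v
  define L where "L v = card {e \<in> edges G. ends G e = Upair v v}" for v
  have deg: "int (degree G v) = between ?m {v} ?V + 2 * int (L v)" if "v \<in> ?V" for v
    using mult_of_degree[OF that] by (simp add: L_def)
  have par: "even (between ?m {v} ?V + b v)" if "v \<in> ?V" for v using deg[OF that] by (simp add: b_def)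
  have sum_b: "sum b ?V = 2 * (sum p ?V - int (card (edges G)))"
    using handshake by (simp add: b_def sum_subtractf flip: sum_distrib_left of_nat_sum)
  have tot: "2 * int k dvd sum b ?V" unfolding sum_b using total by (intro mult_dvd_mono) auto
  have "orientable (int k) ?V ?m ?z ?z b"
    using conn
  proof
    assume ec: "edge_connected (3 * k - 3) G"
    have par': "\<forall>x\<in>?V. even (bd ?V ?m ?z ?z {x} + b x)"
      using par bd_singleton[OF finite_verts _ multiplicity_mult_of, of _ G ?z ?z] by (simp add: between_singleton)
    have "admissible (int k) ?V {} ?m ?z ?z b"
      unfolding admissible_def
    proof (intro conjI)
      show "bd ?V ?m ?z ?z ?V \<le> demand (int k) (sum b ?V)"
        using k cdist_nonneg[of "sum b ?V"] by (simp add: bd_whole)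
      show "\<forall>A. A \<noteq> {} \<and> A \<subset> ?V \<and> A \<noteq> {} \<longrightarrow> demand (int k) (sum b A) \<le> bd ?V ?m ?z ?z A"
      proof (intro allI impI, elim conjE)
        fix A assume A: "A \<noteq> {}" "A \<subset> ?V"
        have cut: "bd ?V ?m ?z ?z A = int (cut_degree G A)" using cut_degree_mult_of[of A] A by (auto simp: bd_def)
        have "3 * k - 3 \<le> cut_degree G A" using ec A by (simp add: edge_connected_def)
        then have "3 * int k - 3 \<le> int (cut_degree G A)" by linarith
        \<comment> \<open>If the distance is \<open>k\<close>, then the number of edges is not \<open>3k - 3\<close>, by parity.\<close>
        moreover have "even (bd ?V ?m ?z ?z A + sum b A)"
          using bd_even[OF finite_verts _ multiplicity_mult_of par'] A by auto
        then have "even (int (cut_degree G A) + cdist (int k) (sum b A))"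
          using cdist_even[of "sum b A"] cut by presburger
        moreover have "cdist (int k) (sum b A) \<le> int k" by (rule cdist_le_k)
        ultimately show "demand (int k) (sum b A) \<le> bd ?V ?m ?z ?z A"
          unfolding cut by presburger
      qed
    qed (use finite_verts multiplicity_mult_of par' tot in auto)
    then show ?thesis by (rule admissible_orientable)
  next
    assume "tree_connected (2 * k - 2) G"
    then obtain T where T: "\<forall>i\<in>{1..2 * k - 2}. is_factor (T i) G \<and> is_tree (T i)"
      and disj: "disjoint_family_on (\<lambda>i. edges (T i)) {1..2 * k - 2}"
      unfolding tree_connected_def by blast
    show ?thesis
    proof (rule packed_orientable[OF finite_verts multiplicity_mult_of _ _ _ par tot])
      show "int (card {1..2 * k - 2}) = 2 * int k - 2" using k by simp
      show "packing {1..2 * k - 2} (\<lambda>i. mult_of (T i)) ?m" using T disj by (intro tree_packing_mult_of) auto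
      show "cut_connected ?V (mult_of (T j))" if "j \<in> {1..2 * k - 2}" for j
        using bspec[OF T that] by (intro connected_factor_cut_connected) (auto simp: is_tree_def)
    qed
  qed
  then obtain w where w: "\<forall>x y. 0 \<le> w x y" and wm: "\<forall>x\<in>?V. \<forall>y\<in>?V. w x y + w y x = ?m x y"
    and wb: "\<forall>x\<in>?V. 2 * int k dvd balance w ?V x + 0 - 0 - b x"
    unfolding orientable_def by blast
  have "\<exists>t h. (\<forall>e\<in>edges G. ends G e = Upair (t e) (h e)) \<and>
      (\<forall>x\<in>?V. \<forall>y\<in>?V. x \<noteq> y \<longrightarrow> int (card {e \<in> edges G. t e = x \<and> h e = y}) = w x y)"
    by (rule realize_arc_counts) (use finite_edges w wm ends_in_verts in \<open>auto simp: mult_of_def\<close>)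
  then obtain t h where o: "orients G t h"
    and cnt: "\<And>x y. x \<in> ?V \<Longrightarrow> y \<in> ?V \<Longrightarrow> x \<noteq> y \<Longrightarrow> int (card {e \<in> edges G. t e = x \<and> h e = y}) = w x y"
    unfolding orients_def by blast
  have "int k dvd int (card {e \<in> edges G. t e = v}) - p v" if v: "v \<in> ?V" for v
  proof -
    have "w v v = 0" using bspec[OF bspec[OF wm v] v] by (simp add: mult_of_def)
    have loops: "{e \<in> edges G. t e = v \<and> h e = v} = {e \<in> edges G. ends G e = Upair v v}"
      using o by (auto simp: orients_def Upair_inject)
    have split: "(\<Sum>y\<in>?V. g y) = g v + (\<Sum>y\<in>?V - {v}. g y)" for g :: "'v \<Rightarrow> int"
      using finite_verts v by (simp add: sum.remove)
    have "int (card {e \<in> edges G. t e = v}) = (\<Sum>y\<in>?V. int (card {e \<in> edges G. t e = v \<and> h e = y}))"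
      using sum_card_fibres[of ?V "{e \<in> edges G. t e = v}" h] finite_verts finite_edges orients_in_verts[OF o]
      by (simp add: conj_assoc flip: of_nat_sum)
    then have out: "int (card {e \<in> edges G. t e = v}) = int (L v) + (\<Sum>y\<in>?V. w v y)"
      unfolding split using cnt v \<open>w v v = 0\<close> by (auto simp: loops L_def intro!: sum.cong)
    have "(\<Sum>y\<in>?V. w v y) + (\<Sum>y\<in>?V. w y v) = between ?m {v} ?V"
      using wm v by (simp add: between_singleton flip: sum.distrib)
    then have "balance w ?V v + 0 - 0 - b v
        = 2 * (int (card {e \<in> edges G. t e = v}) - p v)"
      using out deg[OF v] by (simp add: b_def)
    then have "2 * int k dvd 2 * (int (card {e \<in> edges G. t e = v}) - p v)" using bspec[OF wb v] by (simp only:)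
    then show ?thesis by (subst (asm) dvd_times_left_cancel_iff) simp_all
  qed
  then show ?thesis using o by blast
qed

end

section \<open>Equitable colourings of arcs\<close>

definition ends_diff :: "('e \<Rightarrow> 'v) \<Rightarrow> ('e \<Rightarrow> 'v) \<Rightarrow> 'e \<Rightarrow> 'v \<Rightarrow> int" where
  "ends_diff t h e v = of_bool (t e = v) - of_bool (h e = v)"

text \<open>
  A sign says whether an edge keeps its direction.  At a vertex \<open>v\<close> where the given directions are not
  balanced, two edges \<open>xv\<close> and \<open>vy\<close> are replaced by one edge \<open>xy\<close>; in the end the direction of
  that edge is passed on to the path from \<open>x\<close> over \<open>v\<close> to \<open>y\<close>.
\<close>

lemma balanced_signs:
  fixes t h :: "'e \<Rightarrow> 'v"
  assumes "finite E"
  shows "\<exists>s. (\<forall>e. s e = 1 \<or> s e = -1) \<and> (\<forall>v. \<bar>\<Sum>e\<in>E. s e * ends_diff t h e v\<bar> \<le> (1 :: int))"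
  using assms
proof (induction "card E" arbitrary: E t h rule: less_induct)
  case less
  note fin = less.prems
  show ?case
  proof (cases "\<exists>v. 2 \<le> \<bar>\<Sum>e\<in>E. ends_diff t h e v\<bar>")
    case False
    have "\<bar>\<Sum>e\<in>E. 1 * ends_diff t h e v\<bar> \<le> 1" for v
    proof -
      have "\<not> 2 \<le> \<bar>\<Sum>e\<in>E. ends_diff t h e v\<bar>" using False by blast
      then show ?thesis unfolding mult_1 by linarith
    qed
    then show ?thesis by (intro exI[of _ "\<lambda>_. 1"]) simp
  next
    case True
    then obtain v where v: "2 \<le> \<bar>\<Sum>e\<in>E. ends_diff t h e v\<bar>" by blast
    have "\<exists>e1\<in>E. ends_diff t h e1 v \<noteq> 0"
    proof (rule ccontr)
      assume "\<not> ?thesis"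
      then have "(\<Sum>e\<in>E. ends_diff t h e v) = 0" by (intro sum.neutral) auto
      then show False using v by simp
    qed
    then obtain e1 where e1: "e1 \<in> E" "ends_diff t h e1 v \<noteq> 0" by blast
    have "\<exists>e2\<in>E - {e1}. ends_diff t h e2 v \<noteq> 0"
    proof (rule ccontr)
      assume "\<not> ?thesis"
      then have "(\<Sum>e\<in>E - {e1}. ends_diff t h e v) = 0" by (intro sum.neutral) auto
      then have "(\<Sum>e\<in>E. ends_diff t h e v) = ends_diff t h e1 v" using fin e1 by (simp add: sum.remove)
      moreover have "\<bar>ends_diff t h e1 v\<bar> \<le> 1" by (simp add: ends_diff_def)
      ultimately show False using v by linarith
    qed
    then obtain e2 where e2: "e2 \<in> E" "e2 \<noteq> e1" "ends_diff t h e2 v \<noteq> 0" by blast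
    have other_end: "\<exists>x r. (r = 1 \<or> r = -1) \<and>
        (\<forall>z. ends_diff t h e z = r * (of_bool (x = z) - of_bool (v = z)))" if "ends_diff t h e v \<noteq> 0" for e
    proof (cases "t e = v")
      case True
      then have "ends_diff t h e z = -1 * (of_bool (h e = z) - of_bool (v = z))" for z by (simp add: ends_diff_def)
      then show ?thesis by blast
    next
      case False
      then have "h e = v" using that by (auto simp: ends_diff_def split: if_splits)
      then have "ends_diff t h e z = 1 * (of_bool (t e = z) - of_bool (v = z))" for z by (simp add: ends_diff_def)
      then show ?thesis by blast
    qed
    obtain x r where r: "r = 1 \<or> r = -1"
      and d1: "\<And>z. ends_diff t h e1 z = r * (of_bool (x = z) - of_bool (v = z))"
      using other_end[OF e1(2)] by blast
    obtain y q where q: "q = 1 \<or> q = -1"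
      and d2: "\<And>z. ends_diff t h e2 z = q * (of_bool (y = z) - of_bool (v = z))"
      using other_end[OF e2(3)] by blast
    let ?t = "t(e1 := x)" and ?h = "h(e1 := y)"
    have "card (E - {e2}) < card E" using card_Diff1_less[OF fin e2(1)] .
    then obtain s where s: "\<forall>e. s e = 1 \<or> s e = -1"
      and bal: "\<And>v. \<bar>\<Sum>e\<in>E - {e2}. s e * ends_diff ?t ?h e v\<bar> \<le> (1 :: int)"
      using less.hyps[of "E - {e2}" ?t ?h] fin by blast
    \<comment> \<open>The factors \<open>r\<close> and \<open>q\<close> translate between the directions stored for \<open>e1\<close> and \<open>e2\<close> and the path \<open>x, v, y\<close>.\<close>
    define s' where "s' = s(e1 := r * s e1, e2 := - q * s e1)"
    have "(\<Sum>e\<in>E. s' e * ends_diff t h e z) = (\<Sum>e\<in>E - {e2}. s e * ends_diff ?t ?h e z)" for z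
    proof -
      have split: "sum g E = g e2 + (g e1 + sum g (E - {e2} - {e1}))" "sum g (E - {e2}) = g e1 + sum g (E - {e2} - {e1})"
        for g :: "'e \<Rightarrow> int"
        using fin e1(1) e2(2) sum.remove[OF fin e2(1), of g] sum.remove[of "E - {e2}" e1 g] by auto
      have "(\<Sum>e\<in>E - {e2} - {e1}. s' e * ends_diff t h e z) = (\<Sum>e\<in>E - {e2} - {e1}. s e * ends_diff ?t ?h e z)"
        by (intro sum.cong) (auto simp: s'_def ends_diff_def)
      moreover have "s' e1 * ends_diff t h e1 z = s e1 * of_bool (x = z) - s e1 * of_bool (v = z)"
        unfolding d1 using r e2(2) by (auto simp: s'_def)
      moreover have "s' e2 * ends_diff t h e2 z = s e1 * of_bool (v = z) - s e1 * of_bool (y = z)"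
        unfolding d2 using q by (auto simp: s'_def)
      moreover have "s e1 * ends_diff ?t ?h e1 z = s e1 * of_bool (x = z) - s e1 * of_bool (y = z)"
        by (simp add: ends_diff_def)
      ultimately show ?thesis unfolding split by linarith
    qed
    then have "\<bar>\<Sum>e\<in>E. s' e * ends_diff t h e z\<bar> \<le> 1" for z using bal[of z] by simp
    moreover have "\<forall>e. s' e = 1 \<or> s' e = -1" using s r q by (auto simp: s'_def)
    ultimately show ?thesis by blast
  qed
qed

definition colour_count :: "('e \<Rightarrow> 'a) \<Rightarrow> 'e set \<Rightarrow> ('e \<Rightarrow> nat) \<Rightarrow> nat \<Rightarrow> 'a \<Rightarrow> int" where
  "colour_count f E c i v = int (card {e \<in> E. c e = i \<and> f e = v})"

text \<open>
  Regard the arcs as edges of a bipartite graph in which tails and heads are kept apart.  A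
  balanced orientation splits the edges into those directed towards the heads and the others.
\<close>

lemma balanced_halving:
  fixes t :: "'e \<Rightarrow> 'a" and h :: "'e \<Rightarrow> 'b"
  assumes "finite E" "i \<noteq> j"
  shows "\<exists>d. (\<forall>e. d e = i \<or> d e = j) \<and> (\<forall>v. \<bar>colour_count t E d i v - colour_count t E d j v\<bar> \<le> 1) \<and>
    (\<forall>v. \<bar>colour_count h E d i v - colour_count h E d j v\<bar> \<le> 1)"
proof -
  let ?t = "\<lambda>e. Inl (t e) :: 'a + 'b" and ?h = "\<lambda>e. Inr (h e) :: 'a + 'b"
  obtain s where s: "\<forall>e. s e = 1 \<or> s e = -1"
    and bal: "\<And>v. \<bar>\<Sum>e\<in>E. s e * ends_diff ?t ?h e v\<bar> \<le> (1 :: int)"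
    using balanced_signs[OF assms(1), of ?t ?h] by blast
  define d where "d e = (if s e = 1 then i else j)" for e
  have count: "colour_count f E d i v - colour_count f E d j v = (\<Sum>e\<in>E. s e * of_bool (f e = v))"
    for f :: "'e \<Rightarrow> 'c" and v
  proof -
    have "colour_count f E d n v = (\<Sum>e\<in>E. of_bool (d e = n \<and> f e = v))" for n
      using assms(1) by (simp add: colour_count_def of_bool_def sum.If_cases Int_def)
    then have "colour_count f E d i v - colour_count f E d j v
        = (\<Sum>e\<in>E. of_bool (d e = i \<and> f e = v) - of_bool (d e = j \<and> f e = v))"
      by (simp add: sum_subtractf)
    also have "\<dots> = (\<Sum>e\<in>E. s e * of_bool (f e = v))"
      using s assms(2) by (intro sum.cong) (auto simp: d_def of_bool_def)
    finally show ?thesis .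
  qed
  have "\<bar>colour_count t E d i v - colour_count t E d j v\<bar> \<le> 1" for v
    using bal[of "Inl v"] by (simp add: count ends_diff_def)
  moreover have "\<bar>colour_count h E d i v - colour_count h E d j v\<bar> \<le> 1" for v
    using bal[of "Inr v"] by (simp add: count ends_diff_def sum_negf)
  moreover have "\<forall>e. d e = i \<or> d e = j" by (simp add: d_def)
  ultimately show ?thesis by blast
qed

text \<open>
  Twice the sum of squares is the square of the sum plus the square of the difference, and the two
  differences have the same parity.
\<close>

lemma sum_squares_balanced:
  fixes x y x' y' :: int
  assumes "x' + y' = x + y" "\<bar>x' - y'\<bar> \<le> 1"
  shows "x'\<^sup>2 + y'\<^sup>2 \<le> x\<^sup>2 + y\<^sup>2" and "2 \<le> \<bar>x - y\<bar> \<Longrightarrow> x'\<^sup>2 + y'\<^sup>2 < x\<^sup>2 + y\<^sup>2"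
proof -
  have id: "2 * (u\<^sup>2 + v\<^sup>2) = (u + v)\<^sup>2 + (u - v)\<^sup>2" for u v :: int
    by (simp add: power2_eq_square algebra_simps)
  have "x' - y' \<noteq> 0 \<Longrightarrow> x - y \<noteq> 0" using assms by presburger
  then have "\<bar>x' - y'\<bar> \<le> \<bar>x - y\<bar>" using assms(2) by linarith
  then have "(x' - y')\<^sup>2 \<le> (x - y)\<^sup>2" by (simp only: abs_le_square_iff)
  then show "x'\<^sup>2 + y'\<^sup>2 \<le> x\<^sup>2 + y\<^sup>2" using id[of x' y'] id[of x y] assms(1) by simp
  assume "2 \<le> \<bar>x - y\<bar>"
  then have "\<not> \<bar>x - y\<bar> \<le> \<bar>x' - y'\<bar>" using assms(2) by linarith
  then have "(x' - y')\<^sup>2 < (x - y)\<^sup>2" by (simp only: abs_le_square_iff not_le)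
  then show "x'\<^sup>2 + y'\<^sup>2 < x\<^sup>2 + y\<^sup>2" using id[of x' y'] id[of x y] assms(1) by simp
qed

definition colour_squares :: "nat set \<Rightarrow> ('e \<Rightarrow> 'a) \<Rightarrow> 'e set \<Rightarrow> ('e \<Rightarrow> nat) \<Rightarrow> 'a \<Rightarrow> int" where
  "colour_squares K f E c v = (\<Sum>n\<in>K. (colour_count f E c n v)\<^sup>2)"

text \<open>
  Minimise the sum of the squares of all colour counts.  If two colours differ by two at some vertex,
  redistributing their edges by \<open>balanced_halving\<close> makes the sum smaller.
\<close>

lemma equitable_colouring:
  fixes t :: "'e \<Rightarrow> 'a" and h :: "'e \<Rightarrow> 'b"
  assumes fin: "finite E" and K: "finite K" "K \<noteq> {}"
  shows "\<exists>c. (\<forall>e. c e \<in> K) \<and> (\<forall>i\<in>K. \<forall>j\<in>K. \<forall>v. colour_count t E c i v \<le> colour_count t E c j v + 1) \<and>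
    (\<forall>i\<in>K. \<forall>j\<in>K. \<forall>v. colour_count h E c i v \<le> colour_count h E c j v + 1)"
proof -
  define pot where "pot c = (\<Sum>v\<in>t ` E. colour_squares K t E c v) + (\<Sum>v\<in>h ` E. colour_squares K h E c v)" for c
  have pot0: "0 \<le> pot c" for c unfolding pot_def colour_squares_def by (intro add_nonneg_nonneg sum_nonneg) auto
  obtain i0 where "i0 \<in> K" using K by blast
  then have "\<exists>c. \<forall>e. c e \<in> K" by (intro exI[of _ "\<lambda>_. i0"]) simp
  then obtain c where c: "\<forall>e. c e \<in> K" and least: "\<And>c'. \<forall>e. c' e \<in> K \<Longrightarrow> nat (pot c) \<le> nat (pot c')"
    using ex_has_least_nat[of "\<lambda>c. \<forall>e. c e \<in> K" _ "\<lambda>c. nat (pot c)"] by blast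
  have no_improvement: "\<bar>colour_count t E c i v - colour_count t E c j v\<bar> < 2 \<and> \<bar>colour_count h E c i u - colour_count h E c j u\<bar> < 2"
    if ij: "i \<in> K" "j \<in> K" "i \<noteq> j" for i j u v
  proof (rule ccontr)
    assume bad: "\<not> ?thesis"
    define F where "F = {e \<in> E. c e = i \<or> c e = j}"
    obtain d where d: "\<forall>e. d e = i \<or> d e = j"
      and dt: "\<And>v. \<bar>colour_count t F d i v - colour_count t F d j v\<bar> \<le> 1"
      and dh: "\<And>v. \<bar>colour_count h F d i v - colour_count h F d j v\<bar> \<le> 1"
      using balanced_halving[of F i j t h] fin ij by (auto simp: F_def)
    define c' where "c' e = (if e \<in> F then d e else c e)" for e
    have c'K: "\<forall>e. c' e \<in> K" using c d ij by (auto simp: c'_def)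
    have same: "colour_count f E c' n v = colour_count f E c n v" if "n \<noteq> i" "n \<noteq> j" for f :: "'e \<Rightarrow> 'c" and n v
    proof -
      have "{e \<in> E. c' e = n \<and> f e = v} = {e \<in> E. c e = n \<and> f e = v}"
        using d that by (auto simp: c'_def F_def)
      then show ?thesis by (simp add: colour_count_def)
    qed
    have new: "colour_count f E c' n v = colour_count f F d n v" if "n = i \<or> n = j" for f :: "'e \<Rightarrow> 'c" and n v
    proof -
      have "{e \<in> E. c' e = n \<and> f e = v} = {e \<in> F. d e = n \<and> f e = v}"
        using that by (auto simp: c'_def F_def)
      then show ?thesis by (simp add: colour_count_def)
    qed
    have total: "colour_count f E b i v + colour_count f E b j v = int (card {e \<in> F. f e = v})"
      if "\<And>e. e \<in> E \<Longrightarrow> (b e = i \<or> b e = j) = (e \<in> F)" for f :: "'e \<Rightarrow> 'c" and v b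
    proof -
      have "{e \<in> F. f e = v} = {e \<in> E. b e = i \<and> f e = v} \<union> {e \<in> E. b e = j \<and> f e = v}"
        using that by (auto simp: F_def)
      moreover have "{e \<in> E. b e = i \<and> f e = v} \<inter> {e \<in> E. b e = j \<and> f e = v} = {}" using ij by auto
      ultimately show ?thesis using fin by (simp add: colour_count_def card_Un_disjoint)
    qed
    have conserve: "colour_count f E c' i v + colour_count f E c' j v = colour_count f E c i v + colour_count f E c j v"
      for f :: "'e \<Rightarrow> 'c" and v
      using total[of c f v] total[of c' f v] d by (auto simp: c'_def F_def)
    have inner: "(\<Sum>n\<in>K. g n) = g i + g j + (\<Sum>n\<in>K - {i, j}. g n)" for g :: "nat \<Rightarrow> int"
    proof -
      have "K - {i} - {j} = K - {i, j}" by auto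
      then show ?thesis using K(1) ij by (simp add: sum.remove[of K i] sum.remove[of "K - {i}" j])
    qed
    have inner_le: "colour_squares K f E c' v \<le> colour_squares K f E c v"
      and inner_less: "2 \<le> \<bar>colour_count f E c i v - colour_count f E c j v\<bar> \<Longrightarrow>
         colour_squares K f E c' v < colour_squares K f E c v"
      if b: "\<And>v. \<bar>colour_count f F d i v - colour_count f F d j v\<bar> \<le> 1" for f :: "'e \<Rightarrow> 'c" and v
    proof -
      have "(\<Sum>n\<in>K - {i, j}. (colour_count f E c' n v)\<^sup>2) = (\<Sum>n\<in>K - {i, j}. (colour_count f E c n v)\<^sup>2)"
        using same[of _ f] by (intro sum.cong) auto
      moreover have "\<bar>colour_count f E c' i v - colour_count f E c' j v\<bar> \<le> 1" using b[of v] new[of i f v] new[of j f v] by simp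
      note sq = sum_squares_balanced[OF conserve this]
      ultimately show "colour_squares K f E c' v \<le> colour_squares K f E c v"
        "2 \<le> \<bar>colour_count f E c i v - colour_count f E c j v\<bar> \<Longrightarrow>
         colour_squares K f E c' v < colour_squares K f E c v"
        using sq unfolding colour_squares_def inner by auto
    qed
    have absent: "v \<in> f ` E" if "2 \<le> \<bar>colour_count f E c i v - colour_count f E c j v\<bar>" for f :: "'e \<Rightarrow> 'c" and v
    proof (rule ccontr)
      assume "v \<notin> f ` E"
      then have none: "{e \<in> E. c e = n \<and> f e = v} = {}" for n by auto
      have "colour_count f E c n v = 0" for n unfolding colour_count_def none by simp
      then show False using that by simp
    qed
    have le: "(\<Sum>v\<in>f ` E. colour_squares K f E c' v) \<le> (\<Sum>v\<in>f ` E. colour_squares K f E c v)"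
      and less: "2 \<le> \<bar>colour_count f E c i v - colour_count f E c j v\<bar> \<Longrightarrow>
        (\<Sum>v\<in>f ` E. colour_squares K f E c' v) < (\<Sum>v\<in>f ` E. colour_squares K f E c v)"
      if b: "\<And>v. \<bar>colour_count f F d i v - colour_count f F d j v\<bar> \<le> 1" for f :: "'e \<Rightarrow> 'c" and v
    proof -
      show "(\<Sum>v\<in>f ` E. colour_squares K f E c' v) \<le> (\<Sum>v\<in>f ` E. colour_squares K f E c v)"
        by (intro sum_mono inner_le b)
      assume bad: "2 \<le> \<bar>colour_count f E c i v - colour_count f E c j v\<bar>"
      show "(\<Sum>v\<in>f ` E. colour_squares K f E c' v) < (\<Sum>v\<in>f ` E. colour_squares K f E c v)"
      proof (rule sum_strict_mono_ex1)
        show "\<exists>v\<in>f ` E. colour_squares K f E c' v < colour_squares K f E c v"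
          using absent[OF bad] inner_less[OF b bad] by (rule bexI[rotated])
      qed (use fin inner_le[OF b] in auto)
    qed
    have "pot c' < pot c"
      using bad le[of t, OF dt] less[of t v, OF dt] le[of h, OF dh] less[of h u, OF dh] unfolding pot_def by linarith
    then show False using least[OF c'K] pot0[of c'] by linarith
  qed
  have "colour_count t E c i v \<le> colour_count t E c j v + 1 \<and> colour_count h E c i u \<le> colour_count h E c j u + 1"
    if "i \<in> K" "j \<in> K" for i j u v
    using no_improvement[OF that, of v u] by (cases "i = j") auto
  then show ?thesis using c by blast
qed

lemma equitable_count_bounds:
  assumes fin: "finite E" and K: "finite K" and c: "\<And>e. e \<in> E \<Longrightarrow> c e \<in> K" and i: "i \<in> K"
    and eq: "\<And>i j. i \<in> K \<Longrightarrow> j \<in> K \<Longrightarrow> colour_count f E c i v \<le> colour_count f E c j v + 1"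
  shows "\<bar>int (card K) * colour_count f E c i v - int (card {e \<in> E. f e = v})\<bar> \<le> int (card K) - 1"
proof -
  let ?n = "\<lambda>j. colour_count f E c j v"
  have "card {e \<in> E. f e = v} = (\<Sum>j\<in>K. card {e \<in> {e \<in> E. f e = v}. c e = j})"
    using sum_card_fibres[of K "{e \<in> E. f e = v}" c] fin K c by simp
  also have "\<dots> = (\<Sum>j\<in>K. card {e \<in> E. c e = j \<and> f e = v})"
    by (intro sum.cong refl arg_cong[where f = card]) auto
  finally have total: "int (card {e \<in> E. f e = v}) = (\<Sum>j\<in>K. ?n j)" by (simp add: colour_count_def)
  have "int (card K) * ?n i - (\<Sum>j\<in>K. ?n j) = (\<Sum>j\<in>K. ?n i - ?n j)" by (simp add: sum_subtractf)
  also have "\<dots> = (\<Sum>j\<in>K - {i}. ?n i - ?n j)" using K i by (simp add: sum.remove)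
  finally have e: "int (card K) * ?n i - (\<Sum>j\<in>K. ?n j) = (\<Sum>j\<in>K - {i}. ?n i - ?n j)" .
  have "\<bar>\<Sum>j\<in>K - {i}. ?n i - ?n j\<bar> \<le> (\<Sum>j\<in>K - {i}. \<bar>?n i - ?n j\<bar>)" by (rule sum_abs)
  also have "\<dots> \<le> (\<Sum>j\<in>K - {i}. 1)"
  proof (rule sum_mono)
    fix j assume "j \<in> K - {i}"
    then show "\<bar>?n i - ?n j\<bar> \<le> 1" using eq[of i j] eq[of j i] i by auto
  qed
  also have "\<dots> = int (card K) - 1"
    using K i card_gt_0_iff[of K] by (auto simp: of_nat_diff)
  finally show ?thesis unfolding total e .
qed

section \<open>Decompositions into factors\<close>

text \<open>
  Since \<open>x\<close> leaves the remainder \<open>p\<close>, which is at most the remainder of \<open>d\<close>, there is no carry when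
  \<open>x\<close> and \<open>y\<close> are added: their quotients add up to \<open>d div k\<close>, and \<open>x'\<close> and \<open>y'\<close> are at least these quotients.
\<close>

lemma floor_split:
  fixes k :: int
  assumes k: "1 \<le> k" and d: "d = x + y" and p: "0 \<le> p" "p \<le> d mod k" "k dvd x - p"
    and c: "\<bar>k * x' - x\<bar> \<le> k - 1" "\<bar>k * y' - y\<bar> \<le> k - 1"
  shows "d div k \<le> x' + y'"
proof -
  define q where "q = d div k"
  define r where "r = d mod k"
  have qr: "d = k * q + r" "r < k" using k by (auto simp: q_def r_def)
  obtain z where "x - p = k * z" using p(3) by (rule dvdE)
  then have z: "x = p + k * z" by simp
  have "k * (-1) < k * (x' - z)" using c(1) z p(1) by (simp add: right_diff_distrib)
  then have "z \<le> x'" using k by (simp only: mult_less_cancel_left_pos)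
  have "k * (-1) < k * (y' - (q - z))" 
    using c(2) z p(2)[folded r_def] qr d unfolding right_diff_distrib by linarith
  then have "q - z \<le> y'" using k by (simp only: mult_less_cancel_left_pos)
  then show ?thesis using \<open>z \<le> x'\<close> by (simp add: q_def)
qed

lemma ceiling_split:
  fixes k :: int
  assumes "1 \<le> k" "d = x + y" "0 \<le> p" "p \<le> (- d) mod k" "k dvd x - (- p)"
    and "\<bar>k * x' - x\<bar> \<le> k - 1" "\<bar>k * y' - y\<bar> \<le> k - 1"
  shows "x' + y' \<le> - ((- d) div k)"
proof -
  have "k dvd - (x - (- p))" using assms(5) by (simp only: dvd_minus_iff)
  then have "(- d) div k \<le> - x' + - y'"
    using assms by (intro floor_split[where p = p and x = "- x" and y = "- y"]) auto
  then show ?thesis by simp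
qed

context multigraph
begin

lemma equitable_decomposition:
  assumes k: "k > 0" and o: "orients G t h"
  shows "\<exists>H. edge_decomposition G k H \<and> (\<forall>v. \<forall>i\<in>{1..k}. \<exists>x y. int (degree (H i) v) = x + y \<and>
      \<bar>int k * x - int (card {e \<in> edges G. t e = v})\<bar> \<le> int k - 1 \<and>
      \<bar>int k * y - int (card {e \<in> edges G. h e = v})\<bar> \<le> int k - 1)"
proof -
  have "finite {1..k}" "{1..k} \<noteq> {}" using k by auto
  from equitable_colouring[OF finite_edges this, of t h]
  obtain c where c: "\<forall>e. c e \<in> {1..k}"
    and ct: "\<And>i j v. i \<in> {1..k} \<Longrightarrow> j \<in> {1..k} \<Longrightarrow> colour_count t (edges G) c i v \<le> colour_count t (edges G) c j v + 1"
    and ch: "\<And>i j v. i \<in> {1..k} \<Longrightarrow> j \<in> {1..k} \<Longrightarrow> colour_count h (edges G) c i v \<le> colour_count h (edges G) c j v + 1"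
    by blast
  define H where "H i = G\<lparr>edges := {e \<in> edges G. c e = i}\<rparr>" for i
  have H: "verts (H i) = verts G" "edges (H i) = {e \<in> edges G. c e = i}" "ends (H i) = ends G" for i
    by (simp_all add: H_def)
  have "edge_decomposition G k H"
    using c by (auto simp: edge_decomposition_def is_factor_def disjoint_family_on_def H)
  moreover have "int (degree (H i) v) = colour_count t (edges G) c i v + colour_count h (edges G) c i v" for i v
  proof -
    have "orients (H i) t h" using o by (auto simp: orients_def H)
    moreover have "finite (edges (H i))" using finite_edges by (simp add: H)
    ultimately show ?thesis by (simp add: degree_orients H colour_count_def conj_ac)
  qed
  moreover have "\<bar>int k * colour_count t (edges G) c i v - int (card {e \<in> edges G. t e = v})\<bar> \<le> int k - 1"
    "\<bar>int k * colour_count h (edges G) c i v - int (card {e \<in> edges G. h e = v})\<bar> \<le> int k - 1"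
    if "i \<in> {1..k}" for i v
    using equitable_count_bounds[OF finite_edges _ _ that ct, of v] equitable_count_bounds[OF finite_edges _ _ that ch, of v] c
    by simp_all
  ultimately show ?thesis by blast
qed

lemma decomposition_sizes:
  assumes "edge_decomposition G k H"
  shows "(\<Sum>i\<in>{1..k}. card (edges (H i))) = card (edges G)"
    and "i \<in> {1..k} \<Longrightarrow> (\<Sum>v\<in>verts G. degree (H i) v) = 2 * card (edges (H i))"
proof -
  have sub: "edges (H i) \<subseteq> edges G" if "i \<in> {1..k}" for i
    using assms that by (auto simp: edge_decomposition_def is_factor_def)
  have "card (\<Union>i\<in>{1..k}. edges (H i)) = (\<Sum>i\<in>{1..k}. card (edges (H i)))"
  proof (rule card_UN_disjoint)
    show "\<forall>i\<in>{1..k}. finite (edges (H i))" using sub finite_subset[OF _ finite_edges] by blast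
    show "\<forall>i\<in>{1..k}. \<forall>j\<in>{1..k}. i \<noteq> j \<longrightarrow> edges (H i) \<inter> edges (H j) = {}"
      using assms unfolding edge_decomposition_def disjoint_family_on_def by blast
  qed simp
  then show "(\<Sum>i\<in>{1..k}. card (edges (H i))) = card (edges G)"
    using assms by (simp add: edge_decomposition_def)
  assume i: "i \<in> {1..k}"
  then have f: "is_factor (H i) G" using assms by (simp add: edge_decomposition_def)
  interpret F: multigraph "H i"
    using f finite_verts finite_edges finite_subset[OF sub[OF i] finite_edges] ends_in_verts
    by unfold_locales (auto simp: is_factor_def)
  show "(\<Sum>v\<in>verts G. degree (H i) v) = 2 * card (edges (H i))"
    using F.handshake f by (simp add: is_factor_def)
qed

text \<open>
  The sign \<open>s\<close> covers lower bounds (\<open>s = 1\<close>) and upper bounds (\<open>s = - 1\<close>).  The degree sum of a factor is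
  even and cannot equal an odd sum of bounds, so each of the \<open>k\<close> factors contributes a defect of at
  least one.
\<close>

lemma odd_bound_defect:
  fixes f :: "'v \<Rightarrow> int"
  assumes k: "k > 0" and dec: "edge_decomposition G k H" and s: "s = 1 \<or> s = -1"
    and bound: "\<And>v i. v \<in> verts G \<Longrightarrow> i \<in> {1..k} \<Longrightarrow> s * f v \<le> s * int (degree (H i) v)"
    and odd: "odd (\<Sum>v\<in>verts G. f v)"
  shows "int k \<le> s * (\<Sum>v\<in>verts G. int (degree G v) - int k * f v)"
proof -
  let ?F = "\<Sum>v\<in>verts G. f v"
  have each: "s * ?F + 1 \<le> 2 * s * int (card (edges (H i)))" if i: "i \<in> {1..k}" for i
  proof -
    have "s * ?F \<le> s * (\<Sum>v\<in>verts G. int (degree (H i) v))"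
      unfolding sum_distrib_left by (intro sum_mono bound i)
    also have "(\<Sum>v\<in>verts G. int (degree (H i) v)) = 2 * int (card (edges (H i)))"
      using decomposition_sizes(2)[OF dec i] by (simp flip: of_nat_sum)
    finally have "s * ?F \<le> 2 * (s * int (card (edges (H i))))" by simp
    moreover have "odd (s * ?F)" using odd s by auto
    then have "s * ?F \<noteq> 2 * (s * int (card (edges (H i))))" by (metis dvd_triv_left)
    ultimately show ?thesis unfolding mult.assoc by linarith
  qed
  have "int k * (s * ?F + 1) = (\<Sum>i\<in>{1..k}. s * ?F + 1)" by simp
  also have "\<dots> \<le> (\<Sum>i\<in>{1..k}. 2 * s * int (card (edges (H i))))" by (intro sum_mono each)
  also have "\<dots> = 2 * s * int (card (edges G))"
    unfolding decomposition_sizes(1)[OF dec, symmetric] by (simp add: sum_distrib_left)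
  also have "\<dots> = s * (\<Sum>v\<in>verts G. int (degree G v))"
    using handshake by (simp flip: of_nat_sum)
  finally show ?thesis by (simp add: sum_subtractf algebra_simps flip: sum_distrib_left)
qed

text \<open>
  The sum of the \<open>p v\<close> can be any number up to the sum \<open>R\<close> of the \<open>r v\<close>.  If \<open>R \<ge> k - 1\<close>, this meets
  all residues.  If the \<open>f v\<close> have an even sum \<open>2g\<close>, then the handshake identity says that twice the number
  of edges is \<open>2kg + sR\<close>, and \<open>s * (R / 2)\<close> has the required residue.
\<close>

lemma sufficient_residues:
  fixes r f :: "'v \<Rightarrow> int"
  assumes k: "k > 0" and r: "\<And>v. 0 \<le> r v" and s: "s = 1 \<or> s = -1"
    and deg: "\<And>v. v \<in> verts G \<Longrightarrow> int (degree G v) = int k * f v + s * r v"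
    and cond: "even (\<Sum>v\<in>verts G. f v) \<or> int k - 1 \<le> (\<Sum>v\<in>verts G. r v)"
  shows "\<exists>p. (\<forall>v. 0 \<le> p v \<and> p v \<le> r v) \<and> int k dvd s * (\<Sum>v\<in>verts G. p v) - int (card (edges G))"
proof -
  let ?R = "\<Sum>v\<in>verts G. r v" and ?E = "int (card (edges G))"
  have R0: "0 \<le> ?R" using r by (simp add: sum_nonneg)
  have "\<exists>n. 0 \<le> n \<and> n \<le> ?R \<and> int k dvd s * n - ?E"
  proof (cases "int k - 1 \<le> ?R")
    case True
    have "0 \<le> (s * ?E) mod int k" using k by simp
    moreover have "(s * ?E) mod int k < int k" by (rule pos_mod_bound) (use k in simp)
    then have "(s * ?E) mod int k \<le> ?R" using True by linarith
    moreover have "int k dvd s * ((s * ?E) mod int k) - ?E"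
    proof -
      have "int k dvd (s * ?E) mod int k - s * ?E" by (metis dvd_minus_mod dvd_minus_iff minus_diff_eq)
      then have "int k dvd s * ((s * ?E) mod int k - s * ?E)" by (rule dvd_mult)
      moreover have "s * s = 1" using s by auto
      ultimately show ?thesis by (simp add: right_diff_distrib flip: mult.assoc)
    qed
    ultimately show ?thesis by blast
  next
    case False
    then obtain g where g: "(\<Sum>v\<in>verts G. f v) = 2 * g" using cond by blast
    have "2 * ?E = (\<Sum>v\<in>verts G. int (degree G v))" using handshake by (simp flip: of_nat_sum)
    also have "\<dots> = int k * (\<Sum>v\<in>verts G. f v) + s * ?R"
      using deg by (simp add: sum.distrib flip: sum_distrib_left)
    finally have E: "2 * ?E = 2 * (int k * g) + s * ?R" using g by simp
    then have "even ?R" using s by (metis dvd_add_right_iff dvd_triv_left even_minus mult_1 mult_minus1)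
    then obtain n where n: "?R = 2 * n" by blast
    have "s * n - ?E = - (int k * g)" using E n s by auto
    then have "int k dvd s * n - ?E" by simp
    moreover have "0 \<le> n" "n \<le> ?R" using n R0 by auto
    ultimately show ?thesis by blast
  qed
  then obtain n where n: "0 \<le> n" "n \<le> ?R" "int k dvd s * n - ?E" by blast
  obtain p where "\<forall>v. 0 \<le> p v \<and> p v \<le> r v" "sum p (verts G) = n"
    using distribute[OF finite_verts r n(1,2)] by blast
  then show ?thesis using n(3) by blast
qed

lemma decomposition_of_residues:
  assumes k: "k > 0" and conn: "edge_connected (3 * k - 3) G \<or> tree_connected (2 * k - 2) G"
    and total: "int k dvd sum p (verts G) - int (card (edges G))"
    and enough: "\<And>v x y x' y'. int (degree G v) = x + y \<Longrightarrow> int k dvd x - p v \<Longrightarrow>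
      \<bar>int k * x' - x\<bar> \<le> int k - 1 \<Longrightarrow> \<bar>int k * y' - y\<bar> \<le> int k - 1 \<Longrightarrow> Q v (x' + y')"
  shows "\<exists>H. edge_decomposition G k H \<and> (\<forall>v\<in>verts G. \<forall>i\<in>{1..k}. Q v (int (degree (H i) v)))"
proof -
  obtain t h where o: "orients G t h"
    and out: "\<forall>v\<in>verts G. int k dvd int (card {e \<in> edges G. t e = v}) - p v"
    using modular_orientation[OF k conn total] by blast
  obtain H where H: "edge_decomposition G k H"
    and deg: "\<And>v i. i \<in> {1..k} \<Longrightarrow> \<exists>x y. int (degree (H i) v) = x + y \<and>
      \<bar>int k * x - int (card {e \<in> edges G. t e = v})\<bar> \<le> int k - 1 \<and>
      \<bar>int k * y - int (card {e \<in> edges G. h e = v})\<bar> \<le> int k - 1"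
    using equitable_decomposition[OF k o] by blast
  have "Q v (int (degree (H i) v))" if v: "v \<in> verts G" and i: "i \<in> {1..k}" for v i
  proof -
    have "int (degree G v) = int (card {e \<in> edges G. t e = v}) + int (card {e \<in> edges G. h e = v})"
      using degree_orients[OF finite_edges o, of v] by simp
    note Q = enough[OF this bspec[OF out v]]
    obtain x y where xy: "int (degree (H i) v) = x + y"
      "\<bar>int k * x - int (card {e \<in> edges G. t e = v})\<bar> \<le> int k - 1"
      "\<bar>int k * y - int (card {e \<in> edges G. h e = v})\<bar> \<le> int k - 1" using deg[OF i, of v] by blast
    show ?thesis unfolding xy(1) by (rule Q[OF xy(2,3)])
  qed
  then show ?thesis using H by blast
qed

end

theorem corollary6p3:
  fixes G :: "('v, 'e) mgraph" and k :: nat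
  assumes "multigraph G"
    and "k > 0"
    and "edge_connected (3 * k - 3) G \<or> tree_connected (2 * k - 2) G"
  shows "((\<exists>H. edge_decomposition G k H \<and>
              (\<forall>v \<in> verts G. \<forall>i \<in> {1..k}.
                 int (degree (H i) v) \<ge> \<lfloor>real (degree G v) / real k\<rfloor>))
          \<longleftrightarrow> even (\<Sum>v \<in> verts G. \<lfloor>real (degree G v) / real k\<rfloor>)
            \<or> (\<Sum>v \<in> verts G. int (degree G v) mod int k) \<ge> int k - 1)
       \<and> ((\<exists>H. edge_decomposition G k H \<and>
              (\<forall>v \<in> verts G. \<forall>i \<in> {1..k}.
                 int (degree (H i) v) \<le> \<lceil>real (degree G v) / real k\<rceil>))
          \<longleftrightarrow> even (\<Sum>v \<in> verts G. \<lceil>real (degree G v) / real k\<rceil>)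
            \<or> (\<Sum>v \<in> verts G. (int k - int (degree G v)) mod int k) \<ge> int k - 1)"
proof -
  interpret multigraph G by (rule assms(1))
  note k = assms(2)
  define fl where "fl v = int (degree G v) div int k" for v
  define ce where "ce v = - ((- int (degree G v)) div int k)" for v
  define r where "r v = int (degree G v) mod int k" for v
  define r' where "r' v = (- int (degree G v)) mod int k" for v
  have fl: "\<lfloor>real (degree G v) / real k\<rfloor> = fl v" for v
    by (simp add: fl_def floor_divide_of_nat_eq zdiv_int)
  have ce: "\<lceil>real (degree G v) / real k\<rceil> = ce v" for v
    using ceiling_divide_eq_div[of "int (degree G v)" "int k"] by (simp add: ce_def)
  have r': "(int k - int (degree G v)) mod int k = r' v" for v
    by (simp add: r'_def mod_diff_left_eq flip: mod_diff_left_eq[of "int k"])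
  have split_fl: "int (degree G v) = int k * fl v + 1 * r v" for v by (simp add: fl_def r_def)
  have split_ce: "int (degree G v) = int k * ce v + (-1) * r' v" for v
  proof -
    have "int k * ((- int (degree G v)) div int k) + (- int (degree G v)) mod int k = - int (degree G v)"
      by (rule mult_div_mod_eq)
    then show ?thesis unfolding ce_def r'_def mult_minus_right by linarith
  qed
  have r0: "0 \<le> r v" "0 \<le> r' v" for v using k by (simp_all add: r_def r'_def)
  have k1: "1 \<le> int k" using k by simp
  have a: "(\<exists>H. edge_decomposition G k H \<and> (\<forall>v \<in> verts G. \<forall>i \<in> {1..k}. fl v \<le> int (degree (H i) v)))
      \<longleftrightarrow> even (\<Sum>v\<in>verts G. fl v) \<or> int k - 1 \<le> (\<Sum>v\<in>verts G. r v)" (is "?L \<longleftrightarrow> ?R")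
  proof
    assume ?L
    then obtain H where H: "edge_decomposition G k H" "\<forall>v \<in> verts G. \<forall>i \<in> {1..k}. fl v \<le> int (degree (H i) v)"
      by blast
    show ?R
    proof (rule disjCI)
      assume "\<not> int k - 1 \<le> (\<Sum>v\<in>verts G. r v)"
      then show "even (\<Sum>v\<in>verts G. fl v)"
        using odd_bound_defect[OF k H(1), of 1 fl] H(2) split_fl by fastforce
    qed
  next
    assume cond: ?R
    obtain p where p: "\<forall>v. 0 \<le> p v \<and> p v \<le> r v"
      and total: "int k dvd sum p (verts G) - int (card (edges G))"
      using sufficient_residues[OF k r0(1) _ split_fl cond] by auto
    show ?L
    proof (rule decomposition_of_residues[OF k assms(3) total])
      fix v and x y x' y' :: int
      assume *: "int (degree G v) = x + y" and **: "int k dvd x - p v"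
        "\<bar>int k * x' - x\<bar> \<le> int k - 1" "\<bar>int k * y' - y\<bar> \<le> int k - 1"
      show "fl v \<le> x' + y'"
        unfolding fl_def by (rule floor_split[OF k1 * _ _ **]) (use p in \<open>simp_all add: r_def\<close>)
    qed
  qed
  have b: "(\<exists>H. edge_decomposition G k H \<and> (\<forall>v \<in> verts G. \<forall>i \<in> {1..k}. int (degree (H i) v) \<le> ce v))
      \<longleftrightarrow> even (\<Sum>v\<in>verts G. ce v) \<or> int k - 1 \<le> (\<Sum>v\<in>verts G. r' v)" (is "?L \<longleftrightarrow> ?R")
  proof
    assume ?L
    then obtain H where H: "edge_decomposition G k H" "\<forall>v \<in> verts G. \<forall>i \<in> {1..k}. int (degree (H i) v) \<le> ce v"
      by blast
    show ?R
    proof (rule disjCI)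
      assume "\<not> int k - 1 \<le> (\<Sum>v\<in>verts G. r' v)"
      then show "even (\<Sum>v\<in>verts G. ce v)"
        using odd_bound_defect[OF k H(1), of "-1" ce] H(2) split_ce by (fastforce simp: sum_negf)
    qed
  next
    assume cond: ?R
    obtain p where p: "\<forall>v. 0 \<le> p v \<and> p v \<le> r' v"
      and total: "int k dvd sum (\<lambda>v. - p v) (verts G) - int (card (edges G))"
      using sufficient_residues[OF k r0(2) _ split_ce cond] by (auto simp: sum_negf)
    show ?L
    proof (rule decomposition_of_residues[OF k assms(3) total])
      fix v and x y x' y' :: int
      assume *: "int (degree G v) = x + y" and **: "int k dvd x - (- p v)"
        "\<bar>int k * x' - x\<bar> \<le> int k - 1" "\<bar>int k * y' - y\<bar> \<le> int k - 1"
      show "x' + y' \<le> ce v"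
        unfolding ce_def by (rule ceiling_split[OF k1 * _ _ **]) (use p in \<open>simp_all add: r'_def\<close>)
    qed
  qed
  show ?thesis unfolding fl ce r' r_def[symmetric] using a b by blast
qed

end
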